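(* Let $X_1,\ldots,X_n$ be a stationary, reversible, time homogeneous, $\phi$-irreducible, aperiodic Markov chain with Polish state space $\Omega$ and unique stationary distribution $\pi$ (so $X_1\sim\pi$), with spectral gap $\gamma>0$ and absolute spectral gap $\gamma^*$. Let $f$ be a measurable function in $L^2(\pi)$, $V_f:=\mathrm{Var}_\pi(f)$, and let the asymptotic variance be $$\sigma_{\mathrm{as}}^2:=\left\langle \bar f,\left(2(\boldsymbol{I}-(\boldsymbol{P}-\boldsymbol{\pi}))^{-1}-\boldsymbol{I}\right)\bar f\right\rangle_\pi,\qquad \bar f:=f-\mathbb{E}_\pi(f).$$ Then $$\mathrm{Var}_\pi[f(X_1)+\cdots+f(X_n)]\le\frac{2nV_f}{\gamma},$$ $$\left|\mathrm{Var}_\pi[f(X_1)+\cdots+f(X_n)]-n\sigma_{\mathrm{as}}^2\right|\le 4V_f/\gamma^2.$$ More generally, let $f_1,\ldots,f_n$ be functions in $L^2(\pi)$; then $$\mathrm{Var}_\pi[f_1(X_1)+\cdots+f_n(X_n)]\le\frac{2}{\gamma^*}\sum_{i=1}^n\mathrm{Var}_\pi[f_i(X_i)].$$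
   Context: $\mathbb{E}_\pi$, $\mathrm{Var}_\pi$ refer to the chain started from $X_1\sim\pi$. $L^2(\pi)$ is the Hilbert space of square integrable functions on $\Omega$ with $\langle f,g\rangle_\pi=\int f g^*\,d\pi$. For the Markov kernel $P(x,dy)$, $(\boldsymbol{P}f)(x)=\int f(y)P(x,dy)$; $\boldsymbol{I}$ is the identity and $\boldsymbol{\pi}$ is the projection $\boldsymbol{\pi}(f)(x)=\mathbb{E}_\pi(f)$ on $L^2(\pi)$. Reversible: $\pi(dx)P(x,dy)=\pi(dy)P(y,dx)$, i.e. $\boldsymbol{P}$ is self-adjoint. With $S_2\subset\mathbb{R}$ the spectrum of $\boldsymbol{P}$ on (complex) $L^2(\pi)$: $\gamma:=1-\sup\{\lambda\in S_2:\lambda\ne1\}$ and $\gamma^*:=1-\sup\{|\lambda|:\lambda\in S_2,\lambda\ne1\}$ if the eigenvalue $1$ has multiplicity $1$; both are $0$ otherwise. If $\gamma^*=0$ the last bound is trivial (right hand side read as $+\infty$). $\phi$-irreducible: there is a non-zero $\sigma$-finite measure $\phi$ on $\Omega$ such that for all $A$ with $\phi(A)>0$ and all $x\in\Omega$ there is $n\ge1$ with $P^n(x,A)>0$. Aperiodic: there are no $d\ge2$ and disjoint $\Omega_1,\ldots,\Omega_d\subset\Omega$ with $\pi(\Omega_1)>0$, $P(x,\Omega_{i+1})=1$ for $x\in\Omega_i$ ($i\le d-1$), and $P(x,\Omega_1)=1$ for $x\in\Omega_d$. *)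

theory Defs
  imports "HOL-Probability.Probability"
begin

section \<open>Markov kernels and chains\<close>

text \<open>A Markov kernel on a Polish space is \<open>P \<in> borel \<rightarrow>\<^sub>M prob_algebra borel\<close>.\<close>

definition stationary_dist :: "('a::topological_space \<Rightarrow> 'a measure) \<Rightarrow> 'a measure \<Rightarrow> bool" where
  "stationary_dist P \<nu> \<longleftrightarrow> prob_space \<nu> \<and> sets \<nu> = sets borel \<and> bind \<nu> P = \<nu>"

text \<open>\<open>\<pi>(dx) P(x,dy) = \<pi>(dy) P(y,dx)\<close> as measures on the product space.\<close>

definition reversible :: "('a::topological_space \<Rightarrow> 'a measure) \<Rightarrow> 'a measure \<Rightarrow> bool" where
  "reversible P \<pi> \<longleftrightarrow>
     bind \<pi> (\<lambda>x. bind (P x) (\<lambda>y. return (borel \<Otimes>\<^sub>M borel) (x, y))) =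
     bind \<pi> (\<lambda>y. bind (P y) (\<lambda>x. return (borel \<Otimes>\<^sub>M borel) (x, y)))"

primrec kernel_power ::
  "('a::topological_space \<Rightarrow> 'a measure) \<Rightarrow> nat \<Rightarrow> 'a \<Rightarrow> 'a measure" where
  "kernel_power P 0 x = return borel x"
| "kernel_power P (Suc n) x = bind (P x) (kernel_power P n)"

definition phi_irreducible :: "('a::topological_space \<Rightarrow> 'a measure) \<Rightarrow> bool" where
  "phi_irreducible P \<longleftrightarrow>
     (\<exists>\<phi>. sigma_finite_measure \<phi> \<and> sets \<phi> = sets borel \<and> emeasure \<phi> UNIV \<noteq> 0 \<and>
        (\<forall>A \<in> sets borel. emeasure \<phi> A > 0 \<longrightarrow>
           (\<forall>x. \<exists>n\<ge>1. measure (kernel_power P n x) A > 0)))"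

definition aperiodic :: "('a::topological_space \<Rightarrow> 'a measure) \<Rightarrow> 'a measure \<Rightarrow> bool" where
  "aperiodic P \<pi> \<longleftrightarrow>
     \<not> (\<exists>(d::nat) (D :: nat \<Rightarrow> 'a set). d \<ge> 2 \<and>
          (\<forall>i\<in>{1..d}. D i \<in> sets borel) \<and> disjoint_family_on D {1..d} \<and>
          measure \<pi> (D 1) > 0 \<and>
          (\<forall>i\<in>{1..d-1}. \<forall>x\<in>D i. measure (P x) (D (Suc i)) = 1) \<and>
          (\<forall>x\<in>D d. measure (P x) (D 1) = 1))"

text \<open>The \<open>\<sigma>\<close>-algebra generated by \<open>X\<^sub>1, \<dots>, X\<^sub>i\<close>.\<close>

definition past :: "'w measure \<Rightarrow> (nat \<Rightarrow> 'w \<Rightarrow> 'a::topological_space) \<Rightarrow> nat \<Rightarrow> 'w measure" where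
  "past M X i =
     sigma (space M) (\<Union>j\<in>{1..i}. {X j -` A \<inter> space M | A. A \<in> sets borel})"

text \<open>\<open>X\<^sub>1, \<dots>, X\<^sub>n\<close> is a time homogeneous Markov chain with kernel \<open>P\<close>:
  \<open>\<P>(X\<^sub>i\<^sub>+\<^sub>1 \<in> A | X\<^sub>1, \<dots>, X\<^sub>i) = P(X\<^sub>i, A)\<close> almost surely.\<close>

definition markov_chain ::
  "'w measure \<Rightarrow> ('a::topological_space \<Rightarrow> 'a measure) \<Rightarrow> nat \<Rightarrow> (nat \<Rightarrow> 'w \<Rightarrow> 'a) \<Rightarrow> bool" where
  "markov_chain M P n X \<longleftrightarrow>
     prob_space M \<and> (\<forall>i\<in>{1..n}. X i \<in> M \<rightarrow>\<^sub>M borel) \<and>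
     (\<forall>i\<in>{1..<n}. \<forall>A \<in> sets borel.
        AE w in M. real_cond_exp M (past M X i) (\<lambda>v. indicator A (X (Suc i) v)) w
                   = measure (P (X i w)) A)"

section \<open>The complex Hilbert space of square integrable functions\<close>

text \<open>Elements of \<open>L\<^sup>2(\<pi>)\<close> are represented by functions, and equality in \<open>L\<^sup>2(\<pi>)\<close> is
  equality \<open>\<pi>\<close>-almost everywhere.\<close>

definition L2 :: "'a measure \<Rightarrow> ('a \<Rightarrow> complex) set" where
  "L2 \<pi> = {f. f \<in> borel_measurable \<pi> \<and> integrable \<pi> (\<lambda>x. (cmod (f x))\<^sup>2)}"

definition L2_inner :: "'a measure \<Rightarrow> ('a \<Rightarrow> complex) \<Rightarrow> ('a \<Rightarrow> complex) \<Rightarrow> complex" where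
  "L2_inner \<pi> f g = (\<integral>x. f x * cnj (g x) \<partial>\<pi>)"

definition L2_norm :: "'a measure \<Rightarrow> ('a \<Rightarrow> complex) \<Rightarrow> real" where
  "L2_norm \<pi> f = sqrt (\<integral>x. (cmod (f x))\<^sup>2 \<partial>\<pi>)"

text \<open>Linearity and boundedness force such a map to respect equality almost everywhere, so it
  is a bounded operator on the quotient.\<close>

definition L2_bounded_operator ::
  "'a measure \<Rightarrow> (('a \<Rightarrow> complex) \<Rightarrow> ('a \<Rightarrow> complex)) \<Rightarrow> bool" where
  "L2_bounded_operator \<pi> T \<longleftrightarrow>
     (\<forall>f \<in> L2 \<pi>. T f \<in> L2 \<pi>) \<and>
     (\<forall>f \<in> L2 \<pi>. \<forall>g \<in> L2 \<pi>. AE x in \<pi>. T (\<lambda>y. f y + g y) x = T f x + T g x) \<and>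
     (\<forall>c. \<forall>f \<in> L2 \<pi>. AE x in \<pi>. T (\<lambda>y. c * f y) x = c * T f x) \<and>
     (\<exists>C. \<forall>f \<in> L2 \<pi>. L2_norm \<pi> (T f) \<le> C * L2_norm \<pi> f)"

definition L2_is_inverse ::
  "'a measure \<Rightarrow> (('a \<Rightarrow> complex) \<Rightarrow> ('a \<Rightarrow> complex)) \<Rightarrow>
   (('a \<Rightarrow> complex) \<Rightarrow> ('a \<Rightarrow> complex)) \<Rightarrow> bool" where
  "L2_is_inverse \<pi> T S \<longleftrightarrow>
     L2_bounded_operator \<pi> S \<and>
     (\<forall>f \<in> L2 \<pi>. (AE x in \<pi>. S (T f) x = f x) \<and> (AE x in \<pi>. T (S f) x = f x))"

text \<open>When \<open>T\<close> is a bounded operator with bounded inverse, the choice below is unique up to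
  equality almost everywhere.\<close>

definition L2_inverse ::
  "'a measure \<Rightarrow> (('a \<Rightarrow> complex) \<Rightarrow> ('a \<Rightarrow> complex)) \<Rightarrow> ('a \<Rightarrow> complex) \<Rightarrow> ('a \<Rightarrow> complex)" where
  "L2_inverse \<pi> T = (SOME S. L2_is_inverse \<pi> T S)"

definition L2_spectrum ::
  "'a measure \<Rightarrow> (('a \<Rightarrow> complex) \<Rightarrow> ('a \<Rightarrow> complex)) \<Rightarrow> complex set" where
  "L2_spectrum \<pi> T = {z. \<not> (\<exists>S. L2_is_inverse \<pi> (\<lambda>f x. z * f x - T f x) S)}"

definition L2_eigenspace ::
  "'a measure \<Rightarrow> (('a \<Rightarrow> complex) \<Rightarrow> ('a \<Rightarrow> complex)) \<Rightarrow> complex \<Rightarrow> ('a \<Rightarrow> complex) set" where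
  "L2_eigenspace \<pi> T z = {f \<in> L2 \<pi>. AE x in \<pi>. T f x = z * f x}"

text \<open>The eigenspace is one-dimensional modulo equality almost everywhere.\<close>

definition L2_eigenvalue_mult_one ::
  "'a measure \<Rightarrow> (('a \<Rightarrow> complex) \<Rightarrow> ('a \<Rightarrow> complex)) \<Rightarrow> complex \<Rightarrow> bool" where
  "L2_eigenvalue_mult_one \<pi> T z \<longleftrightarrow>
     (\<exists>e \<in> L2_eigenspace \<pi> T z. \<not> (AE x in \<pi>. e x = 0) \<and>
        (\<forall>f \<in> L2_eigenspace \<pi> T z. \<exists>c. AE x in \<pi>. f x = c * e x))"

section \<open>Spectral gaps and variances\<close>

definition markov_op :: "('a \<Rightarrow> 'a measure) \<Rightarrow> ('a \<Rightarrow> complex) \<Rightarrow> ('a \<Rightarrow> complex)" where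
  "markov_op P f = (\<lambda>x. \<integral>y. f y \<partial>(P x))"

definition mean_op :: "'a measure \<Rightarrow> ('a \<Rightarrow> complex) \<Rightarrow> ('a \<Rightarrow> complex)" where
  "mean_op \<pi> f = (\<lambda>_. \<integral>y. f y \<partial>\<pi>)"

text \<open>The gaps are extended reals so that the supremum over the empty set (for reversible
  kernels, the case of a one-dimensional \<open>L\<^sup>2(\<pi>)\<close>) is \<open>-\<infinity>\<close> and the gap is then \<open>\<infinity>\<close>.  In the
  reversible case the spectrum is real, so \<open>Re z\<close> is just the spectral value itself.\<close>

definition spectral_gap :: "'a measure \<Rightarrow> ('a \<Rightarrow> 'a measure) \<Rightarrow> ereal" where
  "spectral_gap \<pi> P =
     (if L2_eigenvalue_mult_one \<pi> (markov_op P) 1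
      then 1 - (SUP z \<in> {z \<in> L2_spectrum \<pi> (markov_op P). z \<noteq> 1}. ereal (Re z))
      else 0)"

definition absolute_spectral_gap :: "'a measure \<Rightarrow> ('a \<Rightarrow> 'a measure) \<Rightarrow> ereal" where
  "absolute_spectral_gap \<pi> P =
     (if L2_eigenvalue_mult_one \<pi> (markov_op P) 1
      then 1 - (SUP z \<in> {z \<in> L2_spectrum \<pi> (markov_op P). z \<noteq> 1}. ereal (cmod z))
      else 0)"

definition complex_variance :: "'w measure \<Rightarrow> ('w \<Rightarrow> complex) \<Rightarrow> real" where
  "complex_variance M Z = (\<integral>w. (cmod (Z w - (\<integral>v. Z v \<partial>M)))\<^sup>2 \<partial>M)"

definition asymptotic_variance ::
  "'a measure \<Rightarrow> ('a \<Rightarrow> 'a measure) \<Rightarrow> ('a \<Rightarrow> complex) \<Rightarrow> complex" where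
  "asymptotic_variance \<pi> P f =
     (let fbar = (\<lambda>x. f x - (\<integral>y. f y \<partial>\<pi>));
          R = L2_inverse \<pi> (\<lambda>h x. h x - (markov_op P h x - mean_op \<pi> h x))
      in L2_inner \<pi> fbar (\<lambda>x. 2 * R fbar x - fbar x))"

end

theory Submission
  imports Defs "HOL-Library.Function_Algebras"
begin

text \<open>
  On mean zero functions in \<open>L\<^sup>2(\<pi>)\<close> the Markov operator \<open>A\<close> is a self-adjoint contraction, and
  \<open>Var(f\<^sub>1(X\<^sub>1) + \<dots> + f\<^sub>n(X\<^sub>n)) = \<Sum>\<^sub>i\<^sub>j \<langle>A\<^bsup>|i - j|\<^esup> f\<^sub>i, f\<^sub>j\<rangle>\<close> for centred \<open>f\<^sub>i\<close>.
  The spectral theorem is avoided. Extremal values of quadratic forms of self-adjoint operators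
  are spectral values, so with \<open>B = I - A\<close> the absence of spectrum of \<open>A\<close> in \<open>(1 - \<gamma>, 1)\<close> gives
  \<open>(B - \<gamma>/2)\<^sup>2 \<ge> (\<gamma>/2)\<^sup>2\<close>, i.e. \<open>B\<^sup>2 \<ge> \<gamma> B\<close>. This yields \<open>B \<ge> \<gamma>\<close> on the closure of the range
  of \<open>B\<close>, which is everything because \<open>1\<close> is a simple eigenvalue. In particular the Poisson
  equation \<open>u - A u = f\<close> has a solution with \<open>\<parallel>u\<parallel> \<le> \<parallel>f\<parallel> / \<gamma>\<close>, and the double sum of covariances
  telescopes in terms of \<open>u\<close>. The bound by \<open>\<gamma>\<^sup>*\<close> follows from \<open>\<parallel>A\<parallel> \<le> 1 - \<gamma>\<^sup>*\<close> and
  the summation of a geometric series.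
\<close>

section \<open>Symmetric operators on semi-inner product spaces\<close>

text \<open>The ambient space is real: the form is the real part of the complex inner product, for
  which a self-adjoint complex operator is symmetric. Vectors are functions rather than classes, so
  the form is only semidefinite and operator identities hold up to null vectors. From the gap
  hypotheses only one consequence is extracted: for real \<open>l\<close> off the spectrum,
  \<open>l - A\<close> is bounded below. A lower bound, unlike invertibility, restricts at once to
  the subspace of mean zero functions. The obstacle is the point 1. The gaps are defined by removing
  it from the spectrum on the whole of L2, so nothing is given about \<open>1 - A\<close> on mean
  zero functions except that its kernel is null. What has to be shown is an instance of the fact
  that an isolated spectral point of a self-adjoint operator is an eigenvalue; this is the content
  of \<open>lap_bounded_below\<close>.\<close>

locale semi_inner_space =
  fixes H :: "'b::real_vector set" and ip :: "'b \<Rightarrow> 'b \<Rightarrow> real"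
  assumes subspace_H: "subspace H"
    and ip_commute: "f \<in> H \<Longrightarrow> g \<in> H \<Longrightarrow> ip f g = ip g f"
    and ip_add_left: "f \<in> H \<Longrightarrow> g \<in> H \<Longrightarrow> h \<in> H \<Longrightarrow> ip (f + g) h = ip f h + ip g h"
    and ip_scaleR_left: "f \<in> H \<Longrightarrow> g \<in> H \<Longrightarrow> ip (a *\<^sub>R f) g = a * ip f g"
    and ip_nonneg: "f \<in> H \<Longrightarrow> 0 \<le> ip f f"
begin

lemma H_closed [simp, intro]:
  "0 \<in> H" "f \<in> H \<Longrightarrow> g \<in> H \<Longrightarrow> f + g \<in> H" "f \<in> H \<Longrightarrow> a *\<^sub>R f \<in> H"
  "f \<in> H \<Longrightarrow> g \<in> H \<Longrightarrow> f - g \<in> H" "f \<in> H \<Longrightarrow> - f \<in> H"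
  using subspace_H by (auto intro: subspace_0 subspace_add subspace_scale subspace_diff subspace_neg)

lemma ip_diff_left: "f \<in> H \<Longrightarrow> g \<in> H \<Longrightarrow> h \<in> H \<Longrightarrow> ip (f - g) h = ip f h - ip g h"
  using ip_add_left[of f "-1 *\<^sub>R g" h] ip_scaleR_left[of g h "-1"] H_closed(3)[of g "-1"] by simp

lemma ip_add_right: "f \<in> H \<Longrightarrow> g \<in> H \<Longrightarrow> h \<in> H \<Longrightarrow> ip h (f + g) = ip h f + ip h g"
  by (metis H_closed(2) ip_add_left ip_commute)

lemma ip_diff_right: "f \<in> H \<Longrightarrow> g \<in> H \<Longrightarrow> h \<in> H \<Longrightarrow> ip h (f - g) = ip h f - ip h g"
  by (metis H_closed(4) ip_diff_left ip_commute)

lemma ip_scaleR_right: "f \<in> H \<Longrightarrow> g \<in> H \<Longrightarrow> ip g (a *\<^sub>R f) = a * ip g f"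
  by (metis H_closed(3) ip_scaleR_left ip_commute)

lemma ip_0 [simp]: "f \<in> H \<Longrightarrow> ip 0 f = 0" "f \<in> H \<Longrightarrow> ip f 0 = 0"
  using ip_scaleR_left[of 0 f 0] ip_scaleR_right[of 0 f 0] by simp_all

lemmas ip_simps = ip_add_left ip_add_right ip_diff_left ip_diff_right
  ip_scaleR_left ip_scaleR_right

lemma cauchy_schwarz:
  assumes f: "f \<in> H" and g: "g \<in> H"
  shows "(ip f g)\<^sup>2 \<le> ip f f * ip g g"
proof -
  have quad: "0 \<le> ip f f - 2 * t * ip f g + t\<^sup>2 * ip g g" for t
    using ip_nonneg[of "f - t *\<^sub>R g"] f g ip_commute[OF f g]
    by (simp add: ip_simps power2_eq_square algebra_simps)
  show ?thesis
  proof (cases "ip g g = 0")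
    case False
    then have pos: "ip g g > 0" using ip_nonneg[OF g] by simp
    have "0 \<le> ip f f - 2 * (ip f g / ip g g) * ip f g + (ip f g / ip g g)\<^sup>2 * ip g g"
      by (rule quad)
    also have "\<dots> = ip f f - (ip f g)\<^sup>2 / ip g g"
      using pos by (simp add: field_simps power2_eq_square)
    finally show ?thesis using pos by (simp add: field_simps)
  next
    case True
    have "ip f g = 0"
    proof (rule ccontr)
      assume "ip f g \<noteq> 0"
      then have "2 * ((ip f f + 1) / (2 * ip f g)) * ip f g = ip f f + 1" by simp
      with quad[of "(ip f f + 1) / (2 * ip f g)"] True show False by simp
    qed
    with True show ?thesis by simp
  qed
qed

definition nrm :: "'b \<Rightarrow> real" where "nrm f = sqrt (ip f f)"

lemma nrm_nonneg: "f \<in> H \<Longrightarrow> 0 \<le> nrm f"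
  by (simp add: nrm_def ip_nonneg)

lemma nrm_square: "f \<in> H \<Longrightarrow> (nrm f)\<^sup>2 = ip f f"
  by (simp add: nrm_def ip_nonneg)

lemma nrm_0: "nrm 0 = 0"
  by (simp add: nrm_def)

lemma abs_ip_le: "f \<in> H \<Longrightarrow> g \<in> H \<Longrightarrow> \<bar>ip f g\<bar> \<le> nrm f * nrm g"
  using cauchy_schwarz[of f g] nrm_square[of f] nrm_square[of g] nrm_nonneg[of f] nrm_nonneg[of g]
  by (metis abs_le_square_iff abs_of_nonneg mult_nonneg_nonneg power_mult_distrib)

lemma nrm_triangle: "f \<in> H \<Longrightarrow> g \<in> H \<Longrightarrow> nrm (f + g) \<le> nrm f + nrm g"
proof (rule power2_le_imp_le)
  assume f: "f \<in> H" and g: "g \<in> H"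
  show "(nrm (f + g))\<^sup>2 \<le> (nrm f + nrm g)\<^sup>2"
    using f g abs_ip_le[OF f g] ip_commute[OF f g]
    by (simp add: nrm_square power2_sum ip_simps)
  show "0 \<le> nrm f + nrm g" using f g by (simp add: nrm_nonneg)
qed

lemma nrm_scaleR: "f \<in> H \<Longrightarrow> nrm (a *\<^sub>R f) = \<bar>a\<bar> * nrm f"
  by (simp add: nrm_def ip_simps real_sqrt_mult mult.assoc[symmetric])

lemma nrm_minus: "f \<in> H \<Longrightarrow> nrm (- f) = nrm f"
  using nrm_scaleR[of f "-1"] by simp

lemma nrm_minus_commute: "f \<in> H \<Longrightarrow> g \<in> H \<Longrightarrow> nrm (f - g) = nrm (g - f)"
  using nrm_minus[of "f - g"] by simp

lemma nrm_triangle_diff: "f \<in> H \<Longrightarrow> g \<in> H \<Longrightarrow> h \<in> H \<Longrightarrow> nrm (f - h) \<le> nrm (f - g) + nrm (g - h)"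
  using nrm_triangle[of "f - g" "g - h"] by simp

lemma ip_null: "f \<in> H \<Longrightarrow> g \<in> H \<Longrightarrow> nrm f = 0 \<Longrightarrow> ip f g = 0"
  using abs_ip_le[of f g] by simp

definition symmetric_op :: "('b \<Rightarrow> 'b) \<Rightarrow> bool" where
  "symmetric_op T \<longleftrightarrow> (\<forall>f\<in>H. T f \<in> H) \<and> (\<forall>f\<in>H. \<forall>g\<in>H. ip (T f) g = ip f (T g))"

lemma symmetric_opD:
  assumes "symmetric_op T"
  shows "f \<in> H \<Longrightarrow> T f \<in> H" and "f \<in> H \<Longrightarrow> g \<in> H \<Longrightarrow> ip (T f) g = ip f (T g)"
  using assms by (auto simp: symmetric_op_def)

text \<open>Linearity need not be assumed: it follows from symmetry, up to null vectors.\<close>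

lemma symmetric_op_linear:
  assumes T: "symmetric_op T" and f: "f \<in> H" and g: "g \<in> H"
  shows "nrm (T (f - g) - (T f - T g)) = 0" "nrm (T (f + g) - (T f + T g)) = 0"
    "nrm (T (a *\<^sub>R f) - a *\<^sub>R T f) = 0"
proof -
  note TH [simp] = symmetric_opD(1)[OF T] and sym = symmetric_opD(2)[OF T]
  have null: "nrm h = 0" if "h \<in> H" "\<And>k. k \<in> H \<Longrightarrow> ip h k = 0" for h
    using that by (simp add: nrm_def)
  show "nrm (T (f - g) - (T f - T g)) = 0" "nrm (T (f + g) - (T f + T g)) = 0"
    "nrm (T (a *\<^sub>R f) - a *\<^sub>R T f) = 0"
    by (rule null; use f g in \<open>simp add: ip_simps sym\<close>)+
qed

lemma nrm_eq_of_null: 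
  assumes "f \<in> H" "g \<in> H" "nrm (f - g) = 0" shows "nrm f = nrm g"
  using nrm_triangle_diff[of f g 0] nrm_triangle_diff[of g f 0] nrm_minus_commute[of f g] assms by simp

lemma ip_eq_of_null: 
  assumes "f \<in> H" "g \<in> H" "h \<in> H" "nrm (f - g) = 0" shows "ip f h = ip g h"
  using ip_null[of "f - g" h] assms by (simp add: ip_simps)

lemma symmetric_op_affine:
  assumes T: "symmetric_op T" shows "symmetric_op (\<lambda>f. a *\<^sub>R f + b *\<^sub>R T f)"
  using symmetric_opD[OF T] by (auto simp: symmetric_op_def ip_simps)

lemma symmetric_op_square:
  assumes T: "symmetric_op T" shows "symmetric_op (\<lambda>f. T (T f))"
  using symmetric_opD[OF T] by (auto simp: symmetric_op_def)

lemma symmetric_op_funpow: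
  assumes T: "symmetric_op T" shows "symmetric_op (T ^^ k)"
proof (induction k)
  case (Suc k)
  then show ?case using T unfolding symmetric_op_def by (auto simp: funpow_swap1)
qed (auto simp: symmetric_op_def)

section \<open>Positive forms and extremal values of symmetric operators\<close>

lemma positive_form:
  assumes W: "symmetric_op W" and pos: "\<And>f. f \<in> H \<Longrightarrow> 0 \<le> ip (W f) f"
  shows "semi_inner_space H (\<lambda>f g. ip (W f) g)"
proof
  note WH [simp] = symmetric_opD(1)[OF W] and sym = symmetric_opD(2)[OF W]
  fix f g h :: 'b assume "f \<in> H" "g \<in> H" "h \<in> H"
  then show "ip (W (f + g)) h = ip (W f) h + ip (W g) h"
    by (simp add: sym ip_simps)
next
  note WH [simp] = symmetric_opD(1)[OF W] and sym = symmetric_opD(2)[OF W]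
  fix f g :: 'b and a assume f: "f \<in> H" and g: "g \<in> H"
  show "ip (W (a *\<^sub>R f)) g = a * ip (W f) g"
    using f g by (simp add: sym ip_simps)
  show "ip (W f) g = ip (W g) f"
    using f g by (simp add: sym ip_commute[of f])
qed (use subspace_H pos in auto)

text \<open>Cauchy-Schwarz for the form of \<open>W\<close>, applied to \<open>f\<close> and
  \<open>W f\<close>, bounds \<open>(nrm (W f))\<^sup>4\<close> by
  \<open>ip (W f) f * ip (W (W f)) (W f)\<close>. Boundedness of \<open>W\<close> turns this into
  \<open>(nrm (W f))\<^sup>2 \<le> D * ip (W f) f\<close>, so a lower bound on the norm of
  \<open>W f\<close> becomes one on the form.\<close>

lemma positive_op_bounded_below:
  assumes W: "symmetric_op W" and pos: "\<And>f. f \<in> H \<Longrightarrow> 0 \<le> ip (W f) f"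
    and bdd: "\<And>f. f \<in> H \<Longrightarrow> nrm (W f) \<le> C * nrm f"
    and \<delta>: "\<delta> > 0" "\<And>f. f \<in> H \<Longrightarrow> \<delta> * nrm f \<le> nrm (W f)"
  obtains e where "e > 0" "\<And>f. f \<in> H \<Longrightarrow> e * ip f f \<le> ip (W f) f"
proof -
  note WH [simp] = symmetric_opD(1)[OF W]
  \<comment> \<open>\<open>C\<close> may fail to be positive when all vectors are null, whereas
    \<open>D\<close> can be divided by.\<close>
  define D where "D = max C 1"
  have D: "D > 0" by (simp add: D_def)
  have bddD: "nrm (W f) \<le> D * nrm f" if "f \<in> H" for f
  proof -
    have "C * nrm f \<le> D * nrm f"
      by (rule mult_right_mono) (simp_all add: D_def nrm_nonneg that)
    with bdd[OF that] show ?thesis by simp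
  qed
  have "\<delta>\<^sup>2 / D * ip f f \<le> ip (W f) f" if f: "f \<in> H" for f
  proof (cases "nrm (W f) = 0")
    case True
    then have "nrm f = 0" using \<delta>(1) \<delta>(2)[OF f] nrm_nonneg[OF f]
      by (simp add: mult_le_0_iff)
    then show ?thesis using pos[OF f] nrm_square[OF f] by simp
  next
    case False
    then have pos': "nrm (W f) > 0" using nrm_nonneg[of "W f"] f by simp
    have "(nrm (W f))\<^sup>2 * (nrm (W f))\<^sup>2 = (ip (W f) (W f))\<^sup>2"
      using nrm_square[of "W f"] f by (simp add: power2_eq_square)
    also have "\<dots> \<le> ip (W f) f * ip (W (W f)) (W f)"
      using semi_inner_space.cauchy_schwarz[OF positive_form[OF W pos], of f "W f"] f by simp
    also have "\<dots> \<le> ip (W f) f * (D * (nrm (W f))\<^sup>2)"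
    proof (rule mult_left_mono[OF _ pos[OF f]])
      have "ip (W (W f)) (W f) \<le> nrm (W (W f)) * nrm (W f)"
        using abs_ip_le[of "W (W f)" "W f"] f by simp
      also have "\<dots> \<le> (D * nrm (W f)) * nrm (W f)"
        by (rule mult_right_mono) (use f bddD nrm_nonneg in auto)
      finally show "ip (W (W f)) (W f) \<le> D * (nrm (W f))\<^sup>2" by (simp add: power2_eq_square)
    qed
    finally have "(nrm (W f))\<^sup>2 \<le> D * ip (W f) f"
      using pos' by (simp add: power2_eq_square mult.assoc[symmetric] mult.commute[of _ D])
    moreover have "\<delta>\<^sup>2 * ip f f \<le> (nrm (W f))\<^sup>2"
      using power_mono[OF \<delta>(2)[OF f], of 2] \<delta>(1) nrm_nonneg[OF f] nrm_square[OF f]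
      by (simp add: power_mult_distrib)
    ultimately show ?thesis using D by (simp add: field_simps)
  qed
  with that[of "\<delta>\<^sup>2 / D"] \<delta>(1) D show ?thesis by simp
qed

text \<open>If \<open>T\<^sup>2 - \<mu>\<^sup>2\<close> (or its negative) is a positive form and \<open>T - \<mu>\<close> and
  \<open>T + \<mu>\<close> are both bounded below, then the form is strictly positive; hence the
  extremal values of \<open>\<parallel>T f\<parallel> / \<parallel>f\<parallel>\<close> belong, up to sign, to the spectrum.\<close>

lemma square_shift_bounded_below:
  assumes T: "symmetric_op T" and bdd: "\<And>f. f \<in> H \<Longrightarrow> nrm (T f) \<le> C * nrm f"
    and s: "s = 1 \<or> s = (-1::real)"
    and pos: "\<And>f. f \<in> H \<Longrightarrow> 0 \<le> s * ((nrm (T f))\<^sup>2 - \<mu>\<^sup>2 * (nrm f)\<^sup>2)"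
    and d1: "d1 > 0" "\<And>f. f \<in> H \<Longrightarrow> d1 * nrm f \<le> nrm (T f - \<mu> *\<^sub>R f)"
    and d2: "d2 > 0" "\<And>f. f \<in> H \<Longrightarrow> d2 * nrm f \<le> nrm (T f + \<mu> *\<^sub>R f)"
  obtains e where "e > 0" "\<And>f. f \<in> H \<Longrightarrow> e * (nrm f)\<^sup>2 \<le> s * ((nrm (T f))\<^sup>2 - \<mu>\<^sup>2 * (nrm f)\<^sup>2)"
proof -
  note TH [simp] = symmetric_opD(1)[OF T] and sym = symmetric_opD(2)[OF T]
  define W where "W = (\<lambda>f. (- s * \<mu>\<^sup>2) *\<^sub>R f + s *\<^sub>R T (T f))"
  have W: "symmetric_op W"
    unfolding W_def by (intro symmetric_op_affine symmetric_op_square T)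
  note WH [simp] = symmetric_opD(1)[OF W]
  have form: "ip (W f) f = s * ((nrm (T f))\<^sup>2 - \<mu>\<^sup>2 * (nrm f)\<^sup>2)" if "f \<in> H" for f
    using that by (simp add: W_def ip_simps sym nrm_square algebra_simps)
  have "nrm (W f) \<le> (\<mu>\<^sup>2 + \<bar>C\<bar> * \<bar>C\<bar>) * nrm f" if f: "f \<in> H" for f
  proof -
    have "nrm (T (T f)) \<le> C * nrm (T f)" using bdd f by simp
    also have "\<dots> \<le> \<bar>C\<bar> * nrm (T f)" using f by (intro mult_right_mono) (auto simp: nrm_nonneg)
    also have "\<dots> \<le> \<bar>C\<bar> * (C * nrm f)" using bdd f by (intro mult_left_mono) auto
    also have "\<dots> \<le> \<bar>C\<bar> * (\<bar>C\<bar> * nrm f)"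
      using f by (intro mult_left_mono mult_right_mono) (auto simp: nrm_nonneg)
    finally have "nrm (T (T f)) \<le> \<bar>C\<bar> * \<bar>C\<bar> * nrm f" by (simp add: mult.assoc)
    moreover have "nrm (W f) \<le> \<mu>\<^sup>2 * nrm f + nrm (T (T f))"
    proof -
      have "nrm (W f) \<le> nrm ((- s * \<mu>\<^sup>2) *\<^sub>R f) + nrm (s *\<^sub>R T (T f))"
        unfolding W_def using f by (intro nrm_triangle) auto
      also have "\<dots> = \<mu>\<^sup>2 * nrm f + nrm (T (T f))"
        using f s by (auto simp: nrm_scaleR abs_mult simp del: scaleR_minus_left mult_minus_left)
      finally show ?thesis .
    qed
    ultimately show ?thesis by (simp add: algebra_simps)
  qed
  moreover have "d1 * d2 * nrm f \<le> nrm (W f)" if f: "f \<in> H" for f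
  proof -
    \<comment> \<open>Up to sign and null vectors \<open>W\<close> factors as
      \<open>(T - \<mu>) (T + \<mu>)\<close>, so it inherits the product of the two lower
      bounds.\<close>
    let ?g = "T f + \<mu> *\<^sub>R f"
    have null: "nrm (T (T f + \<mu> *\<^sub>R f) - (T (T f) + T (\<mu> *\<^sub>R f))) = 0"
      "nrm (T (\<mu> *\<^sub>R f) - \<mu> *\<^sub>R T f) = 0"
      using symmetric_op_linear[OF T, of "T f" "\<mu> *\<^sub>R f"] symmetric_op_linear[OF T, of f] f by auto
    have "ip (s *\<^sub>R (T ?g - \<mu> *\<^sub>R ?g)) h = ip (W f) h" if h: "h \<in> H" for h
      using f h ip_eq_of_null[OF _ _ h null(1)] ip_eq_of_null[OF _ _ h null(2)]
      by (simp add: W_def ip_simps algebra_simps power2_eq_square)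
    then have "nrm (s *\<^sub>R (T ?g - \<mu> *\<^sub>R ?g)) = nrm (W f)"
      using ip_commute f unfolding nrm_def by (metis H_closed(2,3,4) TH WH)
    then have "nrm (W f) = nrm (T ?g - \<mu> *\<^sub>R ?g)"
      using s f by (auto simp: nrm_scaleR)
    then have "d1 * nrm ?g \<le> nrm (W f)"
      using d1(2)[of ?g] f by simp
    moreover have "d1 * (d2 * nrm f) \<le> d1 * nrm ?g"
      using d1(1) d2(2)[OF f] by (intro mult_left_mono) auto
    ultimately show ?thesis by simp
  qed
  ultimately obtain e where "e > 0" "\<And>f. f \<in> H \<Longrightarrow> e * ip f f \<le> ip (W f) f"
    using positive_op_bounded_below[OF W, where \<delta> = "d1 * d2"] pos form d1(1) d2(1)
    by (metis mult_pos_pos)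
  then show ?thesis
    using that[of e] form by (simp add: nrm_square)
qed

text \<open>Let \<open>\<mu>\<close> be the best constant in the lower bound. If it were below
  \<open>c\<close>, both shifts by \<open>\<mu>\<close> would be bounded below, the form of
  \<open>T\<^sup>2 - \<mu>\<^sup>2\<close> would be at least some \<open>e > 0\<close>, and
  \<open>sqrt (\<mu>\<^sup>2 + e)\<close> would be a better constant.\<close>

lemma bounded_below_of_shifts:
  assumes T: "symmetric_op T" and bdd: "\<And>f. f \<in> H \<Longrightarrow> nrm (T f) \<le> C * nrm f"
    and d1: "\<And>t. 0 \<le> t \<Longrightarrow> t < c \<Longrightarrow> \<exists>d>0. \<forall>f\<in>H. d * nrm f \<le> nrm (T f - t *\<^sub>R f)"
    and d2: "\<And>t. 0 \<le> t \<Longrightarrow> t < c \<Longrightarrow> \<exists>d>0. \<forall>f\<in>H. d * nrm f \<le> nrm (T f + t *\<^sub>R f)"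
    and f: "f \<in> H"
  shows "c * nrm f \<le> nrm (T f)"
proof (rule ccontr)
  assume less: "\<not> c * nrm f \<le> nrm (T f)"
  note TH [simp] = symmetric_opD(1)[OF T]
  define S where "S = {t. 0 \<le> t \<and> (\<forall>f\<in>H. t * nrm f \<le> nrm (T f))}"
  have S0: "0 \<in> S" by (auto simp: S_def nrm_nonneg)
  have less_c: "t < c" if "t \<in> S" for t
  proof (rule ccontr)
    assume "\<not> t < c"
    then have "c * nrm f \<le> t * nrm f" using nrm_nonneg[OF f] by (intro mult_right_mono) auto
    with that f less show False by (auto simp: S_def)
  qed
  then have bdd_S: "bdd_above S" by (meson bdd_aboveI less_imp_le)
  define \<mu> where "\<mu> = Sup S"
  have \<mu>0: "0 \<le> \<mu>" unfolding \<mu>_def by (rule cSup_upper[OF S0 bdd_S])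
  have "\<mu> * nrm g \<le> nrm (T g)" if g: "g \<in> H" for g
  proof (cases "nrm g = 0")
    case False
    then have pos: "nrm g > 0" using nrm_nonneg[OF g] by simp
    have "\<mu> \<le> nrm (T g) / nrm g" unfolding \<mu>_def
      by (rule cSup_least) (use S0 g pos in \<open>auto simp: S_def field_simps\<close>)
    then show ?thesis using pos by (simp add: field_simps)
  qed (use g in \<open>simp add: nrm_nonneg\<close>)
  then have \<mu>S: "\<mu> \<in> S" using \<mu>0 by (simp add: S_def)
  then have "\<mu> < c" by (rule less_c)
  obtain e1 where e1: "e1 > 0" "\<And>f. f \<in> H \<Longrightarrow> e1 * nrm f \<le> nrm (T f - \<mu> *\<^sub>R f)"
    using d1[OF \<mu>0 \<open>\<mu> < c\<close>] by auto
  obtain e2 where e2: "e2 > 0" "\<And>f. f \<in> H \<Longrightarrow> e2 * nrm f \<le> nrm (T f + \<mu> *\<^sub>R f)"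
    using d2[OF \<mu>0 \<open>\<mu> < c\<close>] by auto
  have "0 \<le> 1 * ((nrm (T g))\<^sup>2 - \<mu>\<^sup>2 * (nrm g)\<^sup>2)" if "g \<in> H" for g
    using that \<mu>S \<mu>0 power_mono[of "\<mu> * nrm g" "nrm (T g)" 2]
    by (simp add: S_def nrm_nonneg power_mult_distrib)
  then obtain e where e: "e > 0"
    "\<And>g. g \<in> H \<Longrightarrow> e * (nrm g)\<^sup>2 \<le> 1 * ((nrm (T g))\<^sup>2 - \<mu>\<^sup>2 * (nrm g)\<^sup>2)"
    using square_shift_bounded_below[OF T bdd, of 1 \<mu> e1 e2] e1 e2 by blast
  have "sqrt (\<mu>\<^sup>2 + e) * nrm g \<le> nrm (T g)" if g: "g \<in> H" for g
  proof (rule power2_le_imp_le)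
    show "(sqrt (\<mu>\<^sup>2 + e) * nrm g)\<^sup>2 \<le> (nrm (T g))\<^sup>2"
      using e(2)[OF g] e(1) by (simp add: power_mult_distrib algebra_simps)
  qed (use g in \<open>simp add: nrm_nonneg\<close>)
  then have "sqrt (\<mu>\<^sup>2 + e) \<in> S" using e(1) by (simp add: S_def)
  then have "sqrt (\<mu>\<^sup>2 + e) \<le> \<mu>" unfolding \<mu>_def by (rule cSup_upper[OF _ bdd_S])
  moreover have "\<mu> < sqrt (\<mu>\<^sup>2 + e)" using e(1) by (intro real_less_rsqrt) simp
  ultimately show False by simp
qed

text \<open>Mirror image of \<open>bounded_below_of_shifts\<close>, with \<open>\<mu>\<close> the
  operator norm: if it exceeded \<open>b\<close>, the form of
  \<open>\<mu>\<^sup>2 - T\<^sup>2\<close> would be strictly positive and a smaller norm bound would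
  hold.\<close>

lemma bounded_above_of_shifts:
  assumes T: "symmetric_op T" and bdd: "\<And>f. f \<in> H \<Longrightarrow> nrm (T f) \<le> C * nrm f"
    and b: "0 \<le> b"
    and d1: "\<And>t. b < t \<Longrightarrow> \<exists>d>0. \<forall>f\<in>H. d * nrm f \<le> nrm (T f - t *\<^sub>R f)"
    and d2: "\<And>t. b < t \<Longrightarrow> \<exists>d>0. \<forall>f\<in>H. d * nrm f \<le> nrm (T f + t *\<^sub>R f)"
    and f: "f \<in> H"
  shows "nrm (T f) \<le> b * nrm f"
proof (rule ccontr)
  assume less: "\<not> nrm (T f) \<le> b * nrm f"
  note TH [simp] = symmetric_opD(1)[OF T]
  define S where "S = {t. 0 \<le> t \<and> (\<forall>f\<in>H. nrm (T f) \<le> t * nrm f)}"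
  have "nrm (T g) \<le> \<bar>C\<bar> * nrm g" if "g \<in> H" for g
    using bdd[OF that] mult_right_mono[OF abs_ge_self[of C] nrm_nonneg[OF that]] by simp
  then have S0: "\<bar>C\<bar> \<in> S" by (simp add: S_def)
  have gr_b: "b < t" if "t \<in> S" for t
  proof (rule ccontr)
    assume "\<not> b < t"
    then have "t * nrm f \<le> b * nrm f" using nrm_nonneg[OF f] by (intro mult_right_mono) auto
    with that f less show False by (auto simp: S_def)
  qed
  have bdd_S: "bdd_below S" by (rule bdd_belowI[of _ 0]) (simp add: S_def)
  define \<mu> where "\<mu> = Inf S"
  have \<mu>0: "0 \<le> \<mu>" unfolding \<mu>_def by (rule cInf_greatest) (use S0 in blast, simp add: S_def)
  have "nrm (T g) \<le> \<mu> * nrm g" if g: "g \<in> H" for g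
  proof (cases "nrm g = 0")
    case True
    then show ?thesis using bdd[OF g] by simp
  next
    case False
    then have pos: "nrm g > 0" using nrm_nonneg[OF g] by simp
    have "nrm (T g) / nrm g \<le> \<mu>" unfolding \<mu>_def
      by (rule cInf_greatest) (use S0 in blast, use g pos in \<open>simp add: S_def pos_divide_le_eq\<close>)
    then show ?thesis using pos by (simp add: field_simps)
  qed
  then have \<mu>S: "\<mu> \<in> S" using \<mu>0 by (simp add: S_def)
  then have "b < \<mu>" by (rule gr_b)
  obtain e1 where e1: "e1 > 0" "\<And>f. f \<in> H \<Longrightarrow> e1 * nrm f \<le> nrm (T f - \<mu> *\<^sub>R f)"
    using d1[OF \<open>b < \<mu>\<close>] by auto
  obtain e2 where e2: "e2 > 0" "\<And>f. f \<in> H \<Longrightarrow> e2 * nrm f \<le> nrm (T f + \<mu> *\<^sub>R f)"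
    using d2[OF \<open>b < \<mu>\<close>] by auto
  have "0 \<le> (-1) * ((nrm (T g))\<^sup>2 - \<mu>\<^sup>2 * (nrm g)\<^sup>2)" if "g \<in> H" for g
    using that \<mu>S \<mu>0 power_mono[of "nrm (T g)" "\<mu> * nrm g" 2]
    by (simp add: S_def nrm_nonneg power_mult_distrib)
  then obtain e where e: "e > 0"
    "\<And>g. g \<in> H \<Longrightarrow> e * (nrm g)\<^sup>2 \<le> (-1) * ((nrm (T g))\<^sup>2 - \<mu>\<^sup>2 * (nrm g)\<^sup>2)"
    using square_shift_bounded_below[OF T bdd, of "-1" \<mu> e1 e2] e1 e2 by blast
  \<comment> \<open>If \<open>\<mu>\<^sup>2 - e\<close> is negative, all vectors are null;
    truncating at 0 keeps the square root usable in that case.\<close>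
  define m where "m = max 0 (\<mu>\<^sup>2 - e)"
  have "nrm (T g) \<le> sqrt m * nrm g" if g: "g \<in> H" for g
  proof (rule power2_le_imp_le)
    have "(nrm (T g))\<^sup>2 \<le> (\<mu>\<^sup>2 - e) * (nrm g)\<^sup>2" using e(2)[OF g] by (simp add: algebra_simps)
    also have "\<dots> \<le> m * (nrm g)\<^sup>2" unfolding m_def by (rule mult_right_mono) auto
    also have "\<dots> = (sqrt m * nrm g)\<^sup>2" by (simp add: power_mult_distrib m_def)
    finally show "(nrm (T g))\<^sup>2 \<le> (sqrt m * nrm g)\<^sup>2" .
  qed (use g in \<open>simp add: nrm_nonneg m_def\<close>)
  then have "sqrt m \<in> S" by (simp add: S_def m_def)
  then have "\<mu> \<le> sqrt m" unfolding \<mu>_def by (rule cInf_lower[OF _ bdd_S])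
  moreover have "sqrt m < \<mu>"
    using e(1) \<open>b < \<mu>\<close> b by (intro real_less_lsqrt) (auto simp: m_def)
  ultimately show False by simp
qed

lemma ip_tendsto:
  assumes H: "\<And>k. x k \<in> H" "\<And>k. y k \<in> H" "v \<in> H" "w \<in> H"
    and x: "(\<lambda>k. nrm (x k - v)) \<longlonglongrightarrow> 0" and y: "(\<lambda>k. nrm (y k - w)) \<longlonglongrightarrow> 0"
  shows "(\<lambda>k. ip (x k) (y k)) \<longlonglongrightarrow> ip v w"
proof -
  have "(\<lambda>k. nrm (x k - v) * (nrm (y k - w) + nrm w) + nrm v * nrm (y k - w)) \<longlonglongrightarrow>
      0 * (0 + nrm w) + nrm v * 0"
    by (intro tendsto_intros x y)
  then have lim: "(\<lambda>k. nrm (x k - v) * (nrm (y k - w) + nrm w) + nrm v * nrm (y k - w)) \<longlonglongrightarrow> 0"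
    by simp
  have "\<bar>ip (x k) (y k) - ip v w\<bar> \<le> nrm (x k - v) * (nrm (y k - w) + nrm w) + nrm v * nrm (y k - w)" for k
  proof -
    have "ip (x k) (y k) - ip v w = ip (x k - v) (y k) + ip v (y k - w)"
      using H by (simp add: ip_simps)
    moreover have "\<bar>ip (x k - v) (y k)\<bar> \<le> nrm (x k - v) * nrm (y k)"
      using H by (intro abs_ip_le) auto
    moreover have "nrm (x k - v) * nrm (y k) \<le> nrm (x k - v) * (nrm (y k - w) + nrm w)"
      using H nrm_triangle[of "y k - w" w] by (intro mult_left_mono) (auto intro: nrm_nonneg)
    moreover have "\<bar>ip v (y k - w)\<bar> \<le> nrm v * nrm (y k - w)"
      using H by (intro abs_ip_le) auto
    ultimately show ?thesis by linarith
  qed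
  then have "(\<lambda>k. ip (x k) (y k) - ip v w) \<longlonglongrightarrow> 0"
    by (intro Lim_null_comparison[OF _ lim]) auto
  then show ?thesis by (simp add: LIM_zero_iff)
qed

end

section \<open>Complete spaces and contraction iterations\<close>

locale semi_hilbert_space = semi_inner_space H ip
  for H :: "'b::real_vector set" and ip +
  assumes complete: "(\<And>k. x k \<in> H) \<Longrightarrow> summable (\<lambda>k. nrm (x (Suc k) - x k)) \<Longrightarrow>
    \<exists>v\<in>H. (\<lambda>k. nrm (x k - v)) \<longlonglongrightarrow> 0"
begin

text \<open>In \<open>lap_bounded_below\<close> the set \<open>D\<close> is a range that may fail to
  be closed. The limit is therefore only placed in \<open>H\<close>, and vanishing increments along
  the iteration stand in for the fixed point equation. Geometric decay of the increments is exactly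
  the summability that \<open>complete\<close> asks for.\<close>

lemma contraction_limit:
  assumes D: "D \<subseteq> H" "x0 \<in> D" and F: "\<And>u. u \<in> D \<Longrightarrow> F u \<in> D" and q: "0 \<le> q" "q < 1"
    and contr: "\<And>u v. u \<in> D \<Longrightarrow> v \<in> D \<Longrightarrow> nrm (F u - F v) \<le> q * nrm (u - v)"
  obtains x v where "\<And>k. x k \<in> D" "v \<in> H" "(\<lambda>k. nrm (x k - v)) \<longlonglongrightarrow> 0"
    "(\<lambda>k. nrm (F (x k) - x k)) \<longlonglongrightarrow> 0"
proof -
  define x where "x k = (F ^^ k) x0" for k
  have xD: "x k \<in> D" for k by (induction k) (auto simp: x_def D F)
  then have xH: "x k \<in> H" for k using D by auto
  have step: "nrm (F (x k) - x k) \<le> nrm (F x0 - x0) * q ^ k" for k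
  proof (induction k)
    case (Suc k)
    have "nrm (F (x (Suc k)) - x (Suc k)) \<le> q * nrm (F (x k) - x k)"
      using contr[of "F (x k)" "x k"] F xD by (simp add: x_def)
    also have "\<dots> \<le> q * (nrm (F x0 - x0) * q ^ k)" using Suc q by (intro mult_left_mono) auto
    finally show ?case by (simp add: mult_ac)
  qed (simp add: x_def)
  have nn: "0 \<le> nrm (F (x k) - x k)" for k
    using xD F D by (intro nrm_nonneg) blast
  have geom: "summable (\<lambda>k. nrm (F x0 - x0) * q ^ k)"
    using q by (intro summable_mult summable_geometric) auto
  have "summable (\<lambda>k. nrm (F (x k) - x k))"
    using step nn by (intro summable_comparison_test'[OF geom, of 0]) auto
  moreover have "x (Suc k) = F (x k)" for k by (simp add: x_def)
  ultimately obtain v where "v \<in> H" "(\<lambda>k. nrm (x k - v)) \<longlonglongrightarrow> 0"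
    using complete[of x] xH by auto
  moreover have "(\<lambda>k. nrm (F (x k) - x k)) \<longlonglongrightarrow> 0"
    using \<open>summable (\<lambda>k. nrm (F (x k) - x k))\<close> by (rule summable_LIMSEQ_zero)
  ultimately show ?thesis using that xD by blast
qed

lemma contraction_fixed_point:
  assumes F: "\<And>u. u \<in> H \<Longrightarrow> F u \<in> H" and q: "0 \<le> q" "q < 1"
    and contr: "\<And>u v. u \<in> H \<Longrightarrow> v \<in> H \<Longrightarrow> nrm (F u - F v) \<le> q * nrm (u - v)"
  obtains v where "v \<in> H" "nrm (F v - v) = 0"
proof -
  obtain x v where x: "\<And>k. x k \<in> H" "v \<in> H" "(\<lambda>k. nrm (x k - v)) \<longlonglongrightarrow> 0"
    "(\<lambda>k. nrm (F (x k) - x k)) \<longlonglongrightarrow> 0"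
    using contraction_limit[OF order_refl _ F q contr, of 0] by auto
  have "nrm (F v - v) \<le> q * nrm (x k - v) + nrm (F (x k) - x k) + nrm (x k - v)" for k
    using nrm_triangle_diff[of "F v" "F (x k)" v] nrm_triangle_diff[of "F (x k)" "x k" v]
      contr[of v "x k"] x(1,2) F nrm_minus_commute[of v "x k"] by fastforce
  moreover have "(\<lambda>k. q * nrm (x k - v) + nrm (F (x k) - x k) + nrm (x k - v)) \<longlonglongrightarrow> q * 0 + 0 + 0"
    by (intro tendsto_intros x)
  ultimately have "nrm (F v - v) \<le> q * 0 + 0 + 0"
    by (intro LIMSEQ_le_const) auto
  then show ?thesis using that[of v] x(2) F nrm_nonneg[of "F v - v"] by simp
qed

end

section \<open>The operator \<open>lap = I - A\<close> of a symmetric contraction\<close>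

locale contraction_operator = semi_hilbert_space H ip
  for H :: "'b::real_vector set" and ip +
  fixes A :: "'b \<Rightarrow> 'b"
  assumes symmetric_A: "symmetric_op A" and nrm_A_contraction: "f \<in> H \<Longrightarrow> nrm (A f) \<le> nrm f"
begin

definition lap :: "'b \<Rightarrow> 'b" where "lap f = f - A f"

lemma A_closed [simp, intro]: "f \<in> H \<Longrightarrow> A f \<in> H"
  using symmetric_opD(1)[OF symmetric_A] .

lemma A_sym: "f \<in> H \<Longrightarrow> g \<in> H \<Longrightarrow> ip (A f) g = ip f (A g)"
  using symmetric_opD(2)[OF symmetric_A] .

lemma symmetric_lap: "symmetric_op lap"
  using symmetric_op_affine[OF symmetric_A, of 1 "-1"] by (simp add: lap_def[abs_def])

lemma lap_closed [simp, intro]: "f \<in> H \<Longrightarrow> lap f \<in> H"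
  using symmetric_opD(1)[OF symmetric_lap] .

lemma lap_sym: "f \<in> H \<Longrightarrow> g \<in> H \<Longrightarrow> ip (lap f) g = ip f (lap g)"
  using symmetric_opD(2)[OF symmetric_lap] .

lemma A_contr_square: "f \<in> H \<Longrightarrow> ip (A f) (A f) \<le> ip f f"
  using power_mono[OF nrm_A_contraction[of f], of 2] by (simp add: nrm_square nrm_nonneg)

lemma abs_ip_A_le: "f \<in> H \<Longrightarrow> \<bar>ip (A f) f\<bar> \<le> ip f f"
  using abs_ip_le[of "A f" f] mult_right_mono[OF nrm_A_contraction[of f] nrm_nonneg[of f]]
  by (simp add: nrm_square[symmetric] power2_eq_square)

lemma lap_pos: "f \<in> H \<Longrightarrow> 0 \<le> ip (lap f) f"
  using abs_ip_A_le[of f] by (simp add: lap_def ip_simps)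

text \<open>Spectrally this is \<open>(1 - l)\<^sup>2 \<le> 2 * (1 - l)\<close> on [-1, 1];
  expanded, it is the contraction property of \<open>A\<close>.\<close>

lemma lap_square_le: "f \<in> H \<Longrightarrow> ip (lap f) (lap f) \<le> 2 * ip (lap f) f"
  using A_contr_square[of f] by (simp add: lap_def ip_simps ip_commute[of f "A f"])

lemma nrm_lap_le: "f \<in> H \<Longrightarrow> nrm (lap f) \<le> 2 * nrm f"
  using nrm_triangle_diff[of f 0 "A f"] nrm_A_contraction[of f] nrm_minus_commute[of 0 "A f"]
  by (simp add: lap_def)

lemma lap_diff: "u \<in> H \<Longrightarrow> v \<in> H \<Longrightarrow> nrm (lap (u - v) - (lap u - lap v)) = 0"
  by (rule symmetric_op_linear(1)[OF symmetric_lap])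

lemma lap_tendsto:
  assumes x: "\<And>k. x k \<in> H" "v \<in> H" "(\<lambda>k. nrm (x k - v)) \<longlonglongrightarrow> 0"
  shows "(\<lambda>k. nrm (lap (x k) - lap v)) \<longlonglongrightarrow> 0"
proof (rule Lim_null_comparison)
  show "\<forall>\<^sub>F k in sequentially. norm (nrm (lap (x k) - lap v)) \<le> 2 * nrm (x k - v)"
  proof (intro always_eventually allI)
    fix k
    have "nrm (lap (x k) - lap v) = nrm (lap (x k - v))"
      using lap_diff[of "x k" v] x by (intro nrm_eq_of_null[symmetric]) auto
    then show "norm (nrm (lap (x k) - lap v)) \<le> 2 * nrm (x k - v)"
      using nrm_lap_le[of "x k - v"] x nrm_nonneg by auto
  qed
  show "(\<lambda>k. 2 * nrm (x k - v)) \<longlonglongrightarrow> 0" using tendsto_mult_left[OF x(3), of 2] by simp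
qed

text \<open>Richardson iteration \<open>v \<mapsto> v - (lap v - h) / 2\<close>, which is a contraction
  wherever \<open>lap\<close> is strictly positive because \<open>lap \<le> 2\<close>.\<close>

lemma richardson:
  assumes D: "D \<subseteq> H" "x0 \<in> D" and h: "h \<in> H" and g: "g > 0"
    and step: "\<And>u. u \<in> D \<Longrightarrow> u - (1/2) *\<^sub>R (lap u - h) \<in> D"
    and pos: "\<And>u v. u \<in> D \<Longrightarrow> v \<in> D \<Longrightarrow> g * ip (u - v) (u - v) \<le> ip (lap (u - v)) (u - v)"
  obtains x v where "\<And>k. x k \<in> D" "v \<in> H" "(\<lambda>k. nrm (x k - v)) \<longlonglongrightarrow> 0" "nrm (lap v - h) = 0"
proof -
  define F where "F u = u - (1/2) *\<^sub>R (lap u - h)" for u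
  \<comment> \<open>For a difference \<open>d\<close> of two points of \<open>D\<close>, the square
    of the norm of \<open>d - lap d / 2\<close> is at most \<open>(1 - g/2) * ip d d\<close> by
    \<open>lap_square_le\<close> and \<open>pos\<close>. The maximum with 0 acts only for
    \<open>g > 2\<close>, where such differences are null.\<close>
  define q where "q = sqrt (max 0 (1 - g/2))"
  have q: "0 \<le> q" "q < 1" using g by (auto simp: q_def)
  have "nrm (F u - F v) \<le> q * nrm (u - v)" if uv: "u \<in> D" "v \<in> D" for u v
  proof (rule power2_le_imp_le)
    have H: "u \<in> H" "v \<in> H" using uv D by auto
    let ?d = "u - v"
    have "ip (F u - F v) k = ip (?d - (1/2) *\<^sub>R lap ?d) k" if "k \<in> H" for k
      using H that h ip_eq_of_null[OF _ _ that lap_diff[OF H]]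
      by (simp add: F_def ip_simps algebra_simps)
    then have "(nrm (F u - F v))\<^sup>2 = (nrm (?d - (1/2) *\<^sub>R lap ?d))\<^sup>2"
      using H h by (simp add: nrm_square F_def)
        (metis (no_types, lifting) lap_closed F_def H_closed(3) H_closed(4) ip_commute)
    also have "\<dots> = ip ?d ?d - ip (lap ?d) ?d + ip (lap ?d) (lap ?d) / 4"
    proof -
      have "(nrm (d - (1/2) *\<^sub>R e))\<^sup>2 = ip d d - ip e d + ip e e / 4"
        if "d \<in> H" "e \<in> H" for d e
        using that ip_commute[OF that] by (simp add: nrm_square ip_simps field_simps)
      then show ?thesis using H by simp
    qed
    also have "\<dots> \<le> ip ?d ?d - ip (lap ?d) ?d / 2"
      using lap_square_le[of ?d] H by simp
    also have "\<dots> \<le> (1 - g/2) * ip ?d ?d"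
      using pos[OF uv] by (simp add: algebra_simps)
    also have "\<dots> \<le> max 0 (1 - g/2) * ip ?d ?d"
      by (rule mult_right_mono) (use H ip_nonneg in auto)
    also have "\<dots> = (q * nrm ?d)\<^sup>2"
      using H by (simp add: q_def power_mult_distrib nrm_square)
    finally show "(nrm (F u - F v))\<^sup>2 \<le> (q * nrm ?d)\<^sup>2" .
    show "0 \<le> q * nrm ?d" using H q by (simp add: nrm_nonneg)
  qed
  then obtain x v where xv: "\<And>k. x k \<in> D" "v \<in> H" "(\<lambda>k. nrm (x k - v)) \<longlonglongrightarrow> 0"
    "(\<lambda>k. nrm (F (x k) - x k)) \<longlonglongrightarrow> 0"
    using contraction_limit[of D x0 F q] D q step unfolding F_def by blast
  have xH: "x k \<in> H" for k using xv(1) D by auto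
  have "nrm (lap v - h) \<le> nrm (lap (x k) - lap v) + 2 * nrm (F (x k) - x k)" for k
  proof -
    have "F (x k) - x k = (- 1/2) *\<^sub>R (lap (x k) - h)" by (simp add: F_def)
    then have "nrm (F (x k) - x k) = (1/2) * nrm (lap (x k) - h)"
      using xH h nrm_scaleR[of "lap (x k) - h" "-1/2"] by simp
    then show ?thesis
      using nrm_triangle_diff[of "lap v" "lap (x k)" h] nrm_minus_commute[of "lap v" "lap (x k)"] xH h xv(2)
      by simp
  qed
  moreover have "(\<lambda>k. nrm (lap (x k) - lap v) + 2 * nrm (F (x k) - x k)) \<longlonglongrightarrow> 0 + 2 * 0"
    by (intro tendsto_intros xv lap_tendsto xH)
  ultimately have "nrm (lap v - h) \<le> 0 + 2 * 0"
    by (intro LIMSEQ_le_const) auto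
  then have "nrm (lap v - h) = 0" using nrm_nonneg[of "lap v - h"] xv(2) h by simp
  then show ?thesis using that xv by blast
qed

lemma lap_surj:
  assumes g: "g > 0" "\<And>f. f \<in> H \<Longrightarrow> g * ip f f \<le> ip (lap f) f" and h: "h \<in> H"
  obtains u where "u \<in> H" "nrm (lap u - h) = 0"
proof -
  have "\<exists>u\<in>H. nrm (lap u - h) = 0"
    by (rule richardson[OF order_refl _ h g(1), of 0]) (use g h in auto)
  then show ?thesis using that by auto
qed

lemma lap_square_ge:
  assumes g: "g > 0"
    and res: "\<And>l. 1 - g < l \<Longrightarrow> l < 1 \<Longrightarrow> \<exists>d>0. \<forall>f\<in>H. d * nrm f \<le> nrm (l *\<^sub>R f - A f)"
    and f: "f \<in> H"
  shows "g * ip (lap f) f \<le> ip (lap f) (lap f)"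
proof -
  define c where "c = g / 2"
  define K where "K f = (- c) *\<^sub>R f + 1 *\<^sub>R lap f" for f
  have K: "symmetric_op K" unfolding K_def[abs_def] by (intro symmetric_op_affine symmetric_lap)
  \<comment> \<open>As \<open>t\<close> runs through (-c, c), the parameter \<open>1 - c + t\<close>
    runs through the interval (1 - g, 1) on which \<open>res\<close> applies. Hence
    \<open>K\<close>, which is \<open>lap\<close> shifted by the midpoint of (0, g), is bounded
    below by the half-width \<open>c\<close>.\<close>
  have KA: "K u + t *\<^sub>R u = (1 - c + t) *\<^sub>R u - A u" for t u
    by (simp add: K_def lap_def algebra_simps)
  have res': "\<exists>d>0. \<forall>f\<in>H. d * nrm f \<le> nrm (K f + t *\<^sub>R f)" if "\<bar>t\<bar> < c" for t
    unfolding KA by (rule res) (use that in \<open>auto simp: c_def\<close>)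
  have bdd: "nrm (K u) \<le> (c + 2) * nrm u" if "u \<in> H" for u
  proof -
    have "nrm (K u) \<le> nrm ((- c) *\<^sub>R u) + nrm (1 *\<^sub>R lap u)"
      unfolding K_def using that by (intro nrm_triangle) auto
    also have "\<dots> = c * nrm u + nrm (lap u)"
      using nrm_scaleR[OF that, of "-c"] g by (simp add: c_def)
    finally show ?thesis using nrm_lap_le[OF that] by (simp add: algebra_simps)
  qed
  have "c * nrm f \<le> nrm (K f)"
  proof (rule bounded_below_of_shifts[OF K bdd _ _ f])
    fix t :: real assume t: "0 \<le> t" "t < c"
    show "\<exists>d>0. \<forall>f\<in>H. d * nrm f \<le> nrm (K f - t *\<^sub>R f)"
      using res'[of "-t"] t by simp
    show "\<exists>d>0. \<forall>f\<in>H. d * nrm f \<le> nrm (K f + t *\<^sub>R f)"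
      using res'[of t] t by simp
  qed
  then have "(c * nrm f)\<^sup>2 \<le> (nrm (K f))\<^sup>2"
    using g f by (intro power_mono) (auto simp: c_def nrm_nonneg)
  also have "\<dots> = ip (lap f) (lap f) - 2 * c * ip (lap f) f + c\<^sup>2 * ip f f"
  proof -
    have "(nrm (K f))\<^sup>2 = ip (lap f - c *\<^sub>R f) (lap f - c *\<^sub>R f)"
      using f by (simp add: nrm_square K_def)
    then show ?thesis
      using f ip_commute[OF f lap_closed[OF f]] by (simp add: ip_simps power2_eq_square algebra_simps)
  qed
  finally show ?thesis using f by (simp add: c_def power_mult_distrib power_divide nrm_square)
qed

text \<open>The moments \<open>a\<^sub>k = \<langle>lap\<^sup>k f, f\<rangle>\<close> are log-convex, so the bound
  \<open>a\<^sub>2 \<ge> g a\<^sub>1\<close> propagates to \<open>a\<^sub>3 \<ge> g a\<^sub>2\<close>.\<close>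

lemma lap_pos_range:
  assumes le: "\<And>f. f \<in> H \<Longrightarrow> g * ip (lap f) f \<le> ip (lap f) (lap f)" and f: "f \<in> H"
  shows "g * ip (lap f) (lap f) \<le> ip (lap (lap f)) (lap f)"
proof -
  have cs: "(ip (lap f) (lap f))\<^sup>2 \<le> ip (lap f) f * ip (lap (lap f)) (lap f)"
    using semi_inner_space.cauchy_schwarz[OF positive_form[OF symmetric_lap lap_pos], of f "lap f"] f by simp
  show ?thesis
  proof (cases "ip (lap f) f = 0")
    case True
    then show ?thesis using cs lap_pos[of "lap f"] f by simp
  next
    case False
    then have pos: "ip (lap f) f > 0" using lap_pos[OF f] by simp
    have "ip (lap f) f * (g * ip (lap f) (lap f)) \<le> ip (lap f) (lap f) * ip (lap f) (lap f)"
      using mult_right_mono[OF le[OF f] ip_nonneg[of "lap f"]] f by (simp add: mult_ac)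
    also have "\<dots> \<le> ip (lap f) f * ip (lap (lap f)) (lap f)" using cs by (simp add: power2_eq_square)
    finally show ?thesis using pos by simp
  qed
qed

text \<open>The bound holds on the range of \<open>lap\<close> by \<open>lap_pos_range\<close>, and
  \<open>f\<close> has to be approximated from there. Richardson iteration for the equation
  \<open>lap v = lap f\<close> started at 0 never leaves the range, and its limit differs from
  \<open>f\<close> by a null vector because \<open>lap\<close> has null kernel. This replaces the
  identification of the closure of the range with the orthogonal complement of the kernel.\<close>

lemma lap_bounded_below:
  assumes g: "g > 0"
    and res: "\<And>l. 1 - g < l \<Longrightarrow> l < 1 \<Longrightarrow> \<exists>d>0. \<forall>f\<in>H. d * nrm f \<le> nrm (l *\<^sub>R f - A f)"
    and ker: "\<And>f. f \<in> H \<Longrightarrow> nrm (lap f) = 0 \<Longrightarrow> nrm f = 0"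
    and f: "f \<in> H"
  shows "g * ip f f \<le> ip (lap f) f"
proof -
  \<comment> \<open>The range of \<open>lap\<close> up to null vectors, expressed weakly by
    \<open>v\<close> and \<open>lap w\<close> having equal products with every \<open>k\<close>. In
    this form closure under linear combinations is immediate, although \<open>lap\<close> is
    additive only up to null vectors.\<close>
  define D where "D = {v\<in>H. \<exists>w\<in>H. \<forall>k\<in>H. ip v k = ip w (lap k)}"
  have pos: "g * ip v v \<le> ip (lap v) v" if v: "v \<in> D" for v
  proof -
    obtain w where w: "w \<in> H" "\<And>k. k \<in> H \<Longrightarrow> ip v k = ip (lap w) k" and vH: "v \<in> H"
      using v by (auto simp: D_def lap_sym)
    have w': "ip k v = ip k (lap w)" if "k \<in> H" for k
      using w that vH ip_commute by (metis lap_closed)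
    have "g * ip (lap w) (lap w) \<le> ip (lap (lap w)) (lap w)"
      using lap_pos_range[OF lap_square_ge[OF g res]] w(1) by blast
    moreover have "ip v v = ip (lap w) (lap w)" using w w' vH by simp
    moreover have "ip (lap v) v = ip (lap (lap w)) (lap w)"
      using w w' vH by (simp add: lap_sym)
    ultimately show ?thesis by simp
  qed
  have "\<exists>x v. (\<forall>k. x k \<in> D) \<and> v \<in> H \<and> (\<lambda>k. nrm (x k - v)) \<longlonglongrightarrow> 0 \<and> nrm (lap v - lap f) = 0"
  proof (rule richardson[of D 0 "lap f" g])
    show "D \<subseteq> H" by (auto simp: D_def)
    show "0 \<in> D" by (auto simp: D_def intro!: bexI[of _ 0])
    show "lap f \<in> H" using f by simp
    show "u - (1/2) *\<^sub>R (lap u - lap f) \<in> D" if u: "u \<in> D" for u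
    proof -
      obtain w where w: "w \<in> H" "\<And>k. k \<in> H \<Longrightarrow> ip u k = ip w (lap k)" and uH: "u \<in> H"
        using u by (auto simp: D_def)
      \<comment> \<open>If \<open>u\<close> agrees with \<open>lap w\<close>, the next iterate
        agrees with \<open>lap (w - (u - f) / 2)\<close>.\<close>
      have "ip (u - (1/2) *\<^sub>R (lap u - lap f)) k = ip (w - (1/2) *\<^sub>R (u - f)) (lap k)" if "k \<in> H" for k
        using w uH f that by (simp add: ip_simps lap_sym)
      then show ?thesis unfolding D_def using w uH f
        by (auto intro!: bexI[of _ "w - (1/2) *\<^sub>R (u - f)"])
    qed
    show "g * ip (u - v) (u - v) \<le> ip (lap (u - v)) (u - v)" if uv: "u \<in> D" "v \<in> D" for u v
    proof (rule pos)
      obtain w w' where w: "w \<in> H" "\<And>k. k \<in> H \<Longrightarrow> ip u k = ip w (lap k)"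
        and w': "w' \<in> H" "\<And>k. k \<in> H \<Longrightarrow> ip v k = ip w' (lap k)" and H: "u \<in> H" "v \<in> H"
        using uv by (auto simp: D_def)
      then show "u - v \<in> D" unfolding D_def
        by (auto intro!: bexI[of _ "w - w'"] simp: ip_simps)
    qed
  qed (use g in auto)
  then obtain x v where x: "\<And>k. x k \<in> D" "v \<in> H" "(\<lambda>k. nrm (x k - v)) \<longlonglongrightarrow> 0" "nrm (lap v - lap f) = 0"
    by auto
  have xH: "x k \<in> H" for k using x(1) by (auto simp: D_def)
  have "nrm (lap (v - f)) = 0"
    using nrm_eq_of_null[of "lap (v - f)" "lap v - lap f"] lap_diff[of v f] x(2,4) f by auto
  then have "nrm (v - f) = 0" using ker x(2) f by auto
  then have "nrm (x k - f) \<le> nrm (x k - v)" for k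
    using nrm_triangle_diff[of "x k" v f] xH x(2) f by simp
  then have xf: "(\<lambda>k. nrm (x k - f)) \<longlonglongrightarrow> 0"
    using xH f nrm_nonneg by (intro Lim_null_comparison[OF _ x(3)]) auto
  have "(\<lambda>k. g * ip (x k) (x k)) \<longlonglongrightarrow> g * ip f f"
    by (intro tendsto_intros ip_tendsto xH f xf)
  moreover have "(\<lambda>k. ip (lap (x k)) (x k)) \<longlonglongrightarrow> ip (lap f) f"
    by (intro ip_tendsto lap_tendsto xH f xf lap_closed)
  ultimately show ?thesis
    using pos[OF x(1)] by (intro LIMSEQ_le) auto
qed

text \<open>The assumption \<open>res\<close> omits \<open>l = 1\<close>, which lies in the spectrum
  on the whole of L2. There the lower bound is supplied by the form bound for \<open>lap\<close>
  together with Cauchy-Schwarz, and \<open>bounded_above_of_shifts\<close> does the rest.\<close>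

lemma nrm_A_le:
  assumes g: "g > 0" "\<And>f. f \<in> H \<Longrightarrow> g * ip f f \<le> ip (lap f) f" and b: "0 \<le> b"
    and res: "\<And>l. b < \<bar>l\<bar> \<Longrightarrow> l \<noteq> 1 \<Longrightarrow> \<exists>d>0. \<forall>f\<in>H. d * nrm f \<le> nrm (l *\<^sub>R f - A f)"
    and f: "f \<in> H"
  shows "nrm (A f) \<le> b * nrm f"
proof (rule bounded_above_of_shifts[OF symmetric_A _ b _ _ f, of 1])
  have one: "g * nrm f \<le> nrm (1 *\<^sub>R f - A f)" if f: "f \<in> H" for f
  proof (cases "nrm f = 0")
    case False
    then have pos: "nrm f > 0" using nrm_nonneg[OF f] by simp
    have "g * nrm f * nrm f \<le> nrm (lap f) * nrm f"
      using g(2)[OF f] abs_ip_le[of "lap f" f] f by (simp add: nrm_square[symmetric] power2_eq_square)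
    then show ?thesis using pos by (simp add: lap_def)
  qed (use f in \<open>simp add: nrm_nonneg\<close>)
  have res': "\<exists>d>0. \<forall>f\<in>H. d * nrm f \<le> nrm (l *\<^sub>R f - A f)" if "b < \<bar>l\<bar>" for l
    using res[OF that] one g(1) by (cases "l = 1") auto
  fix t assume t: "b < t"
  show "\<exists>d>0. \<forall>f\<in>H. d * nrm f \<le> nrm (A f - t *\<^sub>R f)"
    using res'[of t] t b nrm_minus_commute[of "A _" "t *\<^sub>R _"] by auto
  have "nrm ((- t) *\<^sub>R f - A f) = nrm (A f + t *\<^sub>R f)" if f: "f \<in> H" for f
  proof -
    have "(- t) *\<^sub>R f - A f = - (A f + t *\<^sub>R f)" by (simp add: algebra_simps)
    moreover have "A f + t *\<^sub>R f \<in> H" using f by blast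
    ultimately show ?thesis by (simp only: nrm_minus)
  qed
  then show "\<exists>d>0. \<forall>f\<in>H. d * nrm f \<le> nrm (A f + t *\<^sub>R f)"
    using res'[of "-t"] t b by auto
qed (simp add: nrm_A_contraction)

section \<open>Covariance sums and the Poisson equation\<close>

lemma Ak_closed [simp, intro]: "f \<in> H \<Longrightarrow> (A ^^ k) f \<in> H"
  using symmetric_opD(1)[OF symmetric_op_funpow[OF symmetric_A]] .

lemma Ak_sym: "f \<in> H \<Longrightarrow> g \<in> H \<Longrightarrow> ip ((A ^^ k) f) g = ip f ((A ^^ k) g)"
  using symmetric_opD(2)[OF symmetric_op_funpow[OF symmetric_A]] .

lemma nrm_Ak_le: "f \<in> H \<Longrightarrow> nrm ((A ^^ k) f) \<le> nrm f"
  by (induction k) (auto intro: order_trans[OF nrm_A_contraction])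

definition lag :: "nat \<Rightarrow> nat \<Rightarrow> nat" where
  "lag i j = (if i \<le> j then j - i else i - j)"

lemma lag_self [simp]: "lag i i = 0"
  by (simp add: lag_def)

lemma lag_commute: "lag i j = lag j i"
  by (simp add: lag_def)

text \<open>For mean zero \<open>F i\<close> this is the variance of the sum of
  \<open>F i (X i)\<close> along the stationary chain, see
  \<open>complex_variance_sum\<close>.\<close>

definition cov_sum :: "nat \<Rightarrow> (nat \<Rightarrow> 'b) \<Rightarrow> real" where
  "cov_sum n F = (\<Sum>i=1..n. \<Sum>j=1..n. ip ((A ^^ lag i j) (F i)) (F j))"

text \<open>Enlarging the matrix of covariances to size \<open>m\<close> adds a row and a column
  with lags 1, ..., m - 1 and one diagonal entry. Doubling the sum over \<open>k < m\<close> counts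
  lag 0 twice, hence the correction by \<open>ip f f\<close>.\<close>

lemma cov_sum_const:
  assumes f: "f \<in> H"
  shows "cov_sum n (\<lambda>_. f) = (\<Sum>m=1..n. 2 * (\<Sum>k<m. ip ((A ^^ k) f) f) - ip f f)"
proof (induction n)
  case (Suc n)
  let ?c = "\<lambda>k. ip ((A ^^ k) f) f"
  have "(\<Sum>i=1..n. ?c (lag i (Suc n))) = (\<Sum>k=1..n. ?c k)"
    by (rule sum.reindex_bij_witness[of _ "\<lambda>k. Suc n - k" "\<lambda>i. Suc n - i"]) (auto simp: lag_def)
  also have "\<dots> = (\<Sum>k<Suc n. ?c k) - ip f f"
    by (simp add: sum.atLeast1_atMost_eq sum.lessThan_Suc_shift del: sum.lessThan_Suc)
  finally have eq: "(\<Sum>i=1..n. ?c (lag i (Suc n))) = (\<Sum>k<Suc n. ?c k) - ip f f" .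
  have "cov_sum (Suc n) (\<lambda>_. f) = cov_sum n (\<lambda>_. f) + 2 * (\<Sum>i=1..n. ?c (lag i (Suc n))) + ip f f"
    by (simp add: cov_sum_def sum.distrib lag_commute[of "Suc n"])
  with Suc eq show ?case by simp
qed (simp add: cov_sum_def)

lemma poisson_telescope:
  assumes u: "u \<in> H" and f: "f \<in> H" and uf: "nrm (lap u - f) = 0"
  shows "(\<Sum>k<m. ip ((A ^^ k) f) f) = ip u f - ip ((A ^^ m) u) f"
proof -
  have "ip ((A ^^ k) f) f = ip ((A ^^ k) u) f - ip ((A ^^ Suc k) u) f" for k
  proof -
    have "ip ((A ^^ k) f) f = ip (lap u) ((A ^^ k) f)"
      using ip_eq_of_null[OF _ _ _ uf, of "(A ^^ k) f"] u f by (simp add: Ak_sym)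
    also have "\<dots> = ip ((A ^^ k) u) f - ip ((A ^^ k) (A u)) f"
      using u f by (simp add: lap_def ip_simps Ak_sym)
    finally show ?thesis by (simp add: funpow_swap1)
  qed
  then show ?thesis
    using sum_lessThan_telescope'[of "\<lambda>k. ip ((A ^^ k) u) f" m] by simp
qed

text \<open>With \<open>a m = ip ((A ^^ m) u) u\<close> the right hand side is
  \<open>a m - a (Suc m)\<close>, which makes a second telescoping possible in
  \<open>cov_sum_asymp\<close>.\<close>

lemma poisson_ip:
  assumes u: "u \<in> H" and f: "f \<in> H" and uf: "nrm (lap u - f) = 0"
  shows "ip ((A ^^ m) u) f = ip ((A ^^ m) u) u - ip ((A ^^ m) u) (A u)"
proof -
  have "ip ((A ^^ m) u) f = ip f ((A ^^ m) u)" using u f by (intro ip_commute) auto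
  also have "\<dots> = ip (lap u) ((A ^^ m) u)"
    using u f uf by (intro ip_eq_of_null[symmetric]) auto
  also have "\<dots> = ip ((A ^^ m) u) (lap u)" using u by (intro ip_commute) auto
  finally show ?thesis using u by (simp add: lap_def ip_simps)
qed

text \<open>On the spectral side this is \<open>(1 - \<lambda>) (1 - \<lambda> + 2 \<lambda>\<^sup>m) \<ge> 0\<close> on \<open>[-1, 1]\<close>; for
  \<open>m = 2 p + 1\<close> the left hand side is \<open>(1 - \<lambda>)\<^sup>2 (1 - \<lambda>\<^sup>2\<^sup>p) + \<lambda>\<^sup>2\<^sup>p (1 - \<lambda>\<^sup>2)\<close>.\<close>

lemma poisson_remainder_ge:
  assumes u: "u \<in> H" and f: "f \<in> H" and uf: "nrm (lap u - f) = 0"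
  shows "0 \<le> ip f f + 2 * ip ((A ^^ m) u) f"
proof -
  note mf = poisson_ip[OF u f uf, of m]
  consider p where "m = p + p" | p where "m = Suc (p + p)" by (metis mult_2 oddE evenE Suc_eq_plus1)
  then show ?thesis
  proof cases
    case (1 p)
    let ?w = "(A ^^ p) u"
    \<comment> \<open>For even \<open>m\<close> the second term is nonnegative by itself: it is
      twice the form of \<open>lap\<close> at \<open>?w\<close>.\<close>
    have "ip ((A ^^ m) u) u = ip ?w ?w" "ip ((A ^^ m) u) (A u) = ip ?w (A ?w)"
      using u by (simp_all add: 1 funpow_add Ak_sym funpow_swap1)
    then have "0 \<le> ip ((A ^^ m) u) f"
      using abs_ip_A_le[of ?w] u mf A_sym[of ?w ?w] by simp
    then show ?thesis using ip_nonneg[OF f] by simp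
  next
    case (2 p)
    let ?w = "(A ^^ p) u"
    have 3: "ip ((A ^^ m) u) u = ip (A ?w) ?w" "ip ((A ^^ m) u) (A u) = ip (A ?w) (A ?w)"
      using u by (simp_all add: 2 funpow_add Ak_sym A_sym funpow_swap1)
    have "ip (lap ?w) (lap ?w) = ip ((A ^^ p) f) ((A ^^ p) f)"
    proof -
      have "ip (lap ?w) k = ip ((A ^^ p) f) k" if k: "k \<in> H" for k
      proof -
        have "ip (lap ?w) k = ip (lap u) ((A ^^ p) k)"
          using u k by (simp add: lap_def ip_simps Ak_sym A_sym funpow_swap1)
        also have "\<dots> = ip ((A ^^ p) f) k"
          using ip_eq_of_null[OF _ _ _ uf, of "(A ^^ p) k"] u f k by (simp add: Ak_sym)
        finally show ?thesis .
      qed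
      then show ?thesis using u f ip_commute by (metis Ak_closed lap_closed)
    qed
    also have "\<dots> \<le> ip f f"
      using power_mono[OF nrm_Ak_le[OF f, of p], of 2] f by (simp add: nrm_square nrm_nonneg)
    finally have "ip ?w ?w - 2 * ip (A ?w) ?w + ip (A ?w) (A ?w) \<le> ip f f"
      using u ip_commute[of ?w "A ?w"] by (simp add: lap_def ip_simps)
    then show ?thesis using mf 3 A_contr_square[of ?w] u by simp
  qed
qed

context
  fixes g u f
  assumes g: "g > 0" "\<And>f. f \<in> H \<Longrightarrow> g * ip f f \<le> ip (lap f) f"
    and u: "u \<in> H" and f: "f \<in> H" and uf: "nrm (lap u - f) = 0"
begin

lemma nrm_poisson_le: "nrm u \<le> nrm f / g"
proof (cases "nrm u = 0")
  case False
  then have pos: "nrm u > 0" using nrm_nonneg[OF u] by simp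
  have "g * nrm u * nrm u \<le> ip f u"
    using g(2)[OF u] ip_eq_of_null[OF _ f u uf] u by (simp add: nrm_square[symmetric] power2_eq_square)
  also have "\<dots> \<le> nrm f * nrm u" using abs_ip_le[OF f u] by simp
  finally show ?thesis using pos g(1) by (simp add: field_simps)
qed (use g(1) nrm_nonneg[OF f] in simp)

text \<open>By \<open>cov_sum_const\<close> and \<open>poisson_telescope\<close> the
  \<open>m\<close>-th summand is \<open>2 * ip u f\<close> minus the quantity that
  \<open>poisson_remainder_ge\<close> shows to be nonnegative. So each of the \<open>n\<close>
  summands costs at most \<open>2 * ip f f / g\<close>, without an additive remainder.\<close>

lemma cov_sum_le: "cov_sum n (\<lambda>_. f) \<le> 2 * n * ip f f / g"
proof -
  have "ip u f \<le> nrm u * nrm f" using abs_ip_le[OF u f] by simp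
  also have "\<dots> \<le> nrm f / g * nrm f"
    by (rule mult_right_mono[OF nrm_poisson_le nrm_nonneg[OF f]])
  finally have uf_le: "ip u f \<le> ip f f / g"
    using f by (simp add: nrm_square[symmetric] power2_eq_square)
  have "cov_sum n (\<lambda>_. f) \<le> (\<Sum>m=1..n. 2 * ip u f)"
    unfolding cov_sum_const[OF f] poisson_telescope[OF u f uf]
    using poisson_remainder_ge[OF u f uf] by (intro sum_mono) (simp add: algebra_simps)
  also have "\<dots> \<le> (\<Sum>m=1..n. 2 * (ip f f / g))"
    using uf_le by (intro sum_mono) simp
  finally show ?thesis by (simp add: mult_ac)
qed

text \<open>The subtracted rate is the asymptotic variance. The \<open>n\<close> deviations
  telescope to \<open>- 2 * (a 1 - a (Suc n))\<close>, and each value of \<open>a\<close> is at most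
  \<open>ip u u \<le> ip f f / g\<^sup>2\<close> in modulus; this is the origin of the 4 and of the
  independence of \<open>n\<close>.\<close>

lemma cov_sum_asymp:
  "\<bar>cov_sum n (\<lambda>_. f) - n * (2 * ip u f - ip f f)\<bar> \<le> 4 * ip f f / g\<^sup>2"
proof -
  define a where "a m = ip ((A ^^ m) u) u" for m
  have af: "ip ((A ^^ m) u) f = a m - a (Suc m)" for m
    using poisson_ip[OF u f uf, of m] u by (simp add: a_def A_sym)
  have a_le: "\<bar>a m\<bar> \<le> ip u u" for m
  proof -
    have "\<bar>a m\<bar> \<le> nrm ((A ^^ m) u) * nrm u" unfolding a_def using u by (intro abs_ip_le) auto
    also have "\<dots> \<le> nrm u * nrm u" by (rule mult_right_mono[OF nrm_Ak_le[OF u] nrm_nonneg[OF u]])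
    finally show ?thesis using u by (simp add: nrm_square[symmetric] power2_eq_square)
  qed
  have "cov_sum n (\<lambda>_. f) - n * (2 * ip u f - ip f f) = (\<Sum>m=1..n. - 2 * ip ((A ^^ m) u) f)"
    unfolding cov_sum_const[OF f] poisson_telescope[OF u f uf]
    by (simp add: sum_subtractf sum.distrib sum_negf algebra_simps sum_distrib_left)
  also have "\<dots> = - 2 * (a 1 - a (Suc n))"
    unfolding af sum_distrib_left[symmetric] by (induction n) (auto simp: algebra_simps)
  also have "\<bar>\<dots>\<bar> \<le> 4 * ip u u" using a_le[of 1] a_le[of "Suc n"] by simp
  also have "\<dots> \<le> 4 * (ip f f / g\<^sup>2)"
    using power_mono[OF nrm_poisson_le nrm_nonneg[OF u], of 2] u f
    by (simp add: nrm_square power_divide)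
  finally show ?thesis by simp
qed

end

lemma sum_power_lag_le:
  fixes b :: real
  assumes b: "0 \<le> b" "b < 1" and i: "i \<in> {1..n}"
  shows "(\<Sum>j=1..n. b ^ lag i j) \<le> 2 / (1 - b)"
proof -
  have geom: "(\<Sum>k<m. b ^ k) \<le> 1 / (1 - b)" for m
  proof -
    have "(\<Sum>k<m. b ^ k) = (1 - b ^ m) / (1 - b)" using b by (simp add: sum_gp_strict)
    also have "\<dots> \<le> 1 / (1 - b)" using b by (intro divide_right_mono) auto
    finally show ?thesis .
  qed
  have "(\<Sum>j=1..n. b ^ lag i j) = (\<Sum>j\<in>{1..i}. b ^ lag i j) + (\<Sum>j\<in>{Suc i..n}. b ^ lag i j)"
    using i by (subst sum.union_disjoint[symmetric]) (auto intro!: sum.cong)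
  also have "(\<Sum>j\<in>{1..i}. b ^ lag i j) = (\<Sum>k<i. b ^ k)"
    by (rule sum.reindex_bij_witness[of _ "\<lambda>k. i - k" "\<lambda>j. i - j"]) (auto simp: lag_def)
  \<comment> \<open>Counting \<open>j = i\<close> a second time makes both halves geometric sums
    starting at exponent 0, each at most \<open>1 / (1 - b)\<close>.\<close>
  also have "(\<Sum>j\<in>{Suc i..n}. b ^ lag i j) \<le> (\<Sum>j\<in>{i..n}. b ^ lag i j)"
    using b by (intro sum_mono2) auto
  also have "(\<Sum>j\<in>{i..n}. b ^ lag i j) = (\<Sum>k<Suc n - i. b ^ k)"
    by (rule sum.reindex_bij_witness[of _ "\<lambda>k. i + k" "\<lambda>j. j - i"]) (auto simp: lag_def)
  finally show ?thesis using geom[of i] geom[of "Suc n - i"] by simp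
qed

text \<open>Schur test: \<open>A ^^ k\<close> has norm at most \<open>b ^ k\<close>, the product of
  two norms is at most half the sum of their squares, and by symmetry of \<open>lag\<close> only the
  row sums of \<open>b ^ lag i j\<close> remain.\<close>

lemma cov_sum_le_sum:
  assumes b: "0 \<le> b" "b < 1" "\<And>f. f \<in> H \<Longrightarrow> nrm (A f) \<le> b * nrm f"
    and F: "\<And>i. i \<in> {1..n} \<Longrightarrow> F i \<in> H"
  shows "cov_sum n F \<le> 2 / (1 - b) * (\<Sum>i=1..n. ip (F i) (F i))"
proof -
  have decay: "nrm ((A ^^ k) f) \<le> b ^ k * nrm f" if "f \<in> H" for k f
  proof (induction k)
    case (Suc k)
    have "nrm ((A ^^ Suc k) f) \<le> b * nrm ((A ^^ k) f)" using b(3) that by simp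
    also have "\<dots> \<le> b * (b ^ k * nrm f)" using Suc b(1) by (rule mult_left_mono)
    finally show ?case by (simp add: mult_ac)
  qed simp
  have entry: "ip ((A ^^ lag i j) (F i)) (F j) \<le> b ^ lag i j * (ip (F i) (F i) / 2 + ip (F j) (F j) / 2)"
    if ij: "i \<in> {1..n}" "j \<in> {1..n}" for i j
  proof -
    have H: "F i \<in> H" "F j \<in> H" using F ij by auto
    have "ip ((A ^^ lag i j) (F i)) (F j) \<le> nrm ((A ^^ lag i j) (F i)) * nrm (F j)"
      using abs_ip_le[of "(A ^^ lag i j) (F i)" "F j"] H by simp
    also have "\<dots> \<le> b ^ lag i j * nrm (F i) * nrm (F j)"
      by (rule mult_right_mono[OF decay[OF H(1)] nrm_nonneg[OF H(2)]])
    also have "\<dots> \<le> b ^ lag i j * ((nrm (F i))\<^sup>2 / 2 + (nrm (F j))\<^sup>2 / 2)"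
      unfolding mult.assoc
      using b(1) sum_squares_bound[of "nrm (F i)" "nrm (F j)"] by (intro mult_left_mono) auto
    finally show ?thesis using H by (simp add: nrm_square)
  qed
  have "cov_sum n F \<le> (\<Sum>i=1..n. \<Sum>j=1..n. b ^ lag i j * (ip (F i) (F i) / 2 + ip (F j) (F j) / 2))"
    unfolding cov_sum_def by (intro sum_mono entry)
  also have "\<dots> = (\<Sum>i=1..n. \<Sum>j=1..n. b ^ lag i j * (ip (F i) (F i) / 2))
      + (\<Sum>i=1..n. \<Sum>j=1..n. b ^ lag i j * (ip (F j) (F j) / 2))"
    by (simp add: algebra_simps sum.distrib)
  also have "(\<Sum>i=1..n. \<Sum>j=1..n. b ^ lag i j * (ip (F j) (F j) / 2))
      = (\<Sum>i=1..n. \<Sum>j=1..n. b ^ lag i j * (ip (F i) (F i) / 2))"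
    by (subst sum.swap) (simp add: lag_commute)
  also have "(\<Sum>i=1..n. \<Sum>j=1..n. b ^ lag i j * (ip (F i) (F i) / 2)) + \<dots>
      = (\<Sum>i=1..n. (\<Sum>j=1..n. b ^ lag i j) * ip (F i) (F i))"
    by (simp add: sum_distrib_right sum.distrib[symmetric])
  also have "\<dots> \<le> (\<Sum>i=1..n. 2 / (1 - b) * ip (F i) (F i))"
    using b F by (intro sum_mono mult_right_mono sum_power_lag_le ip_nonneg) auto
  finally show ?thesis by (simp add: sum_distrib_left)
qed

end

section \<open>Square integrable functions\<close>

text \<open>All functions form the ambient vector space, with \<open>L2\<close> and
  \<open>L2_mean_zero\<close> as subspaces; equality almost everywhere is left to the
  seminorm.\<close>

instantiation "fun" :: (type, real_vector) real_vector
begin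

definition scaleR_fun_def: "scaleR r f = (\<lambda>x. r *\<^sub>R f x)"

instance
  by standard (auto simp: scaleR_fun_def fun_eq_iff scaleR_add_right scaleR_add_left)

end

definition L2_re_inner :: "'a measure \<Rightarrow> ('a \<Rightarrow> complex) \<Rightarrow> ('a \<Rightarrow> complex) \<Rightarrow> real" where
  "L2_re_inner M f g = Re (L2_inner M f g)"

definition L2_mean_zero :: "'a measure \<Rightarrow> ('a \<Rightarrow> complex) set" where
  "L2_mean_zero M = {f \<in> L2 M. (\<integral>x. f x \<partial>M) = 0}"

lemma borel_measurable_cnj [measurable (raw)]:
  "f \<in> borel_measurable M \<Longrightarrow> (\<lambda>x. cnj (f x)) \<in> borel_measurable M"
  by (rule measurable_compose[OF _ borel_measurable_continuous_onI[of cnj]])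
    (auto intro: continuous_on_cnj continuous_on_id)

lemma cmod_add_square_le: "(cmod (a + b))\<^sup>2 \<le> 2 * (cmod a)\<^sup>2 + 2 * (cmod b)\<^sup>2"
proof -
  have "(cmod (a + b))\<^sup>2 \<le> (cmod a + cmod b)\<^sup>2"
    by (intro power_mono norm_triangle_ineq) auto
  also have "\<dots> \<le> 2 * (cmod a)\<^sup>2 + 2 * (cmod b)\<^sup>2"
    using sum_squares_bound[of "cmod a" "cmod b"] by (simp add: power2_sum)
  finally show ?thesis .
qed

lemma L2_measurable [measurable_dest]: "f \<in> L2 M \<Longrightarrow> f \<in> borel_measurable M"
  by (simp add: L2_def)

lemma L2_integrable_square: "f \<in> L2 M \<Longrightarrow> integrable M (\<lambda>x. (cmod (f x))\<^sup>2)"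
  by (simp add: L2_def)

lemma L2_I_bound:
  assumes "f \<in> borel_measurable M" "integrable M g" "\<And>x. x \<in> space M \<Longrightarrow> (cmod (f x))\<^sup>2 \<le> g x"
  shows "f \<in> L2 M"
  using assms unfolding L2_def by (auto intro!: Bochner_Integration.integrable_bound[OF assms(2)] AE_I2 order_trans[OF _ abs_ge_self])

lemma L2_add: "f \<in> L2 M \<Longrightarrow> g \<in> L2 M \<Longrightarrow> (\<lambda>x. f x + g x) \<in> L2 M"
  by (rule L2_I_bound[where g = "\<lambda>x. 2 * (cmod (f x))\<^sup>2 + 2 * (cmod (g x))\<^sup>2"])
    (auto intro!: borel_measurable_add L2_measurable L2_integrable_square cmod_add_square_le)

lemma L2_scale: "f \<in> L2 M \<Longrightarrow> (\<lambda>x. c * f x) \<in> L2 M"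
  by (auto simp: L2_def norm_mult power_mult_distrib)

lemma L2_diff: "f \<in> L2 M \<Longrightarrow> g \<in> L2 M \<Longrightarrow> (\<lambda>x. f x - g x) \<in> L2 M"
  using L2_add[of f M "\<lambda>x. - 1 * g x"] L2_scale[of g M "-1"] by simp

lemma L2_integrable_mult:
  assumes "f \<in> L2 M" "g \<in> L2 M"
  shows "integrable M (\<lambda>x. f x * cnj (g x))"
proof (rule Bochner_Integration.integrable_bound)
  show "integrable M (\<lambda>x. (cmod (f x))\<^sup>2 + (cmod (g x))\<^sup>2)"
    using assms by (intro Bochner_Integration.integrable_add L2_integrable_square)
  have [measurable]: "f \<in> borel_measurable M" "g \<in> borel_measurable M"
    using assms L2_measurable by auto
  show "(\<lambda>x. f x * cnj (g x)) \<in> borel_measurable M" by measurable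
  have "cmod (f x) * cmod (g x) \<le> (cmod (f x))\<^sup>2 + (cmod (g x))\<^sup>2" for x
    using sum_squares_bound[of "cmod (f x)" "cmod (g x)"] mult_nonneg_nonneg[of "cmod (f x)" "cmod (g x)"]
    by (simp add: mult.assoc del: mult_nonneg_nonneg zero_le_mult_iff)
  then show "AE x in M. norm (f x * cnj (g x)) \<le> norm ((cmod (f x))\<^sup>2 + (cmod (g x))\<^sup>2)"
    by (auto simp: norm_mult)
qed

lemma L2_inner_add_left:
  "f \<in> L2 M \<Longrightarrow> g \<in> L2 M \<Longrightarrow> h \<in> L2 M \<Longrightarrow> L2_inner M (\<lambda>x. f x + g x) h = L2_inner M f h + L2_inner M g h"
  unfolding L2_inner_def by (simp add: distrib_right L2_integrable_mult)

lemma L2_inner_cnj: "L2_inner M g f = cnj (L2_inner M f g)"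
  unfolding L2_inner_def by (subst Bochner_Integration.integral_cnj[symmetric]) (simp add: mult.commute)

lemma L2_inner_self: "L2_inner M f f = complex_of_real (\<integral>x. (cmod (f x))\<^sup>2 \<partial>M)"
  unfolding L2_inner_def by (simp only: complex_norm_square[symmetric] of_real_power[symmetric] integral_complex_of_real)

lemma L2_re_inner_self: "L2_re_inner M f f = (\<integral>x. (cmod (f x))\<^sup>2 \<partial>M)"
  by (simp add: L2_re_inner_def L2_inner_self)

lemma L2_norm_eq: "L2_norm M f = sqrt (L2_re_inner M f f)"
  by (simp add: L2_norm_def L2_re_inner_self)

lemma L2_norm_nonneg: "0 \<le> L2_norm M f"
  by (simp add: L2_norm_def)

lemma L2_norm_0_iff: "f \<in> L2 M \<Longrightarrow> L2_norm M f = 0 \<longleftrightarrow> (AE x in M. f x = 0)"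
  using integral_nonneg_eq_0_iff_AE[of M "\<lambda>x. (cmod (f x))\<^sup>2"]
  by (simp add: L2_norm_def L2_integrable_square)

lemma L2_norm_cong_AE:
  assumes "f \<in> borel_measurable M" "g \<in> borel_measurable M" "AE x in M. f x = g x"
  shows "L2_norm M f = L2_norm M g"
proof -
  note [measurable] = assms(1,2)
  show ?thesis unfolding L2_norm_def
    using assms(3) by (intro arg_cong[where f = sqrt] integral_cong_AE) auto
qed

lemma L2_norm_scale: "L2_norm M (\<lambda>x. c * f x) = cmod c * L2_norm M f"
  by (simp add: L2_norm_def norm_mult power_mult_distrib real_sqrt_mult)

lemma L2_norm_minus_commute: "L2_norm M (\<lambda>x. f x - g x) = L2_norm M (\<lambda>x. g x - f x)"
  by (simp add: L2_norm_def norm_minus_commute)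

lemma semi_inner_space_L2: "semi_inner_space (L2 M) (L2_re_inner M)"
proof
  show "subspace (L2 M)"
    unfolding subspace_def
  proof (intro conjI ballI allI)
    show "0 \<in> L2 M" by (simp add: L2_def zero_fun_def)
    show "f + g \<in> L2 M" if "f \<in> L2 M" "g \<in> L2 M" for f g
      using L2_add[OF that] by (simp add: plus_fun_def)
    show "c *\<^sub>R f \<in> L2 M" if "f \<in> L2 M" for c f
      using L2_scale[OF that, of "of_real c"] by (simp add: scaleR_fun_def scaleR_conv_of_real)
  qed
next
  fix f g h :: "'a \<Rightarrow> complex" and a :: real
  assume f: "f \<in> L2 M" and g: "g \<in> L2 M"
  show "L2_re_inner M f g = L2_re_inner M g f"
    unfolding L2_re_inner_def by (subst L2_inner_cnj) simp
  show "L2_re_inner M (a *\<^sub>R f) g = a * L2_re_inner M f g"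
    by (simp add: L2_re_inner_def L2_inner_def scaleR_fun_def)
  show "L2_re_inner M (f + g) h = L2_re_inner M f h + L2_re_inner M g h" if "h \<in> L2 M"
    using L2_inner_add_left[OF f g that] by (simp add: L2_re_inner_def plus_fun_def)
next
  show "0 \<le> L2_re_inner M f f" for f by (simp add: L2_re_inner_self)
qed

section \<open>L2 over a probability space and its completeness\<close>

context prob_space
begin

lemma L2_const: "(\<lambda>_. c) \<in> L2 M"
  by (simp add: L2_def)

lemma L2_integrable: "f \<in> L2 M \<Longrightarrow> integrable M f"
  using L2_integrable_mult[OF _ L2_const[of 1]] by simp

text \<open>Nonnegativity of the variance of \<open>cmod (f x)\<close> serves as Jensen's
  inequality.\<close>

lemma norm_integral_le_L2_norm:
  assumes f: "f \<in> L2 M"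
  shows "(\<integral>x. cmod (f x) \<partial>M) \<le> L2_norm M f" "cmod (\<integral>x. f x \<partial>M) \<le> L2_norm M f"
proof -
  have "0 \<le> variance (\<lambda>x. cmod (f x))" by (rule variance_positive)
  then have "(\<integral>x. cmod (f x) \<partial>M)\<^sup>2 \<le> (\<integral>x. (cmod (f x))\<^sup>2 \<partial>M)"
    using f by (subst (asm) variance_eq) (auto intro: L2_integrable L2_integrable_square)
  then show "(\<integral>x. cmod (f x) \<partial>M) \<le> L2_norm M f"
    unfolding L2_norm_def by (intro real_le_rsqrt)
  then show "cmod (\<integral>x. f x \<partial>M) \<le> L2_norm M f"
    by (rule order_trans[OF integral_norm_bound])
qed

text \<open>Riesz-Fischer. The L1 norms of the increments are dominated by their L2 norms, so the
  series of increments converges absolutely almost everywhere and defines \<open>v\<close>. The tail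
  \<open>t k\<close> bounds the distance from \<open>x k\<close> to every later term, and Fatou's
  lemma carries this bound over to \<open>v\<close>.\<close>

lemma L2_absolutely_convergent:
  assumes x: "\<And>k. x k \<in> L2 M" and sum: "summable (\<lambda>k. L2_norm M (\<lambda>z. x (Suc k) z - x k z))"
  shows "\<exists>v\<in>L2 M. (\<lambda>k. L2_norm M (\<lambda>z. x k z - v z)) \<longlonglongrightarrow> 0"
proof -
  interpret L: semi_inner_space "L2 M" "L2_re_inner M" by (rule semi_inner_space_L2)
  have nrm: "L.nrm f = L2_norm M f" for f by (simp add: L.nrm_def L2_norm_eq)
  have [measurable]: "x k \<in> borel_measurable M" for k using x by (rule L2_measurable)
  define a where "a = (\<lambda>k. L2_norm M (\<lambda>z. x (Suc k) z - x k z))"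
  have sum_a: "summable a" using sum by (simp add: a_def)
  have a0: "0 \<le> a k" for k by (simp add: a_def L2_norm_def)
  have d: "(\<lambda>z. x (Suc k) z - x k z) \<in> L2 M" for k by (intro L2_diff x)
  have "(\<integral>\<^sup>+z. (\<Sum>k. ennreal (cmod (x (Suc k) z - x k z))) \<partial>M)
      = (\<Sum>k. \<integral>\<^sup>+z. ennreal (cmod (x (Suc k) z - x k z)) \<partial>M)"
    by (intro nn_integral_suminf) simp
  also have "\<dots> = (\<Sum>k. ennreal (\<integral>z. cmod (x (Suc k) z - x k z) \<partial>M))"
    by (intro arg_cong[where f = suminf] ext nn_integral_eq_integral integrable_norm L2_integrable d) simp
  also have "\<dots> \<le> (\<Sum>k. ennreal (a k))"
    unfolding a_def by (intro suminf_le ennreal_leI norm_integral_le_L2_norm d) auto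
  also have "\<dots> = ennreal (\<Sum>k. a k)" by (rule suminf_ennreal2[OF a0 sum_a])
  finally have "(\<integral>\<^sup>+z. (\<Sum>k. ennreal (cmod (x (Suc k) z - x k z))) \<partial>M) \<noteq> \<infinity>"
    by (auto simp: top_unique)
  then have "AE z in M. (\<Sum>k. ennreal (cmod (x (Suc k) z - x k z))) \<noteq> \<infinity>"
    by (intro nn_integral_noteq_infinite) auto
  then have conv: "AE z in M. convergent (\<lambda>k. x k z)"
  proof eventually_elim
    case (elim z)
    then have "summable (\<lambda>k. cmod (x (Suc k) z - x k z))"
      by (intro summable_suminf_not_top) auto
    then have "summable (\<lambda>k. x (Suc k) z - x k z)" by (rule summable_norm_cancel)
    then have "convergent (\<lambda>n. \<Sum>k<n. x (Suc k) z - x k z)"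
      by (simp add: summable_iff_convergent)
    then have "convergent (\<lambda>n. x n z - x 0 z)" by (simp add: sum_lessThan_telescope[of "\<lambda>n. x n z"])
    from convergent_add[OF this convergent_const[of "x 0 z"]] show ?case by simp
  qed
  define v where "v z = lim (\<lambda>k. x k z)" for z
  have [measurable]: "v \<in> borel_measurable M"
    unfolding v_def by (rule borel_measurable_lim_metric) simp
  have lim: "AE z in M. (\<lambda>k. x k z) \<longlonglongrightarrow> v z"
    using conv by eventually_elim (simp add: v_def convergent_LIMSEQ_iff)
  define t where "t k = (\<Sum>i. a i) - (\<Sum>i<k. a i)" for k
  have dist: "L2_norm M (\<lambda>z. x k z - x (k + j) z) \<le> (\<Sum>i<k+j. a i) - (\<Sum>i<k. a i)" for k j
  proof (induction j)
    case (Suc j)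
    have "L2_norm M (\<lambda>z. x k z - x (k + Suc j) z)
        \<le> L2_norm M (\<lambda>z. x k z - x (k + j) z) + L2_norm M (\<lambda>z. x (k + j) z - x (Suc (k + j)) z)"
      using L.nrm_triangle_diff[OF x[of k] x[of "k + j"] x[of "Suc (k + j)"]] by (simp add: nrm fun_diff_def)
    also have "L2_norm M (\<lambda>z. x (k + j) z - x (Suc (k + j)) z) = a (k + j)"
      unfolding a_def by (rule L2_norm_minus_commute)
    finally show ?case using Suc by simp
  qed (simp add: L2_norm_def)
  have le_t: "L2_norm M (\<lambda>z. x k z - x (k + j) z) \<le> t k" for k j
    using dist[of k j] sum_le_suminf[OF sum_a, of "{..<k+j}"] a0 by (simp add: t_def)
  have t0: "0 \<le> t k" for k using le_t[of k 0] by (simp add: L2_norm_def)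
  have fatou: "(\<integral>\<^sup>+z. ennreal ((cmod (x k z - v z))\<^sup>2) \<partial>M) \<le> ennreal ((t k)\<^sup>2)" for k
  proof -
    have "(\<integral>\<^sup>+z. ennreal ((cmod (x k z - v z))\<^sup>2) \<partial>M)
        = (\<integral>\<^sup>+z. liminf (\<lambda>j. ennreal ((cmod (x k z - x (k + j) z))\<^sup>2)) \<partial>M)"
    proof (intro nn_integral_cong_AE)
      show "AE z in M. ennreal ((cmod (x k z - v z))\<^sup>2) =
          liminf (\<lambda>j. ennreal ((cmod (x k z - x (k + j) z))\<^sup>2))"
        using lim
      proof eventually_elim
        case (elim z)
        have "(\<lambda>j. x (k + j) z) \<longlonglongrightarrow> v z"
          using LIMSEQ_ignore_initial_segment[OF elim, of k] by (simp add: add.commute)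
        then have "(\<lambda>j. ennreal ((cmod (x k z - x (k + j) z))\<^sup>2)) \<longlonglongrightarrow> ennreal ((cmod (x k z - v z))\<^sup>2)"
          by (intro tendsto_intros)
        then show ?case by (rule lim_imp_Liminf[OF sequentially_bot, symmetric])
      qed
    qed
    also have "\<dots> \<le> liminf (\<lambda>j. \<integral>\<^sup>+z. ennreal ((cmod (x k z - x (k + j) z))\<^sup>2) \<partial>M)"
      by (rule nn_integral_liminf) simp
    also have "\<dots> \<le> liminf (\<lambda>j. ennreal ((t k)\<^sup>2))"
    proof (intro Liminf_mono always_eventually allI)
      fix j
      have "(\<integral>\<^sup>+z. ennreal ((cmod (x k z - x (k + j) z))\<^sup>2) \<partial>M)
          = ennreal (\<integral>z. (cmod (x k z - x (k + j) z))\<^sup>2 \<partial>M)"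
        by (intro nn_integral_eq_integral L2_integrable_square L2_diff x) auto
      also have "(\<integral>z. (cmod (x k z - x (k + j) z))\<^sup>2 \<partial>M) = (L2_norm M (\<lambda>z. x k z - x (k + j) z))\<^sup>2"
        by (simp add: L2_norm_def)
      also have "ennreal \<dots> \<le> ennreal ((t k)\<^sup>2)"
        by (intro ennreal_leI power_mono le_t) (simp add: L2_norm_def)
      finally show "(\<integral>\<^sup>+z. ennreal ((cmod (x k z - x (k + j) z))\<^sup>2) \<partial>M) \<le> ennreal ((t k)\<^sup>2)" .
    qed
    also have "\<dots> = ennreal ((t k)\<^sup>2)" by (simp add: Liminf_const)
    finally show ?thesis .
  qed
  have xv: "(\<lambda>z. x k z - v z) \<in> L2 M" for k
  proof -
    have "integrable M (\<lambda>z. (cmod (x k z - v z))\<^sup>2)"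
      using le_less_trans[OF fatou[of k] ennreal_less_top] by (intro integrableI_bounded) auto
    then show ?thesis by (simp add: L2_def)
  qed
  have norm_le: "L2_norm M (\<lambda>z. x k z - v z) \<le> t k" for k
  proof -
    have "ennreal (\<integral>z. (cmod (x k z - v z))\<^sup>2 \<partial>M) \<le> ennreal ((t k)\<^sup>2)"
      using fatou[of k] nn_integral_eq_integral[OF L2_integrable_square[OF xv[of k]]] by simp
    then have "(\<integral>z. (cmod (x k z - v z))\<^sup>2 \<partial>M) \<le> (t k)\<^sup>2" by (simp add: ennreal_le_iff)
    then show ?thesis unfolding L2_norm_def using t0 by (intro real_le_lsqrt) auto
  qed
  have "v \<in> L2 M" using L2_diff[OF x[of 0] xv[of 0]] by simp
  moreover have "t \<longlonglongrightarrow> 0"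
    unfolding t_def using tendsto_diff[OF tendsto_const[of "suminf a"] summable_LIMSEQ[OF sum_a]] by simp
  then have "(\<lambda>k. L2_norm M (\<lambda>z. x k z - v z)) \<longlonglongrightarrow> 0"
    by (rule Lim_null_comparison[rotated]) (use norm_le in \<open>auto simp: L2_norm_def\<close>)
  ultimately show ?thesis by blast
qed

lemma semi_hilbert_space_L2: "semi_hilbert_space (L2 M) (L2_re_inner M)"
proof -
  interpret L: semi_inner_space "L2 M" "L2_re_inner M" by (rule semi_inner_space_L2)
  have nrm: "L.nrm f = L2_norm M f" for f by (simp add: L.nrm_def L2_norm_eq)
  show ?thesis
    by unfold_locales (use L2_absolutely_convergent in \<open>simp add: nrm fun_diff_def\<close>)
qed

text \<open>Completeness is inherited because the mean is continuous for the L2 norm, so limits of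
  mean zero functions have mean zero.\<close>

lemma semi_hilbert_space_L2_mean_zero: "semi_hilbert_space (L2_mean_zero M) (L2_re_inner M)"
proof -
  interpret L: semi_hilbert_space "L2 M" "L2_re_inner M" by (rule semi_hilbert_space_L2)
  have nrm: "L.nrm f = L2_norm M f" for f by (simp add: L.nrm_def L2_norm_eq)
  interpret Z: semi_inner_space "L2_mean_zero M" "L2_re_inner M"
  proof
    show "subspace (L2_mean_zero M)"
      unfolding subspace_def
    proof (intro conjI ballI allI)
      show "0 \<in> L2_mean_zero M" using L.H_closed(1) by (simp add: L2_mean_zero_def zero_fun_def)
      show "f + g \<in> L2_mean_zero M" if "f \<in> L2_mean_zero M" "g \<in> L2_mean_zero M" for f g
        using that L.H_closed(2)[of f g] by (simp add: L2_mean_zero_def L2_integrable plus_fun_def)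
      show "c *\<^sub>R f \<in> L2_mean_zero M" if "f \<in> L2_mean_zero M" for c f
        using that L.H_closed(3)[of f c] by (simp add: L2_mean_zero_def scaleR_fun_def)
    qed
  qed (auto simp: L2_mean_zero_def L.ip_simps L.ip_commute L.ip_nonneg)
  have znrm: "Z.nrm f = L2_norm M f" for f by (simp add: Z.nrm_def L2_norm_eq)
  show ?thesis
  proof
    fix x :: "nat \<Rightarrow> 'a \<Rightarrow> complex"
    assume x: "\<And>k. x k \<in> L2_mean_zero M" and sum: "summable (\<lambda>k. Z.nrm (x (Suc k) - x k))"
    have xL: "x k \<in> L2 M" for k using x by (simp add: L2_mean_zero_def)
    obtain v where v: "v \<in> L2 M" "(\<lambda>k. L2_norm M (x k - v)) \<longlonglongrightarrow> 0"
      using L.complete[of x] xL sum by (auto simp: nrm znrm)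
    have "cmod (\<integral>z. v z \<partial>M) \<le> L2_norm M (x k - v)" for k
    proof -
      have "(\<integral>z. (x k - v) z \<partial>M) = - (\<integral>z. v z \<partial>M)"
        using x[of k] v(1) by (simp add: L2_mean_zero_def L2_integrable)
      then show ?thesis
        using norm_integral_le_L2_norm(2)[of "x k - v"] L.H_closed(4)[OF xL v(1), of k] by simp
    qed
    then have "cmod (\<integral>z. v z \<partial>M) \<le> 0"
      using v(2) by (intro LIMSEQ_le_const) auto
    then have "v \<in> L2_mean_zero M" using v(1) by (simp add: L2_mean_zero_def)
    with v show "\<exists>v\<in>L2_mean_zero M. (\<lambda>k. Z.nrm (x k - v)) \<longlonglongrightarrow> 0" by (auto simp: znrm)
  qed
qed

end

section \<open>Integration along a kernel\<close>

text \<open>Integrability against the mixture passes to \<open>N x\<close> only for almost every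
  \<open>x\<close>; elsewhere the Bochner integral has its default value 0. This is why additivity
  of \<open>markov_op\<close> is stated almost everywhere.\<close>

lemma
  fixes f :: "'b \<Rightarrow> 'c::{banach, second_countable_topology}"
  assumes N: "N \<in> M \<rightarrow>\<^sub>M subprob_algebra B" and f: "integrable (bind M N) f" and ne: "space M \<noteq> {}"
  shows AE_integrable_kernel: "AE x in M. integrable (N x) f"
    and integrable_integral_norm_kernel: "integrable M (\<lambda>x. \<integral>y. norm (f y) \<partial>N x)"
proof -
  have sets_bind [measurable_cong]: "sets (bind M N) = sets B" by (rule sets_bind[OF sets_kernel[OF N] ne])
  have fB [measurable]: "f \<in> borel_measurable B"
    using borel_measurable_integrable[OF f] by simp
  note [measurable] = N
  have sets_N: "sets (N x) = sets B" if "x \<in> space M" for x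
    using sets_kernel[OF N that] .
  have fN: "f \<in> borel_measurable (N x)" if "x \<in> space M" for x
    using measurable_cong_sets[OF sets_N[OF that] refl] fB by blast
  have "(\<integral>\<^sup>+x. \<integral>\<^sup>+y. ennreal (norm (f y)) \<partial>N x \<partial>M) = (\<integral>\<^sup>+y. ennreal (norm (f y)) \<partial>bind M N)"
    by (rule nn_integral_bind[symmetric, OF _ N]) measurable
  also have "\<dots> < \<infinity>" using f by (simp add: integrable_iff_bounded)
  finally have fin: "(\<integral>\<^sup>+x. \<integral>\<^sup>+y. ennreal (norm (f y)) \<partial>N x \<partial>M) < \<infinity>" .
  have meas: "(\<lambda>x. \<integral>\<^sup>+y. ennreal (norm (f y)) \<partial>N x) \<in> borel_measurable M"
    by (rule measurable_compose[OF N nn_integral_measurable_subprob_algebra]) measurable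
  have "AE x in M. (\<integral>\<^sup>+y. ennreal (norm (f y)) \<partial>N x) \<noteq> \<infinity>"
    using fin by (intro nn_integral_noteq_infinite meas) auto
  then show AE: "AE x in M. integrable (N x) f"
    using AE_space by eventually_elim (auto simp: integrable_iff_bounded fN less_top)
  show "integrable M (\<lambda>x. \<integral>y. norm (f y) \<partial>N x)"
  proof (rule integrableI_bounded)
    show "(\<lambda>x. \<integral>y. norm (f y) \<partial>N x) \<in> borel_measurable M"
      by (rule measurable_compose[OF N integral_measurable_subprob_algebra]) measurable
    have "(\<integral>\<^sup>+x. ennreal (norm (\<integral>y. norm (f y) \<partial>N x)) \<partial>M) = (\<integral>\<^sup>+x. \<integral>\<^sup>+y. ennreal (norm (f y)) \<partial>N x \<partial>M)"
      by (rule nn_integral_cong_AE, use AE in eventually_elim) (simp add: nn_integral_eq_integral)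
    with fin show "(\<integral>\<^sup>+x. ennreal (norm (\<integral>y. norm (f y) \<partial>N x)) \<partial>M) < \<infinity>" by simp
  qed
qed

lemma integral_bind_kernel:
  fixes f :: "'b \<Rightarrow> 'c::{banach, second_countable_topology}"
  assumes N: "N \<in> M \<rightarrow>\<^sub>M subprob_algebra B" and f: "integrable (bind M N) f" and ne: "space M \<noteq> {}"
  shows "(\<integral>y. f y \<partial>bind M N) = (\<integral>x. \<integral>y. f y \<partial>N x \<partial>M)"
proof -
  have sets_bind [measurable_cong]: "sets (bind M N) = sets B" by (rule sets_bind[OF sets_kernel[OF N] ne])
  have kernel_meas: "(\<lambda>x. \<integral>y. g y \<partial>N x) \<in> borel_measurable M" if "integrable (bind M N) g"
    for g :: "'b \<Rightarrow> 'c"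
    using borel_measurable_integrable[OF that]
    by (intro measurable_compose[OF N integral_measurable_subprob_algebra]) simp
  have int: "integrable M (\<lambda>x. \<integral>y. g y \<partial>N x)" if g: "integrable (bind M N) g" for g :: "'b \<Rightarrow> 'c"
    by (rule Bochner_Integration.integrable_bound[OF integrable_integral_norm_kernel[OF N g ne] kernel_meas[OF g]])
      (intro AE_I2 order_trans[OF integral_norm_bound], simp)
  from f show "(\<integral>y. f y \<partial>bind M N) = (\<integral>x. \<integral>y. f y \<partial>N x \<partial>M)"
  proof (induction rule: integrable_induct)
    case (base A c)
    have A: "A \<in> sets B" using base sets_bind by simp
    have AN: "A \<in> sets (N x)" "emeasure (N x) A = ennreal (measure (N x) A)" if "x \<in> space M" for x
    proof -
      interpret subprob_space "N x" by (rule subprob_space_kernel[OF N that])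
      show "emeasure (N x) A = ennreal (measure (N x) A)" by (rule emeasure_eq_measure)
      show "A \<in> sets (N x)" using sets_kernel[OF N that] A by simp
    qed
    have meas: "(\<lambda>x. measure (N x) A) \<in> borel_measurable M"
      by (rule measurable_compose[OF N measurable_measure_subprob_algebra[OF A]])
    have "measure (bind M N) A = enn2real (\<integral>\<^sup>+x. emeasure (N x) A \<partial>M)"
      by (simp add: measure_def emeasure_bind[OF ne N A])
    also have "(\<integral>\<^sup>+x. emeasure (N x) A \<partial>M) = (\<integral>\<^sup>+x. ennreal (measure (N x) A) \<partial>M)"
      by (rule nn_integral_cong) (rule AN)
    also have "enn2real \<dots> = (\<integral>x. measure (N x) A \<partial>M)"
      using meas by (intro integral_eq_nn_integral[symmetric]) auto
    finally have eq: "measure (bind M N) A = (\<integral>x. measure (N x) A \<partial>M)" .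
    have fin: "(\<integral>\<^sup>+x. ennreal (measure (N x) A) \<partial>M) < \<infinity>"
    proof -
      have "(\<integral>\<^sup>+x. ennreal (measure (N x) A) \<partial>M) = (\<integral>\<^sup>+x. emeasure (N x) A \<partial>M)"
        by (rule nn_integral_cong) (rule AN(2)[symmetric])
      then show ?thesis using base emeasure_bind[OF ne N A] by simp
    qed
    have "(\<integral>x. \<integral>y. indicator A y *\<^sub>R c \<partial>N x \<partial>M) = (\<integral>x. measure (N x) A *\<^sub>R c \<partial>M)"
    proof (rule Bochner_Integration.integral_cong[OF refl])
      fix x assume x: "x \<in> space M"
      have "emeasure (N x) A < \<infinity>" using AN(2)[OF x] by simp
      then show "(\<integral>y. indicator A y *\<^sub>R c \<partial>N x) = measure (N x) A *\<^sub>R c"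
        using AN(1)[OF x] by simp
    qed
    also have "\<dots> = (\<integral>x. measure (N x) A \<partial>M) *\<^sub>R c"
      using meas fin by (intro integral_scaleR_left integrableI_bounded) auto
    finally show ?case using eq base by simp
  next
    case (add g h)
    have "AE x in M. (\<integral>y. g y + h y \<partial>N x) = (\<integral>y. g y \<partial>N x) + (\<integral>y. h y \<partial>N x)"
      using AE_integrable_kernel[OF N add.hyps(1) ne] AE_integrable_kernel[OF N add.hyps(2) ne]
      by eventually_elim simp
    then have "(\<integral>x. \<integral>y. g y + h y \<partial>N x \<partial>M) = (\<integral>x. (\<integral>y. g y \<partial>N x) + (\<integral>y. h y \<partial>N x) \<partial>M)"
      using kernel_meas[OF add.hyps(1)] kernel_meas[OF add.hyps(2)] kernel_meas[OF Bochner_Integration.integrable_add[OF add.hyps]]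
      by (intro integral_cong_AE) auto
    then show ?case using add int by simp
  next
    case (lim g s)
    have sp: "space (bind M N) = space B" using sets_eq_imp_space_eq[OF sets_bind] .
    have spN: "space (N x) = space B" if "x \<in> space M" for x
      using sets_eq_imp_space_eq[OF sets_kernel[OF N that]] .
    have mN: "h \<in> borel_measurable (N x)" if "x \<in> space M" "integrable (bind M N) h" for x and h :: "'b \<Rightarrow> 'c"
      using borel_measurable_integrable[OF that(2)] sets_kernel[OF N that(1)]
      by (simp cong: measurable_cong_sets)
    have 1: "(\<lambda>i. \<integral>y. s i y \<partial>bind M N) \<longlonglongrightarrow> (\<integral>y. g y \<partial>bind M N)"
      by (rule integral_dominated_convergence[where w = "\<lambda>y. 2 * norm (g y)"])
        (use lim in \<open>auto intro: borel_measurable_integrable\<close>)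
    have AEg: "AE x in M. integrable (N x) g" by (rule AE_integrable_kernel[OF N lim.hyps(4) ne])
    have 2: "(\<lambda>i. \<integral>x. \<integral>y. s i y \<partial>N x \<partial>M) \<longlonglongrightarrow> (\<integral>x. \<integral>y. g y \<partial>N x \<partial>M)"
    \<comment> \<open>The approximants satisfy \<open>norm (s i y) \<le> 2 * norm (g y)\<close>.
      This dominates the inner integrals, and its average along the kernel dominates the outer
      one.\<close>
    proof (rule integral_dominated_convergence[where w = "\<lambda>x. 2 * (\<integral>y. norm (g y) \<partial>N x)"])
      show "integrable M (\<lambda>x. 2 * (\<integral>y. norm (g y) \<partial>N x))"
        using integrable_integral_norm_kernel[OF N lim.hyps(4) ne] by simp
      show "AE x in M. (\<lambda>i. \<integral>y. s i y \<partial>N x) \<longlonglongrightarrow> (\<integral>y. g y \<partial>N x)"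
        using AEg AE_space
      proof eventually_elim
        case (elim x)
        show ?case
          by (rule integral_dominated_convergence[where w = "\<lambda>y. 2 * norm (g y)"])
            (use elim lim mN sp spN in auto)
      qed
      show "AE x in M. norm (\<integral>y. s i y \<partial>N x) \<le> 2 * (\<integral>y. norm (g y) \<partial>N x)" for i
        using AEg AE_space
      proof eventually_elim
        case (elim x)
        have "norm (\<integral>y. s i y \<partial>N x) \<le> (\<integral>y. 2 * norm (g y) \<partial>N x)"
          by (rule order_trans[OF integral_norm_bound integral_mono'])
            (use elim lim sp spN in auto)
        then show ?case by simp
      qed
    qed (use lim kernel_meas in auto)
    show ?case using LIMSEQ_unique[OF 1] 2 lim by simp
  qed
qed

lemma L2_distr_iff:
  assumes [measurable]: "Y \<in> M \<rightarrow>\<^sub>M borel" "f \<in> borel_measurable borel"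
  shows "(\<lambda>w. f (Y w)) \<in> L2 M \<longleftrightarrow> f \<in> L2 (distr M borel Y)"
  unfolding L2_def by (simp add: integrable_distr_eq)

section \<open>The Markov operator of a stationary kernel\<close>

locale stationary_kernel = prob_space \<pi> for \<pi> :: "'a::polish_space measure" +
  fixes P :: "'a \<Rightarrow> 'a measure"
  assumes kernel: "P \<in> borel \<rightarrow>\<^sub>M prob_algebra borel"
    and sets_pi [measurable_cong, simp]: "sets \<pi> = sets borel"
    and bind_pi: "bind \<pi> P = \<pi>"
begin

lemma space_pi [simp]: "space \<pi> = UNIV"
  using sets_eq_imp_space_eq[OF sets_pi] by simp

lemma kernel_subprob [measurable]: "P \<in> borel \<rightarrow>\<^sub>M subprob_algebra borel"
  using kernel by (rule measurable_prob_algebraD)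

lemma kernel_pi: "P \<in> \<pi> \<rightarrow>\<^sub>M subprob_algebra borel"
  using kernel_subprob measurable_cong_sets[OF sets_pi refl, of "subprob_algebra borel"] by simp

lemma prob_space_P: "prob_space (P x)"
  using measurable_space[OF kernel, of x] by (simp add: space_prob_algebra)

lemma sets_P [measurable_cong, simp]: "sets (P x) = sets borel"
  using measurable_space[OF kernel, of x] by (simp add: space_prob_algebra)

lemma space_P [simp]: "space (P x) = UNIV"
  using sets_eq_imp_space_eq[OF sets_P] by simp

lemma L2_pi_borel: "f \<in> L2 \<pi> \<Longrightarrow> f \<in> borel_measurable borel"
  using L2_measurable[of f \<pi>] by (simp add: measurable_cong_sets[OF sets_pi refl])

lemma nn_integral_kernel:
  "h \<in> borel_measurable borel \<Longrightarrow> (\<integral>\<^sup>+x. \<integral>\<^sup>+y. h y \<partial>P x \<partial>\<pi>) = (\<integral>\<^sup>+x. h x \<partial>\<pi>)"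
  by (subst nn_integral_bind[OF _ kernel_pi, symmetric]) (simp_all add: bind_pi)

lemma AE_integrable_P: "f \<in> L2 \<pi> \<Longrightarrow> AE x in \<pi>. integrable (P x) f"
  by (rule AE_integrable_kernel[OF kernel_pi]) (simp_all add: bind_pi L2_integrable)

lemma markov_op_measurable: "f \<in> borel_measurable borel \<Longrightarrow> markov_op P f \<in> borel_measurable borel"
  unfolding markov_op_def by (rule measurable_compose[OF kernel_subprob integral_measurable_subprob_algebra])

text \<open>Jensen's inequality for \<open>P x\<close>. With values in \<open>ennreal\<close> it is
  trivial where the right hand side is infinite, so it holds at every \<open>x\<close> and can be
  integrated over \<open>\<pi>\<close>.\<close>

lemma cmod_markov_op_le:
  assumes f: "f \<in> borel_measurable borel"
  shows "ennreal ((cmod (markov_op P f x))\<^sup>2) \<le> (\<integral>\<^sup>+y. ennreal ((cmod (f y))\<^sup>2) \<partial>P x)"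
proof (cases "(\<integral>\<^sup>+y. ennreal ((cmod (f y))\<^sup>2) \<partial>P x) < \<infinity>")
  case True
  interpret Px: prob_space "P x" by (rule prob_space_P)
  have [measurable]: "f \<in> borel_measurable (P x)" using f by simp
  have fL: "f \<in> L2 (P x)"
    using True by (auto simp: L2_def intro!: integrableI_bounded)
  have "(cmod (markov_op P f x))\<^sup>2 \<le> (L2_norm (P x) f)\<^sup>2"
    unfolding markov_op_def by (intro power_mono Px.norm_integral_le_L2_norm fL) auto
  also have "\<dots> = (\<integral>y. (cmod (f y))\<^sup>2 \<partial>P x)" by (simp add: L2_norm_def)
  finally show ?thesis
    by (subst nn_integral_eq_integral[OF L2_integrable_square[OF fL]]) (auto intro: ennreal_leI)
qed (simp add: less_top[symmetric])

lemma
  assumes f: "f \<in> L2 \<pi>"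
  shows markov_op_L2: "markov_op P f \<in> L2 \<pi>"
    and L2_norm_markov_op_le: "L2_norm \<pi> (markov_op P f) \<le> L2_norm \<pi> f"
proof -
  note [measurable] = L2_pi_borel[OF f]
  note [measurable] = markov_op_measurable[OF L2_pi_borel[OF f]]
  have "(\<integral>\<^sup>+x. ennreal ((cmod (markov_op P f x))\<^sup>2) \<partial>\<pi>) \<le> (\<integral>\<^sup>+x. \<integral>\<^sup>+y. ennreal ((cmod (f y))\<^sup>2) \<partial>P x \<partial>\<pi>)"
    by (intro nn_integral_mono cmod_markov_op_le) simp
  also have "\<dots> = (\<integral>\<^sup>+x. ennreal ((cmod (f x))\<^sup>2) \<partial>\<pi>)"
    by (rule nn_integral_kernel) simp
  also have "\<dots> = ennreal (\<integral>x. (cmod (f x))\<^sup>2 \<partial>\<pi>)"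
    by (rule nn_integral_eq_integral[OF L2_integrable_square[OF f]]) simp
  finally have le: "(\<integral>\<^sup>+x. ennreal ((cmod (markov_op P f x))\<^sup>2) \<partial>\<pi>) \<le> ennreal (\<integral>x. (cmod (f x))\<^sup>2 \<partial>\<pi>)" .
  have "integrable \<pi> (\<lambda>x. (cmod (markov_op P f x))\<^sup>2)"
    using le_less_trans[OF le ennreal_less_top] by (intro integrableI_bounded) auto
  then show L: "markov_op P f \<in> L2 \<pi>" by (simp add: L2_def)
  have "ennreal (\<integral>x. (cmod (markov_op P f x))\<^sup>2 \<partial>\<pi>) \<le> ennreal (\<integral>x. (cmod (f x))\<^sup>2 \<partial>\<pi>)"
    using le by (subst (asm) nn_integral_eq_integral[OF L2_integrable_square[OF L]]) simp_all
  then have "(\<integral>x. (cmod (markov_op P f x))\<^sup>2 \<partial>\<pi>) \<le> (\<integral>x. (cmod (f x))\<^sup>2 \<partial>\<pi>)"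
    by (subst (asm) ennreal_le_iff) auto
  then show "L2_norm \<pi> (markov_op P f) \<le> L2_norm \<pi> f" by (simp add: L2_norm_def)
qed

lemma integral_markov_op: "f \<in> L2 \<pi> \<Longrightarrow> (\<integral>x. markov_op P f x \<partial>\<pi>) = (\<integral>x. f x \<partial>\<pi>)"
  unfolding markov_op_def
  by (subst integral_bind_kernel[OF kernel_pi, symmetric]) (simp_all add: bind_pi L2_integrable)

lemma markov_op_add:
  assumes "f \<in> L2 \<pi>" "g \<in> L2 \<pi>"
  shows "AE x in \<pi>. markov_op P (\<lambda>y. f y + g y) x = markov_op P f x + markov_op P g x"
  using AE_integrable_P[OF assms(1)] AE_integrable_P[OF assms(2)]
  by eventually_elim (simp add: markov_op_def)

lemma markov_op_diff:
  assumes "f \<in> L2 \<pi>" "g \<in> L2 \<pi>"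
  shows "AE x in \<pi>. markov_op P (\<lambda>y. f y - g y) x = markov_op P f x - markov_op P g x"
  using AE_integrable_P[OF assms(1)] AE_integrable_P[OF assms(2)]
  by eventually_elim (simp add: markov_op_def)

lemma markov_op_scale: "markov_op P (\<lambda>y. c * f y) x = c * markov_op P f x"
  by (simp add: markov_op_def)

lemma markov_op_const: "markov_op P (\<lambda>_. c) = (\<lambda>_. c)"
  using prob_space.prob_space[OF prob_space_P] by (simp add: markov_op_def)

text \<open>The joint law of \<open>a s\<close> and a point drawn from \<open>P (b s)\<close>. For
  \<open>N = \<pi>\<close> and identity maps it is the measure occurring in
  \<open>reversible\<close>; for \<open>a = X i\<close>, \<open>b = X j\<close> with
  \<open>i \<le> j\<close> it is the law of \<open>(X i, X (Suc j))\<close>. One integration formula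
  thus serves both self-adjointness and covariances.\<close>

definition step_law :: "'s measure \<Rightarrow> ('s \<Rightarrow> 'a) \<Rightarrow> ('s \<Rightarrow> 'a) \<Rightarrow> ('a \<times> 'a) measure" where
  "step_law N a b = bind N (\<lambda>s. bind (P (b s)) (\<lambda>z. return (borel \<Otimes>\<^sub>M borel) (a s, z)))"

context
  fixes N :: "'s measure" and a b :: "'s \<Rightarrow> 'a"
  assumes N: "prob_space N" and a [measurable]: "a \<in> N \<rightarrow>\<^sub>M borel" and b [measurable]: "b \<in> N \<rightarrow>\<^sub>M borel"
begin

lemma step_kernel_eq:
  "s \<in> space N \<Longrightarrow> bind (P (b s)) (\<lambda>z. return (borel \<Otimes>\<^sub>M borel) (a s, z))
    = distr (P (b s)) (borel \<Otimes>\<^sub>M borel) (\<lambda>z. (a s, z))"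
  by (rule bind_return_distr') (simp_all add: prob_space.not_empty[OF prob_space_P])

lemma step_kernel_measurable:
  "(\<lambda>s. bind (P (b s)) (\<lambda>z. return (borel \<Otimes>\<^sub>M borel) (a s, z)))
    \<in> N \<rightarrow>\<^sub>M subprob_algebra (borel \<Otimes>\<^sub>M borel)"
  by measurable

lemma sets_step_law [simp]: "sets (step_law N a b) = sets (borel \<Otimes>\<^sub>M borel)"
  unfolding step_law_def
  by (rule sets_bind[OF sets_kernel[OF step_kernel_measurable] prob_space.not_empty[OF N]])

lemma nn_integral_step_law:
  assumes [measurable]: "h \<in> borel_measurable (borel \<Otimes>\<^sub>M borel)"
  shows "(\<integral>\<^sup>+p. h p \<partial>step_law N a b) = (\<integral>\<^sup>+s. \<integral>\<^sup>+z. h (a s, z) \<partial>P (b s) \<partial>N)"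
proof -
  have "(\<integral>\<^sup>+p. h p \<partial>step_law N a b)
      = (\<integral>\<^sup>+s. \<integral>\<^sup>+p. h p \<partial>(bind (P (b s)) (\<lambda>z. return (borel \<Otimes>\<^sub>M borel) (a s, z))) \<partial>N)"
    unfolding step_law_def by (rule nn_integral_bind[OF _ step_kernel_measurable]) simp
  also have "\<dots> = (\<integral>\<^sup>+s. \<integral>\<^sup>+z. h (a s, z) \<partial>P (b s) \<partial>N)"
    by (rule nn_integral_cong) (simp add: step_kernel_eq nn_integral_distr)
  finally show ?thesis .
qed

lemma integral_step_law:
  fixes h :: "'a \<times> 'a \<Rightarrow> complex"
  assumes h: "integrable (step_law N a b) h"
  shows "(\<integral>p. h p \<partial>step_law N a b) = (\<integral>s. \<integral>z. h (a s, z) \<partial>P (b s) \<partial>N)"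
proof -
  have [measurable]: "h \<in> borel_measurable (borel \<Otimes>\<^sub>M borel)"
    using borel_measurable_integrable[OF h] by (simp add: measurable_cong_sets[OF sets_step_law refl])
  have "(\<integral>p. h p \<partial>step_law N a b)
      = (\<integral>s. \<integral>p. h p \<partial>(bind (P (b s)) (\<lambda>z. return (borel \<Otimes>\<^sub>M borel) (a s, z))) \<partial>N)"
    using h unfolding step_law_def
    by (rule integral_bind_kernel[OF step_kernel_measurable _ prob_space.not_empty[OF N]])
  also have "\<dots> = (\<integral>s. \<integral>z. h (a s, z) \<partial>P (b s) \<partial>N)"
    by (rule Bochner_Integration.integral_cong[OF refl]) (simp add: step_kernel_eq integral_distr)
  finally show ?thesis .
qed

text \<open>Both coordinates have law \<open>\<pi>\<close>, the second one by stationarity of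
  \<open>\<pi>\<close>. Hence the product of two L2 functions is integrable and the iterated
  integral applies.\<close>

lemma integral_step_law_mult:
  assumes da: "distr N borel a = \<pi>" and db: "distr N borel b = \<pi>"
    and f: "f \<in> L2 \<pi>" and g: "g \<in> L2 \<pi>"
  shows "(\<integral>p. f (fst p) * cnj (g (snd p)) \<partial>step_law N a b)
      = (\<integral>s. f (a s) * cnj (markov_op P g (b s)) \<partial>N)"
proof -
  interpret Nn: prob_space N by (rule N)
  note [measurable] = L2_pi_borel[OF f] L2_pi_borel[OF g]
  have L: "(\<lambda>p. f (fst p)) \<in> L2 (step_law N a b)" "(\<lambda>p. g (snd p)) \<in> L2 (step_law N a b)"
  proof -
    have "(\<integral>\<^sup>+p. ennreal ((cmod (f (fst p)))\<^sup>2) \<partial>step_law N a b)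
        = (\<integral>\<^sup>+s. \<integral>\<^sup>+z. ennreal ((cmod (f (a s)))\<^sup>2) \<partial>P (b s) \<partial>N)"
      by (subst nn_integral_step_law) simp_all
    also have "\<dots> = (\<integral>\<^sup>+s. ennreal ((cmod (f (a s)))\<^sup>2) \<partial>N)"
      using prob_space.emeasure_space_1[OF prob_space_P] by simp
    also have "\<dots> = (\<integral>\<^sup>+x. ennreal ((cmod (f x))\<^sup>2) \<partial>distr N borel a)"
      by (rule nn_integral_distr[symmetric]) simp_all
    also have "\<dots> < \<infinity>"
      unfolding da using nn_integral_eq_integral[OF L2_integrable_square[OF f]] by simp
    finally have "integrable (step_law N a b) (\<lambda>p. (cmod (f (fst p)))\<^sup>2)"
      by (intro integrableI_bounded) (simp_all cong: measurable_cong_sets)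
    then show "(\<lambda>p. f (fst p)) \<in> L2 (step_law N a b)"
      by (simp add: L2_def cong: measurable_cong_sets)
    have "(\<integral>\<^sup>+p. ennreal ((cmod (g (snd p)))\<^sup>2) \<partial>step_law N a b)
        = (\<integral>\<^sup>+s. \<integral>\<^sup>+z. ennreal ((cmod (g z))\<^sup>2) \<partial>P (b s) \<partial>N)"
      by (subst nn_integral_step_law) simp_all
    also have "\<dots> = (\<integral>\<^sup>+x. \<integral>\<^sup>+z. ennreal ((cmod (g z))\<^sup>2) \<partial>P x \<partial>distr N borel b)"
      by (rule nn_integral_distr[symmetric, OF b])
        (auto intro!: measurable_compose[OF kernel_subprob nn_integral_measurable_subprob_algebra])
    also have "\<dots> = (\<integral>\<^sup>+x. ennreal ((cmod (g x))\<^sup>2) \<partial>\<pi>)"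
      unfolding db by (rule nn_integral_kernel) simp
    also have "\<dots> < \<infinity>"
      using nn_integral_eq_integral[OF L2_integrable_square[OF g]] by simp
    finally have "integrable (step_law N a b) (\<lambda>p. (cmod (g (snd p)))\<^sup>2)"
      by (intro integrableI_bounded) (simp_all cong: measurable_cong_sets)
    then show "(\<lambda>p. g (snd p)) \<in> L2 (step_law N a b)"
      by (simp add: L2_def cong: measurable_cong_sets)
  qed
  have int: "integrable (step_law N a b) (\<lambda>p. f (fst p) * cnj (g (snd p)))"
    by (rule L2_integrable_mult[OF L])
  show "(\<integral>p. f (fst p) * cnj (g (snd p)) \<partial>step_law N a b)
      = (\<integral>s. f (a s) * cnj (markov_op P g (b s)) \<partial>N)"
    unfolding integral_step_law[OF int] by (simp add: markov_op_def)
qed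

end

end

locale reversible_kernel = stationary_kernel +
  assumes rev: "reversible P \<pi>"
begin

text \<open>Reversibility says that the law of one step started from \<open>\<pi>\<close> is
  invariant under swapping the coordinates; both inner products are integrals against this
  law.\<close>

lemma markov_op_adjoint:
  assumes f: "f \<in> L2 \<pi>" and g: "g \<in> L2 \<pi>"
  shows "L2_inner \<pi> (markov_op P f) g = L2_inner \<pi> f (markov_op P g)"
proof -
  let ?id = "\<lambda>x::'a. x"
  let ?swap = "\<lambda>p::'a \<times> 'a. (snd p, fst p)"
  have id: "?id \<in> \<pi> \<rightarrow>\<^sub>M borel" by simp
  have distr_id: "distr \<pi> borel ?id = \<pi>" by (rule distr_id2) simp
  note [measurable] = L2_pi_borel[OF f] L2_pi_borel[OF g]
  have swap: "distr (step_law \<pi> ?id ?id) (borel \<Otimes>\<^sub>M borel) ?swap = step_law \<pi> ?id ?id"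
  proof -
    have "distr (step_law \<pi> ?id ?id) (borel \<Otimes>\<^sub>M borel) ?swap
        = bind \<pi> (\<lambda>y. distr (bind (P y) (\<lambda>z. return (borel \<Otimes>\<^sub>M borel) (y, z))) (borel \<Otimes>\<^sub>M borel) ?swap)"
      unfolding step_law_def
      by (rule distr_bind[OF step_kernel_measurable[OF prob_space_axioms id id] not_empty]) simp
    also have "\<dots> = bind \<pi> (\<lambda>y. bind (P y) (\<lambda>x. return (borel \<Otimes>\<^sub>M borel) (x, y)))"
    proof (rule bind_cong[OF refl])
      fix y :: 'a
      have "distr (bind (P y) (\<lambda>z. return (borel \<Otimes>\<^sub>M borel) (y, z))) (borel \<Otimes>\<^sub>M borel) ?swap
          = distr (P y) (borel \<Otimes>\<^sub>M borel) (\<lambda>z. (z, y))"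
        using step_kernel_eq[OF prob_space_axioms id id, of y] by (simp add: distr_distr comp_def)
      also have "\<dots> = bind (P y) (\<lambda>x. return (borel \<Otimes>\<^sub>M borel) (x, y))"
        by (rule bind_return_distr'[symmetric]) (simp_all add: prob_space.not_empty[OF prob_space_P])
      finally show "distr (bind (P y) (\<lambda>z. return (borel \<Otimes>\<^sub>M borel) (y, z))) (borel \<Otimes>\<^sub>M borel) ?swap
          = bind (P y) (\<lambda>x. return (borel \<Otimes>\<^sub>M borel) (x, y))" .
    qed
    also have "\<dots> = step_law \<pi> ?id ?id"
      using rev by (simp add: reversible_def step_law_def)
    finally show ?thesis .
  qed
  have sets: "sets (step_law \<pi> ?id ?id) = sets (borel \<Otimes>\<^sub>M borel)"
    by (rule sets_step_law[OF prob_space_axioms id id])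
  note mult = integral_step_law_mult[OF prob_space_axioms id id distr_id distr_id]
  have "L2_inner \<pi> f (markov_op P g) = (\<integral>p. f (fst p) * cnj (g (snd p)) \<partial>step_law \<pi> ?id ?id)"
    by (simp add: mult[OF f g] L2_inner_def)
  also have "\<dots> = (\<integral>p. f (fst p) * cnj (g (snd p)) \<partial>distr (step_law \<pi> ?id ?id) (borel \<Otimes>\<^sub>M borel) ?swap)"
    by (simp add: swap)
  also have "\<dots> = (\<integral>p. f (snd p) * cnj (g (fst p)) \<partial>step_law \<pi> ?id ?id)"
    by (subst integral_distr) (simp_all cong: measurable_cong_sets add: sets)
  also have "\<dots> = cnj (\<integral>p. g (fst p) * cnj (f (snd p)) \<partial>step_law \<pi> ?id ?id)"
    by (subst Bochner_Integration.integral_cnj[symmetric]) (simp add: mult.commute)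
  also have "\<dots> = cnj (L2_inner \<pi> g (markov_op P f))"
    by (simp add: mult[OF g f] L2_inner_def)
  also have "\<dots> = L2_inner \<pi> (markov_op P f) g" by (rule L2_inner_cnj[symmetric])
  finally show ?thesis ..
qed

end

section \<open>Spectrum and quadratic form\<close>

text \<open>An arbitrary choice of preimages is automatically linear up to null functions, since
  \<open>lower\<close> makes \<open>T\<close> injective in that sense; \<open>lower\<close> also
  bounds the choice.\<close>

lemma L2_is_inverse_exists:
  assumes T: "\<And>f. f \<in> L2 M \<Longrightarrow> T f \<in> L2 M"
    and add: "\<And>f g. f \<in> L2 M \<Longrightarrow> g \<in> L2 M \<Longrightarrow> AE x in M. T (\<lambda>y. f y + g y) x = T f x + T g x"
    and scale: "\<And>c f. f \<in> L2 M \<Longrightarrow> AE x in M. T (\<lambda>y. c * f y) x = c * T f x"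
    and lower: "\<And>f. f \<in> L2 M \<Longrightarrow> L2_norm M f \<le> C * L2_norm M (T f)"
    and surj: "\<And>g. g \<in> L2 M \<Longrightarrow> \<exists>u\<in>L2 M. AE x in M. T u x = g x"
  shows "\<exists>S. L2_is_inverse M T S"
proof -
  have inj: "AE x in M. u x = v x" if u: "u \<in> L2 M" and v: "v \<in> L2 M" and eq: "AE x in M. T u x = T v x" for u v
  proof -
    have v': "(\<lambda>y. - 1 * v y) \<in> L2 M" using L2_scale[OF v] .
    have uv: "(\<lambda>y. u y + - 1 * v y) \<in> L2 M" using L2_add[OF u v'] .
    have "AE x in M. T (\<lambda>y. u y + - 1 * v y) x = 0"
      using add[OF u v'] scale[OF v, of "-1"] eq by eventually_elim simp
    then have "L2_norm M (T (\<lambda>y. u y + - 1 * v y)) = 0"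
      using L2_norm_0_iff[OF T[OF uv]] by simp
    then have "L2_norm M (\<lambda>y. u y + - 1 * v y) \<le> 0" using lower[OF uv] by simp
    then have "L2_norm M (\<lambda>y. u y + - 1 * v y) = 0" using L2_norm_nonneg by (rule antisym)
    then show ?thesis using L2_norm_0_iff[OF uv] by simp
  qed
  define S where "S g = (SOME u. u \<in> L2 M \<and> (AE x in M. T u x = g x))" for g
  have S: "S g \<in> L2 M" "AE x in M. T (S g) x = g x" if "g \<in> L2 M" for g
  proof -
    have "\<exists>u. u \<in> L2 M \<and> (AE x in M. T u x = g x)" using surj[OF that] by blast
    from someI_ex[OF this] show "S g \<in> L2 M" "AE x in M. T (S g) x = g x" by (simp_all add: S_def)
  qed
  have "L2_is_inverse M T S"
    unfolding L2_is_inverse_def L2_bounded_operator_def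
  proof (intro conjI ballI allI)
    fix f g :: "'a \<Rightarrow> complex" assume f: "f \<in> L2 M"
    show "S f \<in> L2 M" by (rule S[OF f])
    show "AE x in M. T (S f) x = f x" by (rule S[OF f])
    show "AE x in M. S (T f) x = f x" by (rule inj[OF S(1)[OF T[OF f]] f S(2)[OF T[OF f]]])
    show "AE x in M. S (\<lambda>y. c * f y) x = c * S f x" for c
    proof (rule inj[OF S(1) L2_scale[OF S(1)]])
      show "AE x in M. T (S (\<lambda>y. c * f y)) x = T (\<lambda>x. c * S f x) x"
        using S(2)[OF L2_scale[OF f], of c] S(2)[OF f] scale[OF S(1)[OF f], of c]
        by eventually_elim simp
    qed (use f L2_scale in auto)
    show "AE x in M. S (\<lambda>y. f y + g y) x = S f x + S g x" if g: "g \<in> L2 M"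
    proof (rule inj[OF S(1) L2_add[OF S(1) S(1)]])
      show "AE x in M. T (S (\<lambda>y. f y + g y)) x = T (\<lambda>x. S f x + S g x) x"
        using S(2)[OF L2_add[OF f g]] S(2)[OF f] S(2)[OF g] add[OF S(1)[OF f] S(1)[OF g]]
        by eventually_elim simp
    qed (use f g L2_add in auto)
  next
    have "L2_norm M (S f) \<le> C * L2_norm M f" if f: "f \<in> L2 M" for f
    proof -
      have "L2_norm M (T (S f)) = L2_norm M f"
        using S[OF f] T f by (intro L2_norm_cong_AE L2_measurable) auto
      then show ?thesis using lower[OF S(1)[OF f]] by simp
    qed
    then show "\<exists>C. \<forall>f\<in>L2 M. L2_norm M (S f) \<le> C * L2_norm M f" by blast
  qed
  then show ?thesis by blast
qed

lemma L2_is_inverse_bounded_below: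
  assumes inv: "L2_is_inverse M T S" and T: "\<And>f. f \<in> L2 M \<Longrightarrow> T f \<in> L2 M"
  obtains d where "d > 0" "\<And>f. f \<in> L2 M \<Longrightarrow> d * L2_norm M f \<le> L2_norm M (T f)"
proof -
  obtain C where C: "\<And>f. f \<in> L2 M \<Longrightarrow> L2_norm M (S f) \<le> C * L2_norm M f"
    using inv unfolding L2_is_inverse_def L2_bounded_operator_def by blast
  have "L2_norm M f \<le> max C 1 * L2_norm M (T f)" if f: "f \<in> L2 M" for f
  proof -
    have "L2_norm M f = L2_norm M (S (T f))"
      using inv f T by (intro L2_norm_cong_AE L2_measurable)
        (auto simp: L2_is_inverse_def L2_bounded_operator_def)
    also have "\<dots> \<le> C * L2_norm M (T f)" by (rule C[OF T[OF f]])
    also have "\<dots> \<le> max C 1 * L2_norm M (T f)"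
      by (rule mult_right_mono) (auto simp: L2_norm_def)
    finally show ?thesis .
  qed
  then have "1 / max C 1 * L2_norm M f \<le> L2_norm M (T f)" if "f \<in> L2 M" for f
    using that by (simp add: field_simps)
  with that[of "1 / max C 1"] show ?thesis by simp
qed

sublocale stationary_kernel \<subseteq> L: semi_hilbert_space "L2 \<pi>" "L2_re_inner \<pi>"
  by (rule semi_hilbert_space_L2)

context stationary_kernel
begin

lemma prob_UNIV [simp]: "prob UNIV = 1"
  using prob_space by simp

lemma nrm_eq: "L.nrm f = L2_norm \<pi> f"
  by (simp add: L.nrm_def L2_norm_eq)

lemma markov_op_resolvent_L2: "f \<in> L2 \<pi> \<Longrightarrow> (\<lambda>x. z * f x - markov_op P f x) \<in> L2 \<pi>"
  by (intro L2_diff L2_scale markov_op_L2)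

lemma resolvent_bounded_below:
  assumes "z \<notin> L2_spectrum \<pi> (markov_op P)"
  shows "\<exists>d>0. \<forall>f\<in>L2 \<pi>. d * L2_norm \<pi> f \<le> L2_norm \<pi> (\<lambda>x. z * f x - markov_op P f x)"
proof -
  obtain S where "L2_is_inverse \<pi> (\<lambda>f x. z * f x - markov_op P f x) S"
    using assms by (auto simp: L2_spectrum_def)
  then show ?thesis
    by (rule L2_is_inverse_bounded_below) (auto intro: markov_op_resolvent_L2)
qed

text \<open>The Neumann series in fixed point form: \<open>z u - P u = g\<close> means
  \<open>u = (g + P u) / z\<close>, and the right hand side contracts with factor
  \<open>1 / cmod z\<close>. The triangle inequality gives the lower bound.\<close>

lemma spectrum_cmod_le:
  assumes "z \<in> L2_spectrum \<pi> (markov_op P)"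
  shows "cmod z \<le> 1"
proof (rule ccontr)
  assume "\<not> cmod z \<le> 1"
  then have z: "cmod z > 1" by simp
  have "\<exists>S. L2_is_inverse \<pi> (\<lambda>f x. z * f x - markov_op P f x) S"
  proof (rule L2_is_inverse_exists)
    fix f g :: "'a \<Rightarrow> complex" assume f: "f \<in> L2 \<pi>"
    show "(\<lambda>x. z * f x - markov_op P f x) \<in> L2 \<pi>" using f by (rule markov_op_resolvent_L2)
    show "AE x in \<pi>. z * (f x + g x) - markov_op P (\<lambda>y. f y + g y) x
        = z * f x - markov_op P f x + (z * g x - markov_op P g x)" if g: "g \<in> L2 \<pi>"
      using markov_op_add[OF f g] by eventually_elim (simp add: algebra_simps)
    show "AE x in \<pi>. z * (c * f x) - markov_op P (\<lambda>y. c * f y) x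
        = c * (z * f x - markov_op P f x)" for c
      by (simp add: markov_op_scale algebra_simps)
    show "L2_norm \<pi> f \<le> 1 / (cmod z - 1) * L2_norm \<pi> (\<lambda>x. z * f x - markov_op P f x)"
    proof -
      have "L.nrm ((\<lambda>x. z * f x - markov_op P f x) + markov_op P f)
          \<le> L.nrm (\<lambda>x. z * f x - markov_op P f x) + L.nrm (markov_op P f)"
        using f by (intro L.nrm_triangle markov_op_resolvent_L2 markov_op_L2)
      then have "cmod z * L2_norm \<pi> f \<le> L2_norm \<pi> (\<lambda>x. z * f x - markov_op P f x) + L2_norm \<pi> f"
        using L2_norm_markov_op_le[OF f] by (simp add: nrm_eq plus_fun_def L2_norm_scale)
      then show ?thesis using z by (simp add: field_simps)
    qed
  next
    fix g :: "'a \<Rightarrow> complex" assume g: "g \<in> L2 \<pi>"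
    define F where "F u = (\<lambda>x. 1 / z * (g x + markov_op P u x))" for u
    have FL: "F u \<in> L2 \<pi>" if "u \<in> L2 \<pi>" for u
      unfolding F_def using that g by (intro L2_scale L2_add markov_op_L2)
    have contr: "L.nrm (F u - F v) \<le> 1 / cmod z * L.nrm (u - v)" if u: "u \<in> L2 \<pi>" and v: "v \<in> L2 \<pi>" for u v
    proof -
      have "L2_norm \<pi> (F u - F v) = L2_norm \<pi> (\<lambda>x. 1 / z * markov_op P (\<lambda>y. u y - v y) x)"
      proof (rule L2_norm_cong_AE)
        show "F u - F v \<in> borel_measurable \<pi>" using FL u v by (intro L2_measurable) auto
        show "(\<lambda>x. 1 / z * markov_op P (\<lambda>y. u y - v y) x) \<in> borel_measurable \<pi>"
          using u v by (intro L2_measurable L2_scale markov_op_L2 L2_diff)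
        show "AE x in \<pi>. (F u - F v) x = 1 / z * markov_op P (\<lambda>y. u y - v y) x"
          using markov_op_diff[OF u v] by eventually_elim (simp add: F_def add_divide_distrib diff_divide_distrib)
      qed
      also have "\<dots> = 1 / cmod z * L2_norm \<pi> (markov_op P (\<lambda>y. u y - v y))"
        by (subst L2_norm_scale) (simp add: norm_divide)
      also have "\<dots> \<le> 1 / cmod z * L2_norm \<pi> (\<lambda>y. u y - v y)"
        using u v z by (intro mult_left_mono L2_norm_markov_op_le L2_diff) auto
      finally show ?thesis by (simp add: nrm_eq fun_diff_def)
    qed
    have "0 \<le> 1 / cmod z" "1 / cmod z < 1" using z by (auto simp: divide_less_eq)
    then obtain u where u: "u \<in> L2 \<pi>" "L.nrm (F u - u) = 0"
      using L.contraction_fixed_point[OF FL _ _ contr] by blast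
    have "AE x in \<pi>. (F u - u) x = 0"
      using u FL L2_norm_0_iff[of "F u - u" \<pi>] by (auto simp: nrm_eq)
    then have "AE x in \<pi>. z * u x - markov_op P u x = g x"
    proof eventually_elim
      case (elim x)
      then have "u x = 1 / z * (g x + markov_op P u x)" by (simp add: F_def)
      moreover have "z \<noteq> 0" using z by auto
      ultimately show ?case by (simp add: field_simps)
    qed
    with u show "\<exists>u\<in>L2 \<pi>. AE x in \<pi>. z * u x - markov_op P u x = g x" by blast
  qed
  with assms show False by (simp add: L2_spectrum_def)
qed

end

sublocale reversible_kernel \<subseteq> Z: contraction_operator "L2_mean_zero \<pi>" "L2_re_inner \<pi>" "markov_op P"
proof -
  interpret Z: semi_hilbert_space "L2_mean_zero \<pi>" "L2_re_inner \<pi>"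
    by (rule semi_hilbert_space_L2_mean_zero)
  show "contraction_operator (L2_mean_zero \<pi>) (L2_re_inner \<pi>) (markov_op P)"
  proof
    show "Z.symmetric_op (markov_op P)"
      unfolding Z.symmetric_op_def
      using markov_op_L2 integral_markov_op markov_op_adjoint
      by (auto simp: L2_mean_zero_def L2_re_inner_def)
    show "Z.nrm (markov_op P f) \<le> Z.nrm f" if "f \<in> L2_mean_zero \<pi>" for f
      using that L2_norm_markov_op_le by (simp add: nrm_eq L2_mean_zero_def)
  qed
qed

section \<open>From spectral gaps to bounds on the form and the norm\<close>

context reversible_kernel
begin

lemma mean_zero_L2: "f \<in> L2_mean_zero \<pi> \<Longrightarrow> f \<in> L2 \<pi>"
  by (simp add: L2_mean_zero_def)

lemma lap_fun: "Z.lap f = (\<lambda>x. f x - markov_op P f x)"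
  by (simp add: Z.lap_def fun_diff_def)

lemma nrm_null_iff:
  "f \<in> L2_mean_zero \<pi> \<Longrightarrow> h \<in> L2_mean_zero \<pi> \<Longrightarrow> L.nrm (f - h) = 0 \<longleftrightarrow> (AE x in \<pi>. f x = h x)"
  using L2_norm_0_iff[of "f - h" \<pi>] L.H_closed(4)[of f h] by (simp add: nrm_eq mean_zero_L2)

text \<open>Constants are eigenfunctions for 1, so a simple eigenvalue leaves only constants, and a
  constant of mean zero vanishes.\<close>

lemma mult_one_kernel:
  assumes mult: "L2_eigenvalue_mult_one \<pi> (markov_op P) 1"
    and f: "f \<in> L2_mean_zero \<pi>" and Bf: "L.nrm (Z.lap f) = 0"
  shows "L.nrm f = 0"
proof -
  obtain e where e: "\<And>h. h \<in> L2_eigenspace \<pi> (markov_op P) 1 \<Longrightarrow> \<exists>c. AE x in \<pi>. h x = c * e x"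
    using mult by (auto simp: L2_eigenvalue_mult_one_def)
  have "(\<lambda>_. 1) \<in> L2_eigenspace \<pi> (markov_op P) 1"
    by (simp add: L2_eigenspace_def L2_const markov_op_const)
  then obtain c1 where c1: "AE x in \<pi>. 1 = c1 * e x" using e by blast
  have "AE x in \<pi>. f x = markov_op P f x"
    using nrm_null_iff[OF f Z.A_closed[OF f]] Bf by (simp add: Z.lap_def)
  then have "f \<in> L2_eigenspace \<pi> (markov_op P) 1"
    using f by (auto simp: L2_eigenspace_def mean_zero_L2)
  then obtain c2 where c2: "AE x in \<pi>. f x = c2 * e x" using e by blast
  have const: "AE x in \<pi>. f x = c2 / c1"
    using c1 c2 by eventually_elim (metis mult_cancel_left1 mult_eq_0_iff nonzero_mult_div_cancel_left times_divide_eq_left mult.commute zero_neq_one)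
  have "(\<integral>x. f x \<partial>\<pi>) = (\<integral>x. c2 / c1 \<partial>\<pi>)"
    using const L2_measurable[OF mean_zero_L2[OF f]] by (intro integral_cong_AE) auto
  then have "c2 / c1 = 0" using f by (simp add: L2_mean_zero_def prob_space)
  with const have "AE x in \<pi>. f x = 0" by (simp only:)
  then show ?thesis using L2_norm_0_iff[OF mean_zero_L2[OF f]] by (simp add: nrm_eq)
qed

lemma spectral_gap_mult_one: "spectral_gap \<pi> P > 0 \<Longrightarrow> L2_eigenvalue_mult_one \<pi> (markov_op P) 1"
  by (auto simp: spectral_gap_def split: if_splits)

lemma resolvent_mean_zero:
  assumes "complex_of_real l \<notin> L2_spectrum \<pi> (markov_op P)"
  shows "\<exists>d>0. \<forall>f\<in>L2_mean_zero \<pi>. d * L.nrm f \<le> L.nrm (l *\<^sub>R f - markov_op P f)"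
  using resolvent_bounded_below[OF assms] mean_zero_L2
  by (auto simp: nrm_eq scaleR_fun_def fun_diff_def scaleR_conv_of_real)

text \<open>A spectral value \<open>l\<close> in (1 - g, 1) would force the gap down to
  \<open>1 - l < g\<close>. A real \<open>g\<close> below the gap is used because the gap itself may
  be infinite.\<close>

lemma gap_form:
  assumes gap: "spectral_gap \<pi> P > 0" and g: "g > 0" "ereal g \<le> spectral_gap \<pi> P"
    and f: "f \<in> L2_mean_zero \<pi>"
  shows "g * L2_re_inner \<pi> f f \<le> L2_re_inner \<pi> (Z.lap f) f"
proof (rule Z.lap_bounded_below[OF g(1) _ mult_one_kernel[OF spectral_gap_mult_one[OF gap]] f])
  fix l :: real assume l: "1 - g < l" "l < 1"
  have "complex_of_real l \<notin> L2_spectrum \<pi> (markov_op P)"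
  proof
    assume "complex_of_real l \<in> L2_spectrum \<pi> (markov_op P)"
    then have "ereal l \<le> (SUP z \<in> {z \<in> L2_spectrum \<pi> (markov_op P). z \<noteq> 1}. ereal (Re z))"
      using l by (intro SUP_upper2[of "complex_of_real l"]) auto
    then have "spectral_gap \<pi> P \<le> 1 - ereal l"
      using spectral_gap_mult_one[OF gap] by (simp add: spectral_gap_def ereal_minus_mono)
    with g have "ereal g \<le> 1 - ereal l" by (rule_tac order_trans)
    then show False using l by (simp add: one_ereal_def)
  qed
  then show "\<exists>d>0. \<forall>f\<in>L2_mean_zero \<pi>. d * L.nrm f \<le> L.nrm (l *\<^sub>R f - markov_op P f)"
    by (rule resolvent_mean_zero)
qed

lemma absolute_gap_norm:
  assumes gap: "spectral_gap \<pi> P > 0" and g: "g \<le> 1" "ereal g \<le> absolute_spectral_gap \<pi> P"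
    and f: "f \<in> L2_mean_zero \<pi>"
  shows "L.nrm (markov_op P f) \<le> (1 - g) * L.nrm f"
proof -
  \<comment> \<open>This constant enters only through the exclusion of \<open>l = 1\<close> in
    \<open>nrm_A_le\<close>, so its size does not affect the bound.\<close>
  obtain g0 where g0: "g0 > 0" "ereal g0 \<le> spectral_gap \<pi> P"
    using ereal_dense2[OF gap] by (auto simp: zero_ereal_def less_imp_le)
  have b: "0 \<le> 1 - g" using g(1) by simp
  show ?thesis
  proof (rule Z.nrm_A_le[OF g0(1) gap_form[OF gap g0] b _ f])
    fix l :: real assume l: "1 - g < \<bar>l\<bar>" "l \<noteq> 1"
    have "complex_of_real l \<notin> L2_spectrum \<pi> (markov_op P)"
    proof
      assume "complex_of_real l \<in> L2_spectrum \<pi> (markov_op P)"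
      then have "ereal \<bar>l\<bar> \<le> (SUP z \<in> {z \<in> L2_spectrum \<pi> (markov_op P). z \<noteq> 1}. ereal (cmod z))"
        using l by (intro SUP_upper2[of "complex_of_real l"]) auto
      then have "absolute_spectral_gap \<pi> P \<le> 1 - ereal \<bar>l\<bar>"
        using spectral_gap_mult_one[OF gap] unfolding absolute_spectral_gap_def
        by (simp add: ereal_minus_mono del: abs_ereal.simps)
      with g have "ereal g \<le> 1 - ereal \<bar>l\<bar>" by (rule_tac order_trans)
      then show False using l by (simp add: one_ereal_def)
    qed
    then show "\<exists>d>0. \<forall>f\<in>L2_mean_zero \<pi>. d * L.nrm f \<le> L.nrm (l *\<^sub>R f - markov_op P f)"
      by (rule resolvent_mean_zero)
  qed
qed

text \<open>Ensures that a nonzero absolute gap is positive, which is what the case distinction in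
  the final bound relies on.\<close>

lemma absolute_gap_nonneg: "0 \<le> absolute_spectral_gap \<pi> P"
proof -
  have "(SUP z \<in> {z \<in> L2_spectrum \<pi> (markov_op P). z \<noteq> 1}. ereal (cmod z)) \<le> 1"
    by (rule SUP_least) (use spectrum_cmod_le in \<open>auto simp: one_ereal_def\<close>)
  then show ?thesis
    by (auto simp: absolute_spectral_gap_def ereal_diff_positive)
qed

text \<open>An infinite gap means that there is no spectrum besides \<open>1\<close>, i.e. that \<open>L\<^sup>2(\<pi>)\<close> is
  one-dimensional.\<close>

lemma absolute_gap_cases:
  assumes gap: "spectral_gap \<pi> P > 0"
  shows "absolute_spectral_gap \<pi> P \<le> 1 \<or> (absolute_spectral_gap \<pi> P = \<infinity> \<and> spectral_gap \<pi> P = \<infinity>)"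
proof (cases "{z \<in> L2_spectrum \<pi> (markov_op P). z \<noteq> 1} = {}")
  case True
  then show ?thesis using spectral_gap_mult_one[OF gap]
    unfolding absolute_spectral_gap_def spectral_gap_def True by (simp add: bot_ereal_def)
next
  case False
  then obtain z where "z \<in> {z \<in> L2_spectrum \<pi> (markov_op P). z \<noteq> 1}" by blast
  then have "ereal 0 \<le> (SUP z \<in> {z \<in> L2_spectrum \<pi> (markov_op P). z \<noteq> 1}. ereal (cmod z))"
    by (rule SUP_upper2) simp
  then have "1 - (SUP z \<in> {z \<in> L2_spectrum \<pi> (markov_op P). z \<noteq> 1}. ereal (cmod z)) \<le> 1 - ereal 0"
    by (intro ereal_minus_mono) auto
  then show ?thesis using spectral_gap_mult_one[OF gap] by (simp add: absolute_spectral_gap_def)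
qed

text \<open>The form of \<open>lap\<close> is at most 2, so a form bound with any constant above 2,
  here 3, makes every mean zero function null.\<close>

lemma infinite_gap_trivial:
  assumes "spectral_gap \<pi> P = \<infinity>" and f: "f \<in> L2_mean_zero \<pi>"
  shows "L2_re_inner \<pi> f f = 0"
proof -
  have "3 * L2_re_inner \<pi> f f \<le> L2_re_inner \<pi> (Z.lap f) f"
    by (rule gap_form) (use assms in auto)
  also have "\<dots> \<le> 2 * L2_re_inner \<pi> f f"
    using Z.abs_ip_A_le[OF f] f by (simp add: Z.lap_def Z.ip_simps)
  finally show ?thesis using Z.ip_nonneg[OF f] by simp
qed

section \<open>The fundamental operator \<open>I - P + \<pi>\<close> and the asymptotic
  variance\<close>

lemma centre_mean_zero: "f \<in> L2 \<pi> \<Longrightarrow> (\<lambda>x. f x - (\<integral>y. f y \<partial>\<pi>)) \<in> L2_mean_zero \<pi>"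
  by (simp add: L2_mean_zero_def L2_diff L2_const L2_integrable prob_space)

lemma complex_variance_eq:
  "complex_variance \<pi> f = L2_re_inner \<pi> (\<lambda>x. f x - (\<integral>y. f y \<partial>\<pi>)) (\<lambda>x. f x - (\<integral>y. f y \<partial>\<pi>))"
  by (simp add: complex_variance_def L2_re_inner_self)

text \<open>The operator acts as \<open>lap\<close> on mean zero functions and as the identity on
  constants. Splitting off the mean reduces the lower bound to \<open>nrm_poisson_le\<close> and
  surjectivity to \<open>lap_surj\<close>.\<close>

lemma fundamental_inverse_exists:
  assumes g: "g > 0" "\<And>f. f \<in> L2_mean_zero \<pi> \<Longrightarrow> g * L2_re_inner \<pi> f f \<le> L2_re_inner \<pi> (Z.lap f) f"
  shows "\<exists>S. L2_is_inverse \<pi> (\<lambda>h x. h x - (markov_op P h x - mean_op \<pi> h x)) S"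
proof (rule L2_is_inverse_exists)
  let ?T = "\<lambda>h x. h x - (markov_op P h x - mean_op \<pi> h x)"
  have mean_L2: "mean_op \<pi> h \<in> L2 \<pi>" for h unfolding mean_op_def by (rule L2_const)
  fix f h :: "'a \<Rightarrow> complex" assume f: "f \<in> L2 \<pi>"
  show TL: "?T f \<in> L2 \<pi>" using f by (intro L2_diff markov_op_L2 mean_L2)
  show "AE x in \<pi>. f x + h x - (markov_op P (\<lambda>y. f y + h y) x - mean_op \<pi> (\<lambda>y. f y + h y) x)
      = ?T f x + ?T h x" if h: "h \<in> L2 \<pi>"
    using markov_op_add[OF f h] by eventually_elim (simp add: mean_op_def L2_integrable f h)
  show "AE x in \<pi>. c * f x - (markov_op P (\<lambda>y. c * f y) x - mean_op \<pi> (\<lambda>y. c * f y) x) = c * ?T f x" for c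
    by (simp add: markov_op_scale mean_op_def algebra_simps)
  let ?c = "\<integral>y. f y \<partial>\<pi>"
  let ?f0 = "\<lambda>x. f x - ?c"
  have f0: "?f0 \<in> L2_mean_zero \<pi>" by (rule centre_mean_zero[OF f])
  have B0: "AE x in \<pi>. Z.lap ?f0 x = f x - markov_op P f x"
    using markov_op_diff[OF f L2_const[of ?c]] by eventually_elim (simp add: lap_fun markov_op_const)
  \<comment> \<open>\<open>?T f\<close> has the same mean \<open>?c\<close> as \<open>f\<close>, so
    \<open>cmod ?c\<close> costs one norm of \<open>?T f\<close>. Since \<open>Z.lap ?f0\<close> is
    \<open>?T f\<close> minus \<open>?c\<close>, it costs two, and inverting \<open>lap\<close>
    divides them by \<open>g\<close>.\<close>
  show "L2_norm \<pi> f \<le> (1 + 2 / g) * L2_norm \<pi> (?T f)"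
  proof -
    have "(\<integral>x. ?T f x \<partial>\<pi>) = ?c"
      using f by (simp add: mean_op_def integral_markov_op L2_integrable markov_op_L2 prob_space)
    then have c_le: "cmod ?c \<le> L2_norm \<pi> (?T f)"
      using norm_integral_le_L2_norm(2)[OF TL] by simp
    have norm_const: "L2_norm \<pi> (\<lambda>_. ?c) = cmod ?c"
      by (simp add: L2_norm_def prob_space)
    have "L2_norm \<pi> (Z.lap ?f0) = L2_norm \<pi> (?T f - (\<lambda>_. ?c))"
    proof (rule L2_norm_cong_AE)
      show "AE x in \<pi>. Z.lap ?f0 x = (?T f - (\<lambda>_. ?c)) x"
        using B0 by eventually_elim (simp add: mean_op_def)
      show "Z.lap ?f0 \<in> borel_measurable \<pi>"
        using Z.lap_closed[OF f0] by (intro L2_measurable mean_zero_L2)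
      show "?T f - (\<lambda>_. ?c) \<in> borel_measurable \<pi>"
        using L.H_closed(4)[OF TL L2_const[of ?c]] by (rule L2_measurable)
    qed
    also have "\<dots> \<le> L2_norm \<pi> (?T f) + cmod ?c"
      using L.nrm_triangle[OF TL L.H_closed(5)[OF L2_const[of ?c]]] L.nrm_minus[OF L2_const[of ?c]]
      by (simp add: nrm_eq norm_const)
    finally have "L2_norm \<pi> (Z.lap ?f0) \<le> 2 * L2_norm \<pi> (?T f)" using c_le by simp
    moreover have "L2_norm \<pi> ?f0 \<le> L2_norm \<pi> (Z.lap ?f0) / g"
      using Z.nrm_poisson_le[OF g f0 Z.lap_closed[OF f0]] Z.nrm_0 by (simp add: nrm_eq)
    moreover have "L2_norm \<pi> (Z.lap ?f0) / g \<le> 2 * L2_norm \<pi> (?T f) / g"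
      using calculation(1) g(1) by (intro divide_right_mono) auto
    moreover have "L2_norm \<pi> f \<le> L2_norm \<pi> ?f0 + cmod ?c"
      using L.nrm_triangle[OF mean_zero_L2[OF f0] L2_const[of ?c]]
      by (simp add: nrm_eq norm_const plus_fun_def)
    ultimately show ?thesis using c_le by (simp add: algebra_simps)
  qed
  show "\<exists>u\<in>L2 \<pi>. AE x in \<pi>. ?T u x = f x"
  proof -
    obtain u0 where u0: "u0 \<in> L2_mean_zero \<pi>" "L.nrm (Z.lap u0 - ?f0) = 0"
      using Z.lap_surj[OF g f0] by blast
    then have eq: "AE x in \<pi>. Z.lap u0 x = ?f0 x"
      using nrm_null_iff[OF Z.lap_closed[OF u0(1)] f0] by simp
    let ?u = "\<lambda>x. u0 x + ?c"
    have u0L: "u0 \<in> L2 \<pi>" by (rule mean_zero_L2[OF u0(1)])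
    have mean: "mean_op \<pi> ?u x = ?c" for x
      using u0 u0L by (simp add: mean_op_def L2_integrable L2_mean_zero_def prob_space)
    have "AE x in \<pi>. ?T ?u x = f x"
      using eq markov_op_add[OF u0L L2_const[of ?c]]
      by eventually_elim (simp add: lap_fun markov_op_const mean algebra_simps)
    then show ?thesis by (rule bexI[OF _ L2_add[OF u0L L2_const]])
  qed
qed

lemma L2_inner_self_adjoint_real:
  assumes u: "u \<in> L2 \<pi>"
  shows "Im (L2_inner \<pi> (markov_op P u) u) = 0"
proof -
  have "L2_inner \<pi> (markov_op P u) u = cnj (L2_inner \<pi> (markov_op P u) u)"
    using markov_op_adjoint[OF u u] L2_inner_cnj by metis
  then have "Im (L2_inner \<pi> (markov_op P u) u) = Im (cnj (L2_inner \<pi> (markov_op P u) u))" by (rule arg_cong)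
  then show ?thesis by simp
qed

text \<open>The fundamental operator preserves means, so its inverse sends \<open>fbar\<close> to a
  mean zero function, on which the operator is \<open>lap\<close>; the result solves the Poisson
  equation. The value is real because \<open>L2_inner \<pi> fbar u\<close> equals the quadratic form
  of the self-adjoint \<open>lap\<close> at \<open>u\<close>.\<close>

lemma asymptotic_variance_poisson:
  assumes g: "g > 0" "\<And>f. f \<in> L2_mean_zero \<pi> \<Longrightarrow> g * L2_re_inner \<pi> f f \<le> L2_re_inner \<pi> (Z.lap f) f"
    and f: "f \<in> L2 \<pi>"
  defines "fbar \<equiv> \<lambda>x. f x - (\<integral>y. f y \<partial>\<pi>)"
  obtains u where "u \<in> L2_mean_zero \<pi>" "L.nrm (Z.lap u - fbar) = 0"
    "asymptotic_variance \<pi> P f = of_real (2 * L2_re_inner \<pi> u fbar - L2_re_inner \<pi> fbar fbar)"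
proof -
  let ?T = "\<lambda>h x. h x - (markov_op P h x - mean_op \<pi> h x)"
  define R where "R = L2_inverse \<pi> ?T"
  have R: "L2_is_inverse \<pi> ?T R"
    unfolding R_def L2_inverse_def by (rule someI_ex[OF fundamental_inverse_exists[OF g]])
  define u where "u = R fbar"
  have fb: "fbar \<in> L2_mean_zero \<pi>" unfolding fbar_def by (rule centre_mean_zero[OF f])
  have fbL: "fbar \<in> L2 \<pi>" by (rule mean_zero_L2[OF fb])
  have uL: "u \<in> L2 \<pi>" and Tu: "AE x in \<pi>. ?T u x = fbar x"
    using R fbL by (auto simp: L2_is_inverse_def L2_bounded_operator_def u_def)
  have TuL: "?T u \<in> L2 \<pi>"
    using uL unfolding mean_op_def by (intro L2_diff markov_op_L2 L2_const)
  have "(\<integral>x. u x \<partial>\<pi>) = (\<integral>x. ?T u x \<partial>\<pi>)"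
    using uL by (simp add: mean_op_def integral_markov_op L2_integrable markov_op_L2 prob_space)
  also have "\<dots> = (\<integral>x. fbar x \<partial>\<pi>)"
    using Tu TuL fbL by (intro integral_cong_AE L2_measurable)
  also have "\<dots> = 0" using fb by (simp add: L2_mean_zero_def)
  finally have mean: "(\<integral>x. u x \<partial>\<pi>) = 0" .
  then have u: "u \<in> L2_mean_zero \<pi>" using uL by (simp add: L2_mean_zero_def)
  have Bu: "AE x in \<pi>. Z.lap u x = fbar x"
    using Tu by eventually_elim (simp add: lap_fun mean_op_def mean)
  have BuL: "Z.lap u \<in> L2 \<pi>" using Z.lap_closed[OF u] by (rule mean_zero_L2)
  have "L2_inner \<pi> fbar u = L2_inner \<pi> (Z.lap u) u"
    unfolding L2_inner_def
    using Bu L2_integrable_mult[OF fbL uL] L2_integrable_mult[OF BuL uL]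
    by (intro integral_cong_AE borel_measurable_integrable) auto
  also have "\<dots> = L2_inner \<pi> u u - L2_inner \<pi> (markov_op P u) u"
    unfolding L2_inner_def lap_fun
    using L2_integrable_mult[OF uL uL] L2_integrable_mult[OF markov_op_L2[OF uL] uL]
    by (simp add: left_diff_distrib)
  finally have im: "Im (L2_inner \<pi> fbar u) = 0"
    using L2_inner_self_adjoint_real[OF uL] by (simp add: L2_inner_self)
  have "asymptotic_variance \<pi> P f = L2_inner \<pi> fbar (\<lambda>x. 2 * u x - fbar x)"
    by (simp add: asymptotic_variance_def Let_def fbar_def[symmetric] R_def[symmetric] u_def)
  also have "\<dots> = 2 * L2_inner \<pi> fbar u - L2_inner \<pi> fbar fbar"
  proof -
    have "L2_inner \<pi> fbar (\<lambda>x. 2 * u x - fbar x)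
        = (\<integral>x. 2 * (fbar x * cnj (u x)) - fbar x * cnj (fbar x) \<partial>\<pi>)"
      unfolding L2_inner_def by (rule Bochner_Integration.integral_cong[OF refl]) (simp add: algebra_simps)
    then show ?thesis
      using L2_integrable_mult[OF fbL uL] L2_integrable_mult[OF fbL fbL] by (simp add: L2_inner_def)
  qed
  also have "\<dots> = of_real (2 * L2_re_inner \<pi> u fbar - L2_re_inner \<pi> fbar fbar)"
    using im L.ip_commute[OF uL fbL] L2_inner_self[of \<pi> fbar]
    by (simp add: complex_eq_iff L2_re_inner_def)
  finally show ?thesis
    using that u nrm_null_iff[OF Z.lap_closed[OF u] fb] Bu by blast
qed

end

section \<open>Covariances of the stationary chain\<close>

locale stationary_chain = reversible_kernel +
  fixes M :: "'w measure" and X :: "nat \<Rightarrow> 'w \<Rightarrow> 'a" and n :: nat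
  assumes chain: "markov_chain M P n X" and initial: "distr M borel (X 1) = \<pi>"
begin

lemma prob_space_M: "prob_space M"
  using chain by (simp add: markov_chain_def)

sublocale M: prob_space M
  by (rule prob_space_M)

lemma X_measurable: "i \<in> {1..n} \<Longrightarrow> X i \<in> M \<rightarrow>\<^sub>M borel"
  using chain by (simp add: markov_chain_def)

lemma sets_past:
  "sets (past M X j) = sigma_sets (space M) (\<Union>i\<in>{1..j}. {X i -` A \<inter> space M | A. A \<in> sets borel})"
  unfolding past_def by (rule sets_measure_of) blast

lemma subalgebra_past:
  assumes "j \<le> n" shows "subalgebra M (past M X j)"
  unfolding subalgebra_def
proof
  show "space (past M X j) = space M"
    unfolding past_def by (rule space_measure_of) blast
  have "(\<Union>i\<in>{1..j}. {X i -` A \<inter> space M | A. A \<in> sets borel}) \<subseteq> sets M"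
    using assms by (auto intro!: measurable_sets[OF X_measurable])
  then show "sets (past M X j) \<subseteq> sets M"
    unfolding sets_past by (rule sets.sigma_sets_subset)
qed

text \<open>The event that \<open>X i\<close> lies in \<open>A\<close> belongs to the past up to
  \<open>j\<close>, so the conditional probability of the next step may be inserted. Allowing
  \<open>i < j\<close> is what lets \<open>covariance_X\<close> reach larger lags.\<close>

lemma emeasure_step:
  assumes i: "i \<in> {1..j}" and j: "j \<in> {1..<n}" and A: "A \<in> sets borel" and C: "C \<in> sets borel"
  shows "emeasure M (X i -` A \<inter> X (Suc j) -` C \<inter> space M)
    = (\<integral>\<^sup>+w. indicator A (X i w) * emeasure (P (X j w)) C \<partial>M)"
proof -
  have [measurable]: "X i \<in> M \<rightarrow>\<^sub>M borel" "X j \<in> M \<rightarrow>\<^sub>M borel" "X (Suc j) \<in> M \<rightarrow>\<^sub>M borel"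
    using i j by (auto intro: X_measurable)
  note [measurable] = A C
  interpret F: finite_measure_subalgebra M "past M X j"
    by unfold_locales (use j in \<open>auto intro: subalgebra_past\<close>)
  let ?f = "\<lambda>w. indicator (X i -` A \<inter> space M) w :: real"
  let ?g = "\<lambda>w. indicator C (X (Suc j) w) :: real"
  have "X i -` A \<inter> space M \<in> sets (past M X j)"
    unfolding sets_past using i A by (intro sigma_sets.Basic) blast
  then have f: "?f \<in> borel_measurable (past M X j)" by simp
  have "integrable M (\<lambda>w. ?f w * ?g w)"
    by (rule M.integrable_const_bound[of _ 1]) (auto simp: indicator_def)
  then have "(\<integral>w. ?f w * ?g w \<partial>M) = (\<integral>w. ?f w * real_cond_exp M (past M X j) ?g w \<partial>M)"
    using F.real_cond_exp_intg(2)[OF _ f] by simp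
  also have "\<dots> = (\<integral>w. ?f w * measure (P (X j w)) C \<partial>M)"
  proof (rule integral_cong_AE)
    have "AE w in M. real_cond_exp M (past M X j) ?g w = measure (P (X j w)) C"
      using chain j C by (auto simp: markov_chain_def)
    then show "AE w in M. ?f w * real_cond_exp M (past M X j) ?g w = ?f w * measure (P (X j w)) C"
      by eventually_elim simp
  qed (auto intro!: borel_measurable_times measurable_compose[OF measurable_compose[OF \<open>X j \<in> M \<rightarrow>\<^sub>M borel\<close> kernel_subprob] measurable_measure_subprob_algebra[OF C]])
  finally have eq: "(\<integral>w. ?f w * ?g w \<partial>M) = (\<integral>w. ?f w * measure (P (X j w)) C \<partial>M)" .
  have P1: "measure (P x) C \<le> 1" for x
    using prob_space.prob_le_1[OF prob_space_P] by simp
  have meas: "(\<lambda>w. measure (P (X j w)) C) \<in> borel_measurable M"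
    by (intro measurable_compose[OF measurable_compose[OF \<open>X j \<in> M \<rightarrow>\<^sub>M borel\<close> kernel_subprob] measurable_measure_subprob_algebra[OF C]])
  have "emeasure M (X i -` A \<inter> X (Suc j) -` C \<inter> space M) = ennreal (\<integral>w. ?f w * ?g w \<partial>M)"
  proof -
    have "(\<integral>w. ?f w * ?g w \<partial>M) = (\<integral>w. indicator (X i -` A \<inter> X (Suc j) -` C \<inter> space M) w \<partial>M)"
      by (rule Bochner_Integration.integral_cong) (auto simp: indicator_def)
    then show ?thesis by (simp add: M.emeasure_eq_measure Int_absorb1)
  qed
  also have "\<dots> = (\<integral>\<^sup>+w. ennreal (?f w * measure (P (X j w)) C) \<partial>M)"
    unfolding eq
    by (intro nn_integral_eq_integral[symmetric] M.integrable_const_bound[of _ 1])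
      (use P1 meas in \<open>auto simp: indicator_def\<close>)
  also have "\<dots> = (\<integral>\<^sup>+w. indicator A (X i w) * emeasure (P (X j w)) C \<partial>M)"
    by (intro nn_integral_cong)
      (auto simp: indicator_def finite_measure.emeasure_eq_measure[OF prob_space.finite_measure[OF prob_space_P]])
  finally show ?thesis .
qed

lemma distr_pair_step:
  assumes i: "i \<in> {1..j}" and j: "j \<in> {1..<n}"
  shows "distr M (borel \<Otimes>\<^sub>M borel) (\<lambda>w. (X i w, X (Suc j) w)) = step_law M (X i) (X j)"
proof -
  have X [measurable]: "X i \<in> M \<rightarrow>\<^sub>M borel" "X j \<in> M \<rightarrow>\<^sub>M borel" "X (Suc j) \<in> M \<rightarrow>\<^sub>M borel"
    using i j by (auto intro: X_measurable)
  let ?E = "{a \<times> b | a b. a \<in> sets (borel :: 'a measure) \<and> b \<in> sets (borel :: 'a measure)}"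
  have gen: "sets (borel \<Otimes>\<^sub>M borel :: ('a \<times> 'a) measure) = sigma_sets UNIV ?E"
    by (simp add: sets_pair_measure)
  show ?thesis
  proof (rule measure_eqI_generator_eq[where E = ?E and \<Omega> = UNIV and A = "\<lambda>_. UNIV"])
    show "Int_stable ?E" by (rule Int_stable_pair_measure_generator)
    show "range (\<lambda>_. UNIV) \<subseteq> ?E" by (auto intro!: exI[of _ UNIV])
    fix R assume "R \<in> ?E"
    then obtain A C where R: "R = A \<times> C" and A [measurable]: "A \<in> sets borel" and C [measurable]: "C \<in> sets borel"
      by blast
    have "emeasure (distr M (borel \<Otimes>\<^sub>M borel) (\<lambda>w. (X i w, X (Suc j) w))) R
        = emeasure M (X i -` A \<inter> X (Suc j) -` C \<inter> space M)"
      unfolding R by (subst emeasure_distr) (auto intro!: arg_cong[where f = "emeasure M"])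
    also have "\<dots> = (\<integral>\<^sup>+w. indicator A (X i w) * emeasure (P (X j w)) C \<partial>M)"
      by (rule emeasure_step[OF i j A C])
    also have "\<dots> = (\<integral>\<^sup>+w. \<integral>\<^sup>+z. indicator A (X i w) * indicator C z \<partial>P (X j w) \<partial>M)"
      by (intro nn_integral_cong) (simp add: nn_integral_cmult)
    also have "\<dots> = (\<integral>\<^sup>+w. \<integral>\<^sup>+z. indicator R (X i w, z) \<partial>P (X j w) \<partial>M)"
      by (intro nn_integral_cong) (simp add: R indicator_times)
    also have "\<dots> = (\<integral>\<^sup>+p. indicator R p \<partial>step_law M (X i) (X j))"
      by (rule nn_integral_step_law[OF prob_space_M X(1,2), symmetric]) (simp add: R)
    also have "\<dots> = emeasure (step_law M (X i) (X j)) R"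
      by (rule nn_integral_indicator) (simp add: R sets_step_law[OF prob_space_M X(1,2)])
    finally show "emeasure (distr M (borel \<Otimes>\<^sub>M borel) (\<lambda>w. (X i w, X (Suc j) w))) R
        = emeasure (step_law M (X i) (X j)) R" .
  next
    show "emeasure (distr M (borel \<Otimes>\<^sub>M borel) (\<lambda>w. (X i w, X (Suc j) w))) UNIV \<noteq> \<infinity>"
      using finite_measure.emeasure_finite[OF M.finite_measure_distr[of "\<lambda>w. (X i w, X (Suc j) w)"]] by simp
  qed (auto simp: gen[symmetric] sets_step_law[OF prob_space_M X(1,2)])
qed

lemma distr_X: "i \<in> {1..n} \<Longrightarrow> distr M borel (X i) = \<pi>"
proof (induction i)
  case (Suc j)
  show ?case
  proof (cases "j = 0")
    case True
    then show ?thesis using initial by simp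
  next
    case False
    then have j: "j \<in> {1..j}" "j \<in> {1..<n}" and IH: "distr M borel (X j) = \<pi>" using Suc by auto
    have X: "X j \<in> M \<rightarrow>\<^sub>M borel" "X (Suc j) \<in> M \<rightarrow>\<^sub>M borel" using j Suc.prems by (auto intro: X_measurable)
    show ?thesis
    proof (rule measure_eqI)
      fix C assume "C \<in> sets (distr M borel (X (Suc j)))"
      then have C: "C \<in> sets borel" by simp
      have "emeasure (distr M borel (X (Suc j))) C = emeasure M (X j -` UNIV \<inter> X (Suc j) -` C \<inter> space M)"
        using X C by (simp add: emeasure_distr)
      also have "\<dots> = (\<integral>\<^sup>+w. emeasure (P (X j w)) C \<partial>M)"
        by (subst emeasure_step[OF j _ C]) simp_all
      also have "\<dots> = (\<integral>\<^sup>+x. emeasure (P x) C \<partial>distr M borel (X j))"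
        by (rule nn_integral_distr[OF X(1), symmetric])
          (simp, rule measurable_compose[OF kernel_subprob measurable_emeasure_subprob_algebra[OF C]])
      also have "\<dots> = emeasure (bind \<pi> P) C"
        unfolding IH by (rule emeasure_bind[OF not_empty kernel_pi C, symmetric])
      finally show "emeasure (distr M borel (X (Suc j))) C = emeasure \<pi> C" by (simp add: bind_pi)
    qed simp
  qed
qed simp

lemma L2_X: "i \<in> {1..n} \<Longrightarrow> f \<in> L2 \<pi> \<Longrightarrow> (\<lambda>w. f (X i w)) \<in> L2 M"
  using L2_distr_iff[OF X_measurable L2_pi_borel] distr_X by metis

lemma integral_X: "i \<in> {1..n} \<Longrightarrow> f \<in> borel_measurable borel \<Longrightarrow> (\<integral>w. f (X i w) \<partial>M) = (\<integral>x. f x \<partial>\<pi>)"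
  for f :: "'a \<Rightarrow> complex"
  using integral_distr[OF X_measurable, of i f] distr_X[of i] by simp

text \<open>Conditioning on the past replaces \<open>g\<close> at the last time by
  \<open>markov_op P g\<close> one step earlier. The induction therefore varies \<open>g\<close> and
  works with pairs of times only, through \<open>distr_pair_step\<close>.\<close>

lemma covariance_X:
  assumes i: "1 \<le> i" and f: "f \<in> L2 \<pi>" and g: "g \<in> L2 \<pi>" and k: "i + k \<le> n"
  shows "(\<integral>w. f (X i w) * cnj (g (X (i + k) w)) \<partial>M) = L2_inner \<pi> f ((markov_op P ^^ k) g)"
  using g k
proof (induction k arbitrary: g)
  case 0
  note [measurable] = L2_pi_borel[OF f] L2_pi_borel[OF 0(1)]
  have "i \<in> {1..n}" using 0 i by simp
  then show ?case using integral_X[of i "\<lambda>x. f x * cnj (g x)"] by (simp add: L2_inner_def)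
next
  case (Suc k)
  let ?j = "i + k"
  have ij: "i \<in> {1..?j}" "?j \<in> {1..<n}" and in_n: "i \<in> {1..n}" "?j \<in> {1..n}" using Suc.prems i by auto
  have X: "X i \<in> M \<rightarrow>\<^sub>M borel" "X ?j \<in> M \<rightarrow>\<^sub>M borel" "X (Suc ?j) \<in> M \<rightarrow>\<^sub>M borel"
    using Suc.prems i by (auto intro: X_measurable)
  note [measurable] = L2_pi_borel[OF f] L2_pi_borel[OF Suc.prems(1)] X
  have "(\<integral>w. f (X i w) * cnj (g (X (Suc ?j) w)) \<partial>M)
      = (\<integral>p. f (fst p) * cnj (g (snd p)) \<partial>distr M (borel \<Otimes>\<^sub>M borel) (\<lambda>w. (X i w, X (Suc ?j) w)))"
    by (subst integral_distr) simp_all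
  also have "\<dots> = (\<integral>w. f (X i w) * cnj (markov_op P g (X ?j w)) \<partial>M)"
    unfolding distr_pair_step[OF ij]
    by (rule integral_step_law_mult[OF prob_space_M X(1,2) distr_X distr_X f Suc.prems(1)]) (use in_n in auto)
  also have "\<dots> = L2_inner \<pi> f ((markov_op P ^^ k) (markov_op P g))"
    using Suc.IH[OF markov_op_L2[OF Suc.prems(1)]] Suc.prems by simp
  finally show ?case by (simp add: funpow_swap1)
qed

lemma complex_variance_sum:
  assumes g: "\<And>i. i \<in> {1..n} \<Longrightarrow> g i \<in> L2 \<pi>"
  shows "complex_variance M (\<lambda>w. \<Sum>i=1..n. g i (X i w))
    = Z.cov_sum n (\<lambda>i x. g i x - (\<integral>y. g i y \<partial>\<pi>))"
proof -
  define F where "F i = (\<lambda>x. g i x - (\<integral>y. g i y \<partial>\<pi>))" for i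
  have F: "F i \<in> L2_mean_zero \<pi>" if "i \<in> {1..n}" for i
    unfolding F_def by (rule centre_mean_zero[OF g[OF that]])
  have FX: "(\<lambda>w. F i (X i w)) \<in> L2 M" if "i \<in> {1..n}" for i
    by (rule L2_X[OF that mean_zero_L2[OF F[OF that]]])
  have mean: "(\<integral>w. (\<Sum>i=1..n. g i (X i w)) \<partial>M) = (\<Sum>i=1..n. \<integral>y. g i y \<partial>\<pi>)"
  proof -
    have "(\<integral>w. (\<Sum>i=1..n. g i (X i w)) \<partial>M) = (\<Sum>i=1..n. \<integral>w. g i (X i w) \<partial>M)"
      using g by (intro Bochner_Integration.integral_sum M.L2_integrable L2_X) auto
    also have "\<dots> = (\<Sum>i=1..n. \<integral>y. g i y \<partial>\<pi>)"
      using g by (intro sum.cong refl integral_X L2_pi_borel) auto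
    finally show ?thesis .
  qed
  have int: "integrable M (\<lambda>w. F i (X i w) * cnj (F j (X j w)))" if "i \<in> {1..n}" "j \<in> {1..n}" for i j
    by (rule L2_integrable_mult[OF FX[OF that(1)] FX[OF that(2)]])
  have entry: "Re (\<integral>w. F i (X i w) * cnj (F j (X j w)) \<partial>M)
      = L2_re_inner \<pi> ((markov_op P ^^ Z.lag i j) (F i)) (F j)" if ij: "i \<in> {1..n}" "j \<in> {1..n}" for i j
  proof (cases "i \<le> j")
    case True
    then have "(\<integral>w. F i (X i w) * cnj (F j (X j w)) \<partial>M) = L2_inner \<pi> (F i) ((markov_op P ^^ (j - i)) (F j))"
      using covariance_X[of i "F i" "F j" "j - i"] F ij mean_zero_L2 by simp
    then show ?thesis
      using True Z.Ak_sym[OF F[OF ij(1)] F[OF ij(2)]] by (simp add: Z.lag_def L2_re_inner_def)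
  next
    case False
    then have eq: "(\<integral>w. F j (X j w) * cnj (F i (X i w)) \<partial>M) = L2_inner \<pi> (F j) ((markov_op P ^^ (i - j)) (F i))"
      using covariance_X[of j "F j" "F i" "i - j"] F ij mean_zero_L2 by simp
    \<comment> \<open>\<open>covariance_X\<close> needs the earlier time first; exchanging the two
      factors conjugates the integral and leaves its real part unchanged.\<close>
    have "(\<integral>w. F i (X i w) * cnj (F j (X j w)) \<partial>M) = cnj (\<integral>w. F j (X j w) * cnj (F i (X i w)) \<partial>M)"
      by (subst Bochner_Integration.integral_cnj[symmetric]) (simp add: mult.commute)
    then show ?thesis
      using False eq Z.ip_commute[OF F[OF ij(2)] Z.Ak_closed[OF F[OF ij(1)]]]
      by (simp add: Z.lag_def L2_re_inner_def)
  qed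
  have "complex_of_real (complex_variance M (\<lambda>w. \<Sum>i=1..n. g i (X i w)))
      = (\<integral>w. complex_of_real ((cmod (\<Sum>i=1..n. F i (X i w)))\<^sup>2) \<partial>M)"
    unfolding complex_variance_def mean F_def sum_subtractf by (rule integral_complex_of_real[symmetric])
  also have "\<dots> = (\<integral>w. (\<Sum>i=1..n. \<Sum>j=1..n. F i (X i w) * cnj (F j (X j w))) \<partial>M)"
    by (intro Bochner_Integration.integral_cong refl)
      (simp only: complex_norm_square cnj_sum sum_product)
  also have "\<dots> = (\<Sum>i=1..n. \<integral>w. (\<Sum>j=1..n. F i (X i w) * cnj (F j (X j w))) \<partial>M)"
    by (intro Bochner_Integration.integral_sum Bochner_Integration.integrable_sum int)
  also have "\<dots> = (\<Sum>i=1..n. \<Sum>j=1..n. \<integral>w. F i (X i w) * cnj (F j (X j w)) \<partial>M)"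
    by (intro sum.cong refl Bochner_Integration.integral_sum int)
  finally have eq: "complex_of_real (complex_variance M (\<lambda>w. \<Sum>i=1..n. g i (X i w)))
      = (\<Sum>i=1..n. \<Sum>j=1..n. \<integral>w. F i (X i w) * cnj (F j (X j w)) \<partial>M)" .
  have "complex_variance M (\<lambda>w. \<Sum>i=1..n. g i (X i w))
      = (\<Sum>i=1..n. \<Sum>j=1..n. Re (\<integral>w. F i (X i w) * cnj (F j (X j w)) \<partial>M))"
    using arg_cong[OF eq, of Re] by (simp only: Re_complex_of_real Re_sum)
  also have "\<dots> = Z.cov_sum n F"
    unfolding Z.cov_sum_def by (intro sum.cong refl entry)
  finally show ?thesis unfolding F_def .
qed

lemma complex_variance_X:
  assumes i: "i \<in> {1..n}" and g: "g \<in> L2 \<pi>"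
  shows "complex_variance M (\<lambda>w. g (X i w)) = complex_variance \<pi> g"
proof -
  note [measurable] = L2_pi_borel[OF g]
  have "complex_variance M (\<lambda>w. g (X i w)) = (\<integral>w. (cmod (g (X i w) - (\<integral>y. g y \<partial>\<pi>)))\<^sup>2 \<partial>M)"
    by (simp add: complex_variance_def integral_X[OF i])
  also have "\<dots> = (\<integral>x. (cmod (g x - (\<integral>y. g y \<partial>\<pi>)))\<^sup>2 \<partial>distr M borel (X i))"
    by (rule integral_distr[OF X_measurable[OF i], symmetric]) simp
  finally show ?thesis by (simp add: distr_X[OF i] complex_variance_def)
qed

section \<open>Variance bounds for the stationary chain\<close>

lemma variance_bounds:
  assumes gap: "spectral_gap \<pi> P > 0" and g: "g > 0" "ereal g \<le> spectral_gap \<pi> P" and f: "f \<in> L2 \<pi>"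
  shows "complex_variance M (\<lambda>w. \<Sum>i=1..n. f (X i w)) \<le> 2 * real n * complex_variance \<pi> f / g"
    and "cmod (complex_of_real (complex_variance M (\<lambda>w. \<Sum>i=1..n. f (X i w)))
        - of_nat n * asymptotic_variance \<pi> P f) \<le> 4 * complex_variance \<pi> f / g\<^sup>2"
proof -
  let ?f = "\<lambda>x. f x - (\<integral>y. f y \<partial>\<pi>)"
  note form = gap_form[OF gap g]
  obtain u where u: "u \<in> L2_mean_zero \<pi>" "L.nrm (Z.lap u - ?f) = 0"
    "asymptotic_variance \<pi> P f = of_real (2 * L2_re_inner \<pi> u ?f - L2_re_inner \<pi> ?f ?f)"
    using asymptotic_variance_poisson[OF g(1) form f] by blast
  have fz: "?f \<in> L2_mean_zero \<pi>" by (rule centre_mean_zero[OF f])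
  have var: "complex_variance M (\<lambda>w. \<Sum>i=1..n. f (X i w)) = Z.cov_sum n (\<lambda>_. ?f)"
    by (rule complex_variance_sum[where g = "\<lambda>_. f", OF f])
  show "complex_variance M (\<lambda>w. \<Sum>i=1..n. f (X i w)) \<le> 2 * real n * complex_variance \<pi> f / g"
    unfolding var complex_variance_eq by (rule Z.cov_sum_le[OF g(1) form u(1) fz u(2)])
  have "complex_of_real (complex_variance M (\<lambda>w. \<Sum>i=1..n. f (X i w))) - of_nat n * asymptotic_variance \<pi> P f
      = complex_of_real (Z.cov_sum n (\<lambda>_. ?f) - real n * (2 * L2_re_inner \<pi> u ?f - L2_re_inner \<pi> ?f ?f))"
    unfolding var u(3) by simp
  then show "cmod (complex_of_real (complex_variance M (\<lambda>w. \<Sum>i=1..n. f (X i w)))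
        - of_nat n * asymptotic_variance \<pi> P f) \<le> 4 * complex_variance \<pi> f / g\<^sup>2"
    using Z.cov_sum_asymp[OF g(1) form u(1) fz u(2), of n]
    by (simp only: norm_of_real complex_variance_eq)
qed

lemma variance_bound_absolute:
  assumes gap: "spectral_gap \<pi> P > 0" and b: "0 < b" "b \<le> 1" "ereal b \<le> absolute_spectral_gap \<pi> P"
    and g: "\<And>i. i \<in> {1..n} \<Longrightarrow> g i \<in> L2 \<pi>"
  shows "complex_variance M (\<lambda>w. \<Sum>i=1..n. g i (X i w))
    \<le> 2 / b * (\<Sum>i=1..n. complex_variance M (\<lambda>w. g i (X i w)))"
proof -
  let ?F = "\<lambda>i x. g i x - (\<integral>y. g i y \<partial>\<pi>)"
  have "complex_variance M (\<lambda>w. \<Sum>i=1..n. g i (X i w)) = Z.cov_sum n ?F"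
    by (rule complex_variance_sum[where g = g, OF g])
  also have "\<dots> \<le> 2 / (1 - (1 - b)) * (\<Sum>i=1..n. L2_re_inner \<pi> (?F i) (?F i))"
    by (rule Z.cov_sum_le_sum[where F = ?F, OF _ _ absolute_gap_norm[OF gap b(2,3)]])
      (use b g centre_mean_zero in auto)
  also have "(\<Sum>i=1..n. L2_re_inner \<pi> (?F i) (?F i)) = (\<Sum>i=1..n. complex_variance M (\<lambda>w. g i (X i w)))"
    using g by (intro sum.cong refl) (simp add: complex_variance_X complex_variance_eq)
  finally show ?thesis by simp
qed

lemma infinite_gap_variance:
  "spectral_gap \<pi> P = \<infinity> \<Longrightarrow> f \<in> L2 \<pi> \<Longrightarrow> complex_variance \<pi> f = 0"
  by (simp add: complex_variance_eq infinite_gap_trivial centre_mean_zero)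

end

theorem theorem3p5:
  fixes P :: "'a::polish_space \<Rightarrow> 'a measure"
    and \<pi> :: "'a measure"
    and M :: "'w measure"
    and X :: "nat \<Rightarrow> 'w \<Rightarrow> 'a"
    and n :: nat
    and f :: "'a \<Rightarrow> complex"
  assumes kernel: "P \<in> borel \<rightarrow>\<^sub>M prob_algebra borel"
    and stationary: "stationary_dist P \<pi>"
    and unique: "\<And>\<nu>. stationary_dist P \<nu> \<Longrightarrow> \<nu> = \<pi>"
    and reversible: "reversible P \<pi>"
    and irreducible: "phi_irreducible P"
    and aperiodic: "aperiodic P \<pi>"
    and n: "n \<ge> 1"
    and chain: "markov_chain M P n X"
    and initial: "distr M borel (X 1) = \<pi>"
    and gap: "spectral_gap \<pi> P > 0"
    and f: "f \<in> L2 \<pi>"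
  shows "(ereal (complex_variance M (\<lambda>w. \<Sum>i=1..n. f (X i w)))
           \<le> ereal (2 * real n * complex_variance \<pi> f) / spectral_gap \<pi> P)
       \<and> (ereal (cmod (complex_of_real (complex_variance M (\<lambda>w. \<Sum>i=1..n. f (X i w)))
                      - of_nat n * asymptotic_variance \<pi> P f))
           \<le> ereal (4 * complex_variance \<pi> f) / (spectral_gap \<pi> P)\<^sup>2)
       \<and> (\<forall>g :: nat \<Rightarrow> 'a \<Rightarrow> complex. (\<forall>i\<in>{1..n}. g i \<in> L2 \<pi>) \<longrightarrow>
           ereal (complex_variance M (\<lambda>w. \<Sum>i=1..n. g i (X i w)))
           \<le> (if absolute_spectral_gap \<pi> P = 0 then \<infinity>
              else 2 / absolute_spectral_gap \<pi> P
                   * ereal (\<Sum>i=1..n. complex_variance M (\<lambda>w. g i (X i w)))))"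
proof -
  interpret prob_space \<pi> using stationary by (simp add: stationary_dist_def)
  interpret stationary_chain \<pi> P M X n
    by unfold_locales
      (use kernel stationary reversible chain initial in \<open>simp_all add: stationary_dist_def\<close>)
  have "ereal (complex_variance M (\<lambda>w. \<Sum>i=1..n. f (X i w)))
      \<le> ereal (2 * real n * complex_variance \<pi> f) / spectral_gap \<pi> P
    \<and> ereal (cmod (complex_of_real (complex_variance M (\<lambda>w. \<Sum>i=1..n. f (X i w)))
        - of_nat n * asymptotic_variance \<pi> P f)) \<le> ereal (4 * complex_variance \<pi> f) / (spectral_gap \<pi> P)\<^sup>2"
  proof (cases "spectral_gap \<pi> P")
    case (real r)
    then have r: "r > 0" "ereal r \<le> spectral_gap \<pi> P" using gap by simp_all
    then have "ereal (2 * real n * complex_variance \<pi> f) / spectral_gap \<pi> P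
        = ereal (2 * real n * complex_variance \<pi> f / r)"
      "ereal (4 * complex_variance \<pi> f) / (spectral_gap \<pi> P)\<^sup>2 = ereal (4 * complex_variance \<pi> f / r\<^sup>2)"
      by (simp_all add: real)
    then show ?thesis
      using variance_bounds[OF gap r f] by (simp only: ereal_less_eq simp_thms)
  next
    case PInf
    \<comment> \<open>Division by an infinite gap gives 0 on the right. Since the variance of
      \<open>f\<close> vanishes, the bounds for the real constant 1 already say that the left hand
      sides are at most 0.\<close>
    then have le: "ereal 1 \<le> spectral_gap \<pi> P" by simp
    have "complex_variance \<pi> f = 0" by (rule infinite_gap_variance[OF PInf f])
    then show ?thesis
      using variance_bounds[OF gap zero_less_one le f] by (simp add: PInf)
  qed (use gap in simp)
  moreover have "ereal (complex_variance M (\<lambda>w. \<Sum>i=1..n. g i (X i w)))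
      \<le> 2 / absolute_spectral_gap \<pi> P * ereal (\<Sum>i=1..n. complex_variance M (\<lambda>w. g i (X i w)))"
    if g: "\<forall>i\<in>{1..n}. g i \<in> L2 \<pi>" and ne: "absolute_spectral_gap \<pi> P \<noteq> 0" for g :: "nat \<Rightarrow> 'a \<Rightarrow> complex"
  proof -
    have gL: "g i \<in> L2 \<pi>" if "i \<in> {1..n}" for i using g that by blast
    show ?thesis
    proof (cases "absolute_spectral_gap \<pi> P")
      case (real b)
      \<comment> \<open>Needed so that \<open>1 - b\<close> is a nonnegative bound for the norm on
        mean zero functions.\<close>
      have "absolute_spectral_gap \<pi> P \<le> 1"
        using absolute_gap_cases[OF gap] real by auto
      then have b: "0 < b" "b \<le> 1" "ereal b \<le> absolute_spectral_gap \<pi> P"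
        using absolute_gap_nonneg ne by (simp_all add: real)
      have "2 / absolute_spectral_gap \<pi> P * ereal x = ereal (2 / b * x)" for x
        using b(1) by (simp add: real)
      then show ?thesis
        using variance_bound_absolute[where g = g, OF gap b gL] by (simp only: ereal_less_eq)
    next
      case PInf
      then have "spectral_gap \<pi> P = \<infinity>" using absolute_gap_cases[OF gap] by auto
      then have zero: "complex_variance M (\<lambda>w. g i (X i w)) = 0" if "i \<in> {1..n}" for i
        using complex_variance_X[OF that gL[OF that]] infinite_gap_variance[OF _ gL[OF that]] by simp
      \<comment> \<open>As for \<open>f\<close>, the constant 1 suffices: all individual variances
        are 0, and \<open>2 / \<infinity>\<close> times 0 is 0.\<close>
      have le: "ereal 1 \<le> absolute_spectral_gap \<pi> P" by (simp add: PInf)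
      have sum0: "(\<Sum>i=1..n. complex_variance M (\<lambda>w. g i (X i w))) = 0"
        by (rule sum.neutral) (use zero in blast)
      have "complex_variance M (\<lambda>w. \<Sum>i=1..n. g i (X i w)) \<le> 0"
        using variance_bound_absolute[where g = g, OF gap zero_less_one order_refl le gL] unfolding sum0 by simp
      then show ?thesis unfolding sum0 PInf by simp
    qed (use absolute_gap_nonneg in simp)
  qed
  ultimately show ?thesis by simp
qed

end
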